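(* For every $h\in\mathbb R$ the limit $$\mu(h):=\lim_{n\uparrow\infty}-\frac1n\log\mathbb E\bigg[\frac1{Z^-_{n,h}}\bigg]$$ exists and satisfies $$\min\bigg\{\frac{f(h)}3,\frac{f(h)^2}{9\bar\gamma}\bigg\}\le\mu(h)\le f(h).$$ The function $\mu$ that maps $h$ to $\mu(h)$ is a $1$-Lipschitz continuous function on $\mathbb R$.
   Context: Notation: $\mathbb N=\{1,2,\ldots\}$, $\mathbb N_0=\{0\}\cup\mathbb N$. Renewal process: under a law $\mathsf P$ (expectation $\mathsf E$), $T_1,T_2,\ldots$ are i.i.d. $\mathbb N$-valued random variables with $p(t):=\mathsf P[T_1=t]=\ell(t)/t^{\alpha+1}>0$ for all $t\in\mathbb N$, where $\alpha\ge0$ and $\ell:[1,+\infty)\to[0,+\infty)$ is slowly varying at infinity. Set $S_0=0$, $S_i=T_1+\cdots+T_i$, $S=(S_i)_{i\in\mathbb N_0}$, and $X_a=\mathbf 1_{\{a\in S\}}$ for $a\in\mathbb N_0$. Disorder: $\Omega=\mathbb R^{\mathbb N_0}$ with its Borel $\sigma$-field carries a probability measure $\mathbb P$ (expectation $\mathbb E$) under which the coordinates of $\omega=(\omega_a)_{a\in\mathbb N_0}$ form a centered stationary Gaussian sequence with covariance function $\gamma(a)=\int_\Omega\omega_0\omega_a\,\mathbb P[d\omega]$, $a\in\mathbb N_0$, satisfying $\bar\gamma:=\sum_{a\in\mathbb N_0}|\gamma(a)|<+\infty$. In the degenerate case $\bar\gamma=0$ the quantity $f(h)^2/(9\bar\gamma)$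 is read as $+\infty$. Partition functions: for $n\in\mathbb N$, $h\in\mathbb R$, $\omega\in\Omega$, $Z_{n,h}(\omega)=\mathsf E\big[e^{\sum_{a=1}^n(h+\omega_a)X_a}X_n\big]$ and $Z^-_{n,h}(\omega)=e^{-(h+\omega_n)}Z_{n,h}(\omega)$. Free energy: $f(h)=\lim_{n\uparrow\infty}\mathbb E[\frac1n\log Z_{n,h}]$, which exists and is finite and non-negative for all $h\in\mathbb R$. *)

theory Defs
  imports "HOL-Probability.Probability"
begin

text \<open>Measurability is part of the usual definition of slow variation. The values of the
  function below \<open>1\<close> are irrelevant.\<close>

definition slowly_varying :: "(real \<Rightarrow> real) \<Rightarrow> bool" where
  "slowly_varying l \<longleftrightarrow>
     l \<in> borel_measurable (restrict_space borel {1..}) \<and>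
     (\<forall>c>0. ((\<lambda>x. l (c * x) / l x) \<longlongrightarrow> 1) at_top)"

text \<open>The inter-arrival times are \<open>T 1, T 2, \<dots>\<close>; the value \<open>T 0\<close> is never used.\<close>

definition renewal_process ::
    "'b measure \<Rightarrow> (nat \<Rightarrow> 'b \<Rightarrow> nat) \<Rightarrow> real \<Rightarrow> (real \<Rightarrow> real) \<Rightarrow> bool" where
  "renewal_process M T \<alpha> l \<longleftrightarrow>
     prob_space M \<and>
     (\<forall>i\<ge>1. \<forall>x\<in>space M. T i x \<ge> 1) \<and>
     prob_space.indep_vars M (\<lambda>_. count_space UNIV) T {1..} \<and>
     (\<forall>i\<ge>1. distr M (count_space UNIV) (T i) = distr M (count_space UNIV) (T 1)) \<and>
     \<alpha> \<ge> 0 \<and> (\<forall>x\<ge>1. l x \<ge> 0) \<and> slowly_varying l \<and>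
     (\<forall>t\<ge>1. measure M {x \<in> space M. T 1 x = t} = l (real t) / real t powr (\<alpha> + 1) \<and>
             measure M {x \<in> space M. T 1 x = t} > 0)"

definition renewal_time :: "(nat \<Rightarrow> 'b \<Rightarrow> nat) \<Rightarrow> nat \<Rightarrow> 'b \<Rightarrow> nat" where
  "renewal_time T i x = (\<Sum>j=1..i. T j x)"

definition renewal_indicator :: "(nat \<Rightarrow> 'b \<Rightarrow> nat) \<Rightarrow> nat \<Rightarrow> 'b \<Rightarrow> real" where
  "renewal_indicator T a x = indicator (range (\<lambda>i. renewal_time T i x)) a"

text \<open>Degenerate (almost surely constant) Gaussian variables are allowed.\<close>

definition gaussian_rv :: "'b measure \<Rightarrow> ('b \<Rightarrow> real) \<Rightarrow> bool" where
  "gaussian_rv M Y \<longleftrightarrow>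
     Y \<in> borel_measurable M \<and>
     (\<exists>m. (AE x in M. Y x = m) \<or>
          (\<exists>\<sigma>>0. distributed M lborel Y (normal_density m \<sigma>)))"

text \<open>Joint Gaussianity means that every finite linear combination of coordinates is Gaussian.
  The Borel \<open>\<sigma>\<close>-field of \<^typ>\<open>nat \<Rightarrow> real\<close> is the one of the product topology.\<close>

definition centered_stationary_gaussian :: "(nat \<Rightarrow> real) measure \<Rightarrow> bool" where
  "centered_stationary_gaussian P \<longleftrightarrow>
     prob_space P \<and> sets P = sets borel \<and>
     (\<forall>I (c :: nat \<Rightarrow> real). finite I \<longrightarrow> gaussian_rv P (\<lambda>\<omega>. \<Sum>a\<in>I. c a * \<omega> a)) \<and>
     (\<forall>a. (\<integral>\<omega>. \<omega> a \<partial>P) = 0) \<and>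
     (\<forall>k. distr P P (\<lambda>\<omega> a. \<omega> (a + k)) = P)"

definition covariance_fun :: "(nat \<Rightarrow> real) measure \<Rightarrow> nat \<Rightarrow> real" where
  "covariance_fun P a = (\<integral>\<omega>. \<omega> 0 * \<omega> a \<partial>P)"

definition gamma_bar :: "(nat \<Rightarrow> real) measure \<Rightarrow> real" where
  "gamma_bar P = (\<Sum>a. \<bar>covariance_fun P a\<bar>)"

definition partition_fun ::
    "'b measure \<Rightarrow> (nat \<Rightarrow> 'b \<Rightarrow> nat) \<Rightarrow> nat \<Rightarrow> real \<Rightarrow> (nat \<Rightarrow> real) \<Rightarrow> real" where
  "partition_fun M T n h \<omega> =
     (\<integral>x. exp (\<Sum>a=1..n. (h + \<omega> a) * renewal_indicator T a x) * renewal_indicator T n x \<partial>M)"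

definition partition_fun_minus ::
    "'b measure \<Rightarrow> (nat \<Rightarrow> 'b \<Rightarrow> nat) \<Rightarrow> nat \<Rightarrow> real \<Rightarrow> (nat \<Rightarrow> real) \<Rightarrow> real" where
  "partition_fun_minus M T n h \<omega> = exp (- (h + \<omega> n)) * partition_fun M T n h \<omega>"

definition free_energy ::
    "'b measure \<Rightarrow> (nat \<Rightarrow> 'b \<Rightarrow> nat) \<Rightarrow> (nat \<Rightarrow> real) measure \<Rightarrow> real \<Rightarrow> real" where
  "free_energy M T P h = lim (\<lambda>n. \<integral>\<omega>. 1 / real n * ln (partition_fun M T n h \<omega>) \<partial>P)"

definition mu_seq ::
    "'b measure \<Rightarrow> (nat \<Rightarrow> 'b \<Rightarrow> nat) \<Rightarrow> (nat \<Rightarrow> real) measure \<Rightarrow> real \<Rightarrow> nat \<Rightarrow> real" where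
  "mu_seq M T P h n = - (1 / real n) * ln (\<integral>\<omega>. 1 / partition_fun_minus M T n h \<omega> \<partial>P)"

definition mu ::
    "'b measure \<Rightarrow> (nat \<Rightarrow> 'b \<Rightarrow> nat) \<Rightarrow> (nat \<Rightarrow> real) measure \<Rightarrow> real \<Rightarrow> real" where
  "mu M T P h = lim (mu_seq M T P h)"

end

theory Submission
  imports Defs
begin

text \<open>
  The function \<open>Z\<close> is a positive combination of exponentials of sums of disorder variables. Hence
  \<open>log Z\<close> is convex with partial derivatives in \<open>[0, 1]\<close>, and averaging over an independent
  Gaussian perturbation changes \<open>1 / Z\<close> by a factor controlled by the covariance of the
  perturbation alone. If the perturbation is chosen to cancel the covariances between two blocks,
  this gives \<open>E (1 / (U V)) \<le> exp (6 \<Sum> \<bar>\<gamma>\<bar>) E (1 / U) E (1 / V)\<close>, the sum running over the pairs of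
  sites in different blocks. As the sum of these covariances is of smaller order than the length of
  the shorter block, \<open>log E (1 / Z\<^sup>-)\<close> is almost subadditive and \<open>\<mu>\<close> exists; \<open>\<mu> \<le> f\<close> is Jensen's
  inequality. Splitting the disorder into many small independent Gaussian increments gives, for
  \<open>r \<ge> 0\<close>, \<open>E (Z\<^sup>- powr - r) \<le> exp (- r E (log Z\<^sup>-) + 2 r\<^sup>2 \<gamma>' n)\<close> with \<open>\<gamma>' = gamma_bar P\<close>. Interpolating
  with the one-jump bound \<open>Z\<^sup>- \<ge> P (T\<^sub>1 = n)\<close> yields \<open>\<mu> \<ge> r f - 2 r\<^sup>2 \<gamma>'\<close> for \<open>0 \<le> r \<le> 1\<close>, and one
  takes \<open>r = min {1, f / (4 \<gamma>')}\<close>.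
\<close>

section \<open>Uniqueness of laws on sequences\<close>

text \<open>Summable covariances leave blocks of disorder dependent at any distance, so uncorrelated
  blocks have to be manufactured. For Gaussian laws this only asks for a positive semidefinite
  kernel with prescribed cross entries; the rank-one kernels of the vectors
  \<open>sqrt |K a b| * (e_a - sgn (K a b) * e_b)\<close> supply it, at the price of diagonal terms.
  Laws are compared through characteristic functions alone, hence the uniqueness theorem on
  sequences. The constant 6 is 3 times 2: the comparison of the original with the perturbed law is
  made three times (for the product and for each factor), and each one costs
  \<open>exp (2 * k)\<close>, where \<open>k\<close> is the sum of the absolute covariances across
  the blocks. No sharp concentration is required: the argument produces
  \<open>f ^ 2 / (8 * gamma_bar P)\<close>, although a Cauchy-Schwarz step doubles the optimal
  variance term. Slow variation enters only through the ratio \<open>l (2 * x) / l x\<close>. Both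
  limits are shown to exist along the full sequence, so they may be evaluated along powers of two,
  and only there must the one-jump probability be controlled.\<close>

text \<open>Dividing by the common mass \<open>m\<close>, which the case \<open>t = 0\<close>
  supplies, turns the weights into probability densities; the weighted images then have equal
  characteristic functions. The weights are what permits an induction over coordinates: they carry
  the information on the coordinates already treated.\<close>

lemma weighted_char_unique:
  fixes X w :: "'a \<Rightarrow> real" and Y v :: "'b \<Rightarrow> real"
  assumes M: "prob_space M" and N: "prob_space N"
    and X [measurable]: "X \<in> borel_measurable M" and Y [measurable]: "Y \<in> borel_measurable N"
    and w: "integrable M w" "\<And>x. 0 \<le> w x" and v: "integrable N v" "\<And>y. 0 \<le> v y"
    and cos_eq: "\<And>t. (\<integral>x. w x * cos (t * X x) \<partial>M) = (\<integral>y. v y * cos (t * Y y) \<partial>N)"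
    and sin_eq: "\<And>t. (\<integral>x. w x * sin (t * X x) \<partial>M) = (\<integral>y. v y * sin (t * Y y) \<partial>N)"
    and A [measurable]: "A \<in> sets borel"
  shows "(\<integral>x. w x * indicator A (X x) \<partial>M) = (\<integral>y. v y * indicator A (Y y) \<partial>N)"
proof -
  have mass: "(\<integral>x. w x \<partial>M) = (\<integral>y. v y \<partial>N)" using cos_eq[of 0] by simp
  define m where "m = (\<integral>x. w x \<partial>M)"
  \<comment> \<open>One statement for both sides; the type of \<open>L\<close> stays open because
    \<open>M\<close> and \<open>N\<close> live on different types.\<close>
  have aux: "real_distribution (distr (density L (\<lambda>x. ennreal (u x / m))) borel Z)
      \<and> char (distr (density L (\<lambda>x. ennreal (u x / m))) borel Z) t
        = complex_of_real ((\<integral>x. u x * cos (t * Z x) \<partial>L) / m)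
          + \<i> * complex_of_real ((\<integral>x. u x * sin (t * Z x) \<partial>L) / m)
      \<and> measure (distr (density L (\<lambda>x. ennreal (u x / m))) borel Z) A
        = (\<integral>x. u x * indicator A (Z x) \<partial>L) / m"
    if L: "prob_space L" and Z [measurable]: "Z \<in> borel_measurable L" and u: "integrable L u"
      and u0: "\<And>x. 0 \<le> u x" and um: "(\<integral>x. u x \<partial>L) = m" and m: "m > 0"
    for L :: "'c measure" and Z u :: "'c \<Rightarrow> real" and t
  proof -
    interpret L: prob_space L by fact
    have [measurable]: "u \<in> borel_measurable L" using u by simp
    let ?D = "density L (\<lambda>x. ennreal (u x / m))"
    have D: "prob_space ?D"
    proof
      have "emeasure ?D (space ?D) = (\<integral>\<^sup>+x. ennreal (u x / m) \<partial>L)"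
        by (simp add: emeasure_density cong: nn_integral_cong)
      also have "\<dots> = ennreal (\<integral>x. u x / m \<partial>L)"
        using u u0 m by (intro nn_integral_eq_integral) (auto simp: integrable_divide_zero)
      also have "\<dots> = 1" using um m by simp
      finally show "emeasure ?D (space ?D) = 1" .
    qed
    interpret D: prob_space ?D by fact
    have 1: "real_distribution (distr ?D borel Z)"
      by (rule D.real_distribution_distr) simp
    have dens: "(\<integral>x. g (Z x) \<partial>?D) = (\<integral>x. u x * g (Z x) \<partial>L) / m"
      if [measurable]: "g \<in> borel_measurable borel" for g :: "real \<Rightarrow> real"
      using m u0 by (subst integral_real_density) (auto simp flip: integral_divide_zero)
    have iexp: "integrable ?D (\<lambda>x. iexp (t * Z x))"
      by (rule D.integrable_iexp) auto
    have "char (distr ?D borel Z) t = (CLINT x|?D. iexp (t * Z x))"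
      unfolding char_def by (subst integral_distr) auto
    also have "\<dots> = complex_of_real (\<integral>x. cos (t * Z x) \<partial>?D) + \<i> * complex_of_real (\<integral>x. sin (t * Z x) \<partial>?D)"
    proof (rule complex_eqI)
      show "Re (CLINT x|?D. iexp (t * Z x)) = Re (complex_of_real (\<integral>x. cos (t * Z x) \<partial>?D) + \<i> * complex_of_real (\<integral>x. sin (t * Z x) \<partial>?D))"
        using integral_Re[OF iexp] by (simp add: Re_exp)
      show "Im (CLINT x|?D. iexp (t * Z x)) = Im (complex_of_real (\<integral>x. cos (t * Z x) \<partial>?D) + \<i> * complex_of_real (\<integral>x. sin (t * Z x) \<partial>?D))"
        using integral_Im[OF iexp] by (simp add: Im_exp)
    qed
    also have "\<dots> = complex_of_real ((\<integral>x. u x * cos (t * Z x) \<partial>L) / m)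
          + \<i> * complex_of_real ((\<integral>x. u x * sin (t * Z x) \<partial>L) / m)"
      using dens[of "\<lambda>z. cos (t * z)"] dens[of "\<lambda>z. sin (t * z)"] by simp
    finally have 2: "char (distr ?D borel Z) t = \<dots>" .
    interpret D': prob_space "distr ?D borel Z" using 1 by (simp add: real_distribution_def)
    have "measure (distr ?D borel Z) A = (\<integral>z. indicator A z \<partial>distr ?D borel Z)"
      by simp
    also have "\<dots> = (\<integral>x. indicator A (Z x) \<partial>?D)"
      by (subst integral_distr) auto
    also have "\<dots> = (\<integral>x. u x * indicator A (Z x) \<partial>L) / m"
      by (rule dens) simp
    finally show ?thesis using 1 2 by blast
  qed
  show ?thesis
  proof (cases "m = 0")
    case True
    have "AE x in M. w x = 0" "AE y in N. v y = 0"
      using True mass integral_nonneg_eq_0_iff_AE[OF w(1)] integral_nonneg_eq_0_iff_AE[OF v(1)] w(2) v(2)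
      by (simp_all add: m_def)
    then have "AE x in M. w x * indicator A (X x) = 0" "AE y in N. v y * indicator A (Y y) = 0" by auto
    then show ?thesis by (simp add: integral_eq_zero_AE)
  next
    case False
    then have m: "m > 0" using w by (simp add: m_def order_less_le)
    let ?DM = "distr (density M (\<lambda>x. ennreal (w x / m))) borel X"
    let ?DN = "distr (density N (\<lambda>x. ennreal (v x / m))) borel Y"
    note aM = aux[OF M X w m_def[symmetric] m]
    note aN = aux[OF N Y v mass[symmetric, folded m_def] m]
    have "char ?DM t = char ?DN t" for t
      using aM[of t] aN[of t] cos_eq[of t] sin_eq[of t] by simp
    then have "?DM = ?DN" using aM aN by (intro Levy_uniqueness) auto
    then have "measure ?DM A = measure ?DN A" by simp
    then show ?thesis using aM aN m by simp
  qed
qed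

abbreviation lin :: "nat set \<Rightarrow> (nat \<Rightarrow> real) \<Rightarrow> (nat \<Rightarrow> real) \<Rightarrow> real" where
  "lin I c z \<equiv> (\<Sum>a\<in>I. c a * z a)"

lemma borel_measurable_coordinate [measurable]:
  "(\<lambda>z. z a) \<in> borel_measurable (borel :: (nat \<Rightarrow> real) measure)"
  by (intro borel_measurable_continuous_onI continuous_on_product_coordinates)

lemma measurable_into_fun:
  fixes f :: "'a \<Rightarrow> nat \<Rightarrow> real"
  assumes "\<And>i. (\<lambda>x. f x i) \<in> borel_measurable M"
  shows "f \<in> borel_measurable M"
  by (rule measurable_coordinatewise_then_product) (use assms in auto)

lemma lin_add_single:
  assumes "finite I"
  obtains c' where "\<And>z. lin I c z + s * z k = lin (insert k I) c' z"
proof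
  fix z :: "nat \<Rightarrow> real"
  have "lin (insert k I) (\<lambda>a. (if a \<in> I then c a else 0) + (if a = k then s else 0)) z
      = (\<Sum>a\<in>insert k I. (if a \<in> I then c a * z a else 0)) + (\<Sum>a\<in>insert k I. (if a = k then s * z a else 0))"
    by (subst sum.distrib[symmetric], rule sum.cong) (auto simp: algebra_simps)
  also have "(\<Sum>a\<in>insert k I. (if a \<in> I then c a * z a else 0)) = lin I c z"
    using assms by (intro sum.mono_neutral_cong_right) auto
  also have "(\<Sum>a\<in>insert k I. (if a = k then s * z a else 0)) = s * z k"
    using assms by (subst sum.delta) auto
  finally show "lin I c z + s * z k = lin (insert k I) (\<lambda>a. (if a \<in> I then c a else 0) + (if a = k then s else 0)) z"
    by simp
qed

text \<open>By induction over the coordinates: a weight \<open>(1 + cos L) / 2\<close> or \<open>(1 + sin L) / 2\<close> is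
  nonnegative, so the one-dimensional uniqueness theorem applies to the next coordinate.\<close>

theorem cramer_wold_nat:
  fixes P Q :: "(nat \<Rightarrow> real) measure"
  assumes P: "prob_space P" "sets P = sets borel" and Q: "prob_space Q" "sets Q = sets borel"
    and cos_eq: "\<And>I c. finite I \<Longrightarrow> (\<integral>z. cos (lin I c z) \<partial>P) = (\<integral>z. cos (lin I c z) \<partial>Q)"
    and sin_eq: "\<And>I c. finite I \<Longrightarrow> (\<integral>z. sin (lin I c z) \<partial>P) = (\<integral>z. sin (lin I c z) \<partial>Q)"
  shows "P = Q"
proof -
  interpret P: prob_space P by fact
  interpret Q: prob_space Q by fact
  have meas [measurable_cong]: "sets P = sets borel" "sets Q = sets borel" by fact+
  \<comment> \<open>Mixed invariant: the coordinates in \<open>J\<close> are tested by indicators,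
    and in addition one trigonometric function of an arbitrary linear form is allowed. The freedom
    in the form lets the next coordinate be split off; with \<open>I = {}\<close> only the measure
    of a rectangle remains.\<close>
  have main: "(\<integral>z. (\<Prod>j\<in>J. indicator (A j) (z j)) * cos (lin I c z) \<partial>P)
            = (\<integral>z. (\<Prod>j\<in>J. indicator (A j) (z j)) * cos (lin I c z) \<partial>Q)
            \<and> (\<integral>z. (\<Prod>j\<in>J. indicator (A j) (z j)) * sin (lin I c z) \<partial>P)
            = (\<integral>z. (\<Prod>j\<in>J. indicator (A j) (z j)) * sin (lin I c z) \<partial>Q)"
    if "finite J" "finite I" and A: "\<And>j. j \<in> J \<Longrightarrow> A j \<in> sets borel" for J I c and A :: "nat \<Rightarrow> real set"
    using that
  proof (induction J arbitrary: I c rule: finite_induct)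
    case empty
    then show ?case using cos_eq sin_eq by simp
  next
    case (insert k J)
    define W :: "(nat \<Rightarrow> real) \<Rightarrow> real" where "W z = (\<Prod>j\<in>J. indicator (A j) (z j))" for z
    have W_meas [measurable]: "W \<in> borel_measurable borel"
      unfolding W_def using insert.prems by measurable
    have W01: "0 \<le> W z" "W z \<le> 1" for z
      by (auto simp: W_def intro!: prod_nonneg prod_le_1)
    have [measurable]: "A k \<in> sets borel" using insert.prems by simp
    have IH: "(\<integral>z. W z * cos (lin I c z) \<partial>P) = (\<integral>z. W z * cos (lin I c z) \<partial>Q)"
             "(\<integral>z. W z * sin (lin I c z) \<partial>P) = (\<integral>z. W z * sin (lin I c z) \<partial>Q)"
      if "finite I" for I c
      using insert.IH[OF that] insert.prems by (auto simp: W_def)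
    have IHs: "(\<integral>z. W z * cos (lin I c z + s * z k) \<partial>P) = (\<integral>z. W z * cos (lin I c z + s * z k) \<partial>Q)"
             "(\<integral>z. W z * sin (lin I c z + s * z k) \<partial>P) = (\<integral>z. W z * sin (lin I c z + s * z k) \<partial>Q)"
      if I: "finite I" for I c s
    proof -
      obtain c' where "\<And>z. lin I c z + s * z k = lin (insert k I) c' z"
        using lin_add_single[OF I] by blast
      then show "(\<integral>z. W z * cos (lin I c z + s * z k) \<partial>P) = (\<integral>z. W z * cos (lin I c z + s * z k) \<partial>Q)"
             "(\<integral>z. W z * sin (lin I c z + s * z k) \<partial>P) = (\<integral>z. W z * sin (lin I c z + s * z k) \<partial>Q)"
        using IH[of "insert k I" c'] I by simp_all
    qed
    have int: "integrable R (\<lambda>z. W z * f z)"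
      if "prob_space R" "sets R = sets borel" "f \<in> borel_measurable borel" "\<And>z. \<bar>f z\<bar> \<le> 1" for R f
    proof -
      interpret R: prob_space R by fact
      have [measurable_cong]: "sets R = sets borel" by fact
      have [measurable]: "f \<in> borel_measurable borel" by fact
      have "norm (W z * f z) \<le> 1" for z
        using mult_le_one[of "\<bar>W z\<bar>" "\<bar>f z\<bar>"] W01[of z] that(4)[of z] by (simp add: abs_mult)
      then show ?thesis
        by (intro R.integrable_const_bound[of _ 1] AE_I2) measurable
    qed
    define bm where "bm f \<longleftrightarrow> f \<in> borel_measurable borel \<and> (\<forall>z. \<bar>f z\<bar> \<le> (1 :: real))" for f :: "(nat \<Rightarrow> real) \<Rightarrow> real"
    define same where "same f \<longleftrightarrow> (\<integral>z. W z * f z \<partial>P) = (\<integral>z. W z * f z \<partial>Q)" for f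
    have intPQ: "integrable P (\<lambda>z. W z * f z)" "integrable Q (\<lambda>z. W z * f z)" if "bm f" for f
      using int P Q that unfolding bm_def by blast+
    have bm_mult: "bm (\<lambda>z. f z * g z)" if "bm f" "bm g" for f g
      using that by (auto simp: bm_def abs_mult mult_le_one)
    have bm1: "bm (\<lambda>_. 1)" and bm_ind: "bm (\<lambda>z. indicator (A k) (z k))"
      by (auto simp: bm_def indicator_def)
    have same_lincomb: "same (\<lambda>z. (a * f z + b * g z) / 2)" if "bm f" "bm g" "same f" "same g" for f g a b
    proof -
      have "W z * ((a * f z + b * g z) / 2) = (a * (W z * f z) + b * (W z * g z)) / 2" for z
        by (simp add: algebra_simps)
      then show ?thesis using that intPQ[of f] intPQ[of g] by (simp add: same_def)
    qed
    note half = same_lincomb[of _ _ 1 1, simplified] same_lincomb[of _ _ 1 "- 1", simplified]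
    have same_trig: "same (\<lambda>z. f (lin B c z + s * z k))" if "finite B" "f = cos \<or> f = sin" for f B c s
      using IHs[OF that(1)] that(2) by (auto simp: same_def)
    have bm_trig: "bm (\<lambda>z. f (lin B c z + s * z k))" if "f = cos \<or> f = sin" for f B c s
      using that by (auto simp: bm_def)
    \<comment> \<open>Products of trigonometric functions of two linear forms are sums of
      trigonometric functions of linear forms, to which the induction hypothesis applies.\<close>
    have trig: "cos x * cos y = (cos (x + y) + cos (x + - y)) / 2"
         "cos x * sin y = (sin (x + y) - sin (x + - y)) / 2"
         "sin x * cos y = (sin (x + y) + sin (x + - y)) / 2"
         "sin x * sin y = (cos (x + - y) - cos (x + y)) / 2" for x y :: real
      by (simp_all add: cos_add sin_add cos_diff sin_diff)
    have same_prod: "same (\<lambda>z. g (lin I c z) * f (t * z k))"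
      if "g = cos \<or> g = sin" "f = cos \<or> f = sin" for f g t
    proof -
      note b = bm_trig[of _ c I t] bm_trig[of _ c I "- t", simplified]
      note s = same_trig[OF insert.prems(1), of _ c t] same_trig[OF insert.prems(1), of _ c "- t", simplified]
      show ?thesis using that by (elim disjE) (simp_all add: trig half b s)
    qed
    have ind: "same (\<lambda>z. w z * indicator (A k) (z k))"
      if w: "bm w" "\<And>z. 0 \<le> w z"
        and wf: "\<And>f t. f = cos \<or> f = sin \<Longrightarrow> same (\<lambda>z. w z * f (t * z k))" for w
    proof -
      have "(\<integral>z. (W z * w z) * indicator (A k) (z k) \<partial>P) = (\<integral>z. (W z * w z) * indicator (A k) (z k) \<partial>Q)"
        using P(1) Q(1) intPQ[OF w(1)] W01 w(2) wf[of cos] wf[of sin]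
        by (intro weighted_char_unique) (simp_all add: same_def mult.assoc)
      then show ?thesis by (simp add: same_def mult.assoc)
    qed
    have fin: "(\<integral>z. indicator (A k) (z k) * W z * g (lin I c z) \<partial>P) = (\<integral>z. indicator (A k) (z k) * W z * g (lin I c z) \<partial>Q)"
      if g: "g = cos \<or> g = sin" for g
    proof -
      define h where "h z = (1 + g (lin I c z)) / 2" for z
      have bg: "bm (\<lambda>z. g (lin I c z))" using bm_trig[OF g, of c I 0] by simp
      have g1: "- 1 \<le> g x" "g x \<le> 1" for x using g by auto
      have h0: "0 \<le> h z" "\<bar>h z\<bar> \<le> 1" for z
        using g1[of "lin I c z"] unfolding h_def by (simp_all add: abs_le_iff)
      have h: "bm h" using bg h0 by (auto simp: bm_def h_def[abs_def])
      have "same (\<lambda>z. 1 * indicator (A k) (z k))"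
        using same_trig[of "{}"] by (intro ind bm1) auto
      moreover have "same (\<lambda>z. h z * indicator (A k) (z k))"
      proof (rule ind[OF h h0(1)])
        fix f :: "real \<Rightarrow> real" and t assume f: "f = cos \<or> f = sin"
        have "same (\<lambda>z. (f (t * z k) + g (lin I c z) * f (t * z k)) / 2)"
          using bm_trig[OF f, of _ "{}" t] same_trig[of "{}", OF _ f, of _ t]
          by (intro half bm_mult bg same_prod f g) simp_all
        then show "same (\<lambda>z. h z * f (t * z k))" by (simp add: h_def distrib_right)
      qed
      \<comment> \<open>Undoes the shift that made the weight nonnegative:
        \<open>g = 2 * h - 1\<close>.\<close>
      ultimately have "same (\<lambda>z. (4 * (h z * indicator (A k) (z k)) + - 2 * (1 * indicator (A k) (z k))) / 2)"
        using bm_ind h by (intro same_lincomb bm_mult bm1)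
      moreover have "(4 * (h z * x) + - 2 * (1 * x)) / 2 = x * g (lin I c z)" for z x
        by (simp add: h_def algebra_simps)
      ultimately have "same (\<lambda>z. indicator (A k) (z k) * g (lin I c z))" by (simp only:)
      then show ?thesis by (simp add: same_def mult_ac)
    qed
    show ?case
      using insert.hyps fin by (auto simp: W_def)
  qed
  have PiM: "sets (PiM UNIV (\<lambda>_::nat. borel :: real measure)) = sets borel"
    by (rule sets_PiM_equal_borel)
  show "P = Q"
  proof (rule measure_eqI_PiM_infinite)
    show "sets P = sets (PiM UNIV (\<lambda>_::nat. borel :: real measure))" "sets Q = sets (PiM UNIV (\<lambda>_::nat. borel :: real measure))"
      using P Q PiM by auto
    show "finite_measure P" by (rule P.finite_measure_axioms)
    fix A :: "nat \<Rightarrow> real set" and J :: "nat set"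
    assume J: "finite J" and A: "\<And>i. i \<in> J \<Longrightarrow> A i \<in> sets borel"
    let ?E = "prod_emb UNIV (\<lambda>_::nat. borel :: real measure) J (Pi\<^sub>E J A)"
    have E: "?E = {z. \<forall>j\<in>J. z j \<in> A j}"
      by (auto simp: prod_emb_def PiE_def space_PiM Pi_iff)
    have Em: "?E \<in> sets borel"
      using A J by (subst PiM[symmetric], intro sets_PiM_I) auto
    have ind: "(\<Prod>j\<in>J. indicator (A j) (z j)) = (indicator ?E z :: real)" for z
      unfolding E using J by (simp add: indicator_def prod_zero_iff)
    have "measure P ?E = measure Q ?E"
      using main[of J "{}" A "\<lambda>_. 0"] J A P Q Em by (simp add: ind)
    then show "emeasure P ?E = emeasure Q ?E"
      by (simp add: P.emeasure_eq_measure Q.emeasure_eq_measure)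
  qed
qed

section \<open>Gaussian laws on sequences\<close>

definition quad :: "nat set \<Rightarrow> (nat \<Rightarrow> nat \<Rightarrow> real) \<Rightarrow> (nat \<Rightarrow> real) \<Rightarrow> real" where
  "quad I K c = (\<Sum>a\<in>I. \<Sum>b\<in>I. c a * c b * K a b)"

text \<open>Encoded by the characteristic function, split into real and imaginary part, so that
  uniqueness, sums and rescalings become computations with kernels and degenerate laws are included.
  That \<open>K\<close> is positive semidefinite is a consequence, see
  \<open>quad_nonneg\<close>.\<close>

definition gaussian_law :: "(nat \<Rightarrow> real) measure \<Rightarrow> (nat \<Rightarrow> nat \<Rightarrow> real) \<Rightarrow> bool" where
  "gaussian_law P K \<longleftrightarrow> prob_space P \<and> sets P = sets borel \<and>
     (\<forall>I c. finite I \<longrightarrow> (\<integral>z. cos (lin I c z) \<partial>P) = exp (- quad I K c / 2) \<and>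
                        (\<integral>z. sin (lin I c z) \<partial>P) = 0)"

lemma gaussian_lawD:
  assumes "gaussian_law P K"
  shows "prob_space P" "sets P = sets borel"
    and "finite I \<Longrightarrow> (\<integral>z. cos (lin I c z) \<partial>P) = exp (- quad I K c / 2)"
    and "finite I \<Longrightarrow> (\<integral>z. sin (lin I c z) \<partial>P) = 0"
  using assms by (auto simp: gaussian_law_def)

lemma gaussian_law_unique: "gaussian_law P K \<Longrightarrow> gaussian_law Q K \<Longrightarrow> P = Q"
  by (rule cramer_wold_nat) (auto simp: gaussian_law_def)

lemma quad_scale: "quad I K (\<lambda>a. t * c a) = t\<^sup>2 * quad I K c"
  by (simp add: quad_def sum_distrib_left power2_eq_square mult_ac)

lemma quad_add: "quad I (\<lambda>a b. K a b + L a b) c = quad I K c + quad I L c"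
  by (simp add: quad_def sum.distrib algebra_simps)

lemma quad_abs_le:
  assumes "\<And>a. a \<in> I \<Longrightarrow> \<bar>c a\<bar> \<le> C"
  shows "quad I K c \<le> C\<^sup>2 * (\<Sum>a\<in>I. \<Sum>b\<in>I. \<bar>K a b\<bar>)"
proof -
  have "c a * c b * K a b \<le> C\<^sup>2 * \<bar>K a b\<bar>" if "a \<in> I" "b \<in> I" for a b
  proof -
    have "c a * c b * K a b \<le> \<bar>c a\<bar> * \<bar>c b\<bar> * \<bar>K a b\<bar>"
      by (metis abs_ge_self abs_mult)
    also have "\<dots> \<le> (C * C) * \<bar>K a b\<bar>"
      using assms[OF that(1)] assms[OF that(2)] by (intro mult_right_mono mult_mono) auto
    finally show ?thesis by (simp add: power2_eq_square)
  qed
  then show ?thesis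
    unfolding quad_def sum_distrib_left by (intro sum_mono) auto
qed

text \<open>The mean of a cosine is at most 1, so the exponent in the characteristic function cannot
  be positive.\<close>

lemma quad_nonneg:
  assumes "gaussian_law P K" "finite I"
  shows "0 \<le> quad I K c"
proof -
  interpret prob_space P by (rule gaussian_lawD[OF assms(1)])
  have "exp (- quad I K c / 2) \<le> 1"
    unfolding gaussian_lawD(3)[OF assms, of c, symmetric]
    by (rule integral_le_const[OF _ AE_I2])
       (use gaussian_lawD(2)[OF assms(1)] in \<open>auto intro!: integrable_const_bound[of _ 1]
         simp: measurable_cong_sets[OF gaussian_lawD(2)[OF assms(1)] refl]\<close>)
  then show ?thesis by simp
qed

text \<open>A multiple of a linear form is a linear form, so the definition determines the whole
  characteristic function. Moments of linear forms thereby reduce to the standard normal law; the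
  factor \<open>sqrt (quad I K c)\<close> is allowed to vanish.\<close>

lemma gaussian_law_lin_distr:
  assumes "gaussian_law P K" "finite I"
  shows "distr P borel (lin I c) = distr std_normal_distribution borel (\<lambda>x. sqrt (quad I K c) * x)"
proof (rule Levy_uniqueness)
  interpret prob_space P by (rule gaussian_lawD[OF assms(1)])
  have [measurable_cong]: "sets P = sets borel" by (rule gaussian_lawD[OF assms(1)])
  interpret std: real_distribution std_normal_distribution by (rule real_dist_normal_dist)
  show "real_distribution (distr P borel (lin I c))" by (rule real_distribution_distr) simp
  show "real_distribution (distr std_normal_distribution borel (\<lambda>x. sqrt (quad I K c) * x))"
    by (rule std.real_distribution_distr) simp
  show "char (distr P borel (lin I c)) = char (distr std_normal_distribution borel (\<lambda>x. sqrt (quad I K c) * x))"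
  proof
    fix t
    have iexp: "integrable P (\<lambda>x. iexp (t * lin I c x))" by (rule integrable_iexp) auto
    have lin: "t * lin I c x = lin I (\<lambda>a. t * c a) x" for x
      by (simp add: sum_distrib_left mult_ac)
    have "char (distr P borel (lin I c)) t = (CLINT x|P. iexp (t * lin I c x))"
      unfolding char_def by (subst integral_distr) auto
    also have "\<dots> = complex_of_real (\<integral>x. cos (t * lin I c x) \<partial>P) + \<i> * complex_of_real (\<integral>x. sin (t * lin I c x) \<partial>P)"
      by (rule complex_eqI) (use integral_Re[OF iexp] integral_Im[OF iexp] in \<open>simp_all add: Re_exp Im_exp\<close>)
    also have "\<dots> = complex_of_real (exp (- (t\<^sup>2 * quad I K c) / 2))"
      unfolding lin gaussian_lawD(3)[OF assms] gaussian_lawD(4)[OF assms] quad_scale by simp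
    also have "\<dots> = char std_normal_distribution (t * sqrt (quad I K c))"
      using quad_nonneg[OF assms, of c] by (simp add: char_std_normal_distribution power_mult_distrib)
    also have "\<dots> = char (distr std_normal_distribution borel (\<lambda>x. sqrt (quad I K c) * x)) t"
      unfolding char_def by (subst integral_distr) (auto simp: mult_ac)
    finally show "char (distr P borel (lin I c)) t = \<dots>" .
  qed
qed

lemma std_normal_mgf:
  "integrable std_normal_distribution (\<lambda>x. exp (t * x))"
  "(\<integral>x. exp (t * x) \<partial>std_normal_distribution) = exp (t\<^sup>2 / 2)"
proof -
  have *: "std_normal_density x * exp (t * x) = exp (t\<^sup>2 / 2) * normal_density t 1 x" for x
    by (simp add: normal_density_def mult_exp_exp field_simps power2_eq_square)
  have "integrable lborel (\<lambda>x. std_normal_density x * exp (t * x))"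
    unfolding * by simp
  then show "integrable std_normal_distribution (\<lambda>x. exp (t * x))"
    by (subst integrable_real_density) auto
  show "(\<integral>x. exp (t * x) \<partial>std_normal_distribution) = exp (t\<^sup>2 / 2)"
    by (subst integral_real_density) (auto simp: *)
qed

lemma gaussian_law_lin_transfer:
  fixes f :: "real \<Rightarrow> real"
  assumes P: "gaussian_law P K" "finite I" and f: "f \<in> borel_measurable borel"
  shows "integrable P (\<lambda>z. f (lin I c z))
      \<longleftrightarrow> integrable std_normal_distribution (\<lambda>x. f (sqrt (quad I K c) * x))"
    and "(\<integral>z. f (lin I c z) \<partial>P) = (\<integral>x. f (sqrt (quad I K c) * x) \<partial>std_normal_distribution)"
proof -
  have m1: "lin I c \<in> borel_measurable P"
    by (simp add: gaussian_lawD(2)[OF P(1)] cong: measurable_cong_sets)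
  have m2: "(\<lambda>x. sqrt (quad I K c) * x) \<in> borel_measurable std_normal_distribution" by simp
  show "integrable P (\<lambda>z. f (lin I c z))
      \<longleftrightarrow> integrable std_normal_distribution (\<lambda>x. f (sqrt (quad I K c) * x))"
    unfolding integrable_distr_eq[OF m1 f, symmetric] integrable_distr_eq[OF m2 f, symmetric]
      gaussian_law_lin_distr[OF P] ..
  show "(\<integral>z. f (lin I c z) \<partial>P) = (\<integral>x. f (sqrt (quad I K c) * x) \<partial>std_normal_distribution)"
    unfolding integral_distr[OF m1 f, symmetric] integral_distr[OF m2 f, symmetric]
      gaussian_law_lin_distr[OF P] ..
qed

lemma gaussian_law_mgf:
  assumes "gaussian_law P K" "finite I"
  shows "integrable P (\<lambda>z. exp (lin I c z))"
    and "(\<integral>z. exp (lin I c z) \<partial>P) = exp (quad I K c / 2)"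
  using gaussian_law_lin_transfer[OF assms, of exp c] quad_nonneg[OF assms, of c]
  by (simp_all add: std_normal_mgf)

lemma gaussian_law_lin_mean:
  assumes "gaussian_law P K" "finite I"
  shows "integrable P (lin I c)" and "(\<integral>z. lin I c z \<partial>P) = 0"
proof -
  have m: "(\<lambda>x::real. x) \<in> borel_measurable borel" "(\<lambda>x::real. x) \<in> borel_measurable lborel"
    by (rule measurable_ident_sets, simp)+
  have "integrable std_normal_distribution (\<lambda>x. x)"
    using integrable_std_normal_moment[of 1]
    by (subst integrable_real_density[of std_normal_density lborel "\<lambda>x. x", OF _ _ m(2)]) simp_all
  moreover have "(\<integral>x. x \<partial>std_normal_distribution) = 0"
    using integral_std_normal_moment_odd[of 0]
    by (subst integral_real_density[of std_normal_density lborel "\<lambda>x. x", OF _ _ m(2)]) simp_all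
  ultimately show "integrable P (lin I c)" "(\<integral>z. lin I c z \<partial>P) = 0"
    unfolding gaussian_law_lin_transfer[OF assms m(1)] by simp_all
qed

text \<open>The exponent coincides with one of the finitely many signed linear forms, so the
  function is dominated by the sum of the exponentials of all of them, each of which has a finite
  mean.\<close>

lemma gaussian_law_integrable_exp_abs:
  assumes P: "gaussian_law P K" and J: "finite J"
  shows "integrable P (\<lambda>z. exp (s * (\<Sum>a\<in>J. \<bar>z a\<bar>)))"
proof (rule Bochner_Integration.integrable_bound)
  let ?c = "\<lambda>B a. if a \<in> B then s else - s"
  show "integrable P (\<lambda>z. \<Sum>B\<in>Pow J. exp (lin J (?c B) z))"
    using gaussian_law_mgf(1)[OF P J] by simp
  have "exp (s * (\<Sum>a\<in>J. \<bar>z a\<bar>)) \<le> (\<Sum>B\<in>Pow J. exp (lin J (?c B) z))" for z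
  proof -
    have "s * (\<Sum>a\<in>J. \<bar>z a\<bar>) = lin J (?c {a \<in> J. 0 \<le> z a}) z"
      unfolding sum_distrib_left by (rule sum.cong) auto
    also have "exp \<dots> \<le> (\<Sum>B\<in>Pow J. exp (lin J (?c B) z))"
      by (rule member_le_sum) (use J in auto)
    finally show ?thesis .
  qed
  then show "AE z in P. norm (exp (s * (\<Sum>a\<in>J. \<bar>z a\<bar>))) \<le> norm (\<Sum>B\<in>Pow J. exp (lin J (?c B) z))"
    by (auto simp: sum_nonneg)
  show "(\<lambda>z. exp (s * (\<Sum>a\<in>J. \<bar>z a\<bar>))) \<in> borel_measurable P"
    by (simp add: gaussian_lawD(2)[OF P] cong: measurable_cong_sets)
qed

lemma gaussian_law_integrable_dominated:
  assumes P: "gaussian_law P K" and J: "finite J" and f: "f \<in> borel_measurable borel"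
    and le: "\<And>z. \<bar>f z\<bar> \<le> C * exp (s * (\<Sum>a\<in>J. \<bar>z a\<bar>))"
  shows "integrable P f"
proof (rule Bochner_Integration.integrable_bound)
  show "integrable P (\<lambda>z. C * exp (s * (\<Sum>a\<in>J. \<bar>z a\<bar>)))"
    using gaussian_law_integrable_exp_abs[OF P J] by auto
  show "f \<in> borel_measurable P"
    using f by (simp cong: measurable_cong_sets add: gaussian_lawD(2)[OF P])
  show "AE z in P. norm (f z) \<le> norm (C * exp (s * (\<Sum>a\<in>J. \<bar>z a\<bar>)))"
  proof (rule AE_I2)
    fix z
    show "norm (f z) \<le> norm (C * exp (s * (\<Sum>a\<in>J. \<bar>z a\<bar>)))"
      using le[of z] by (metis abs_ge_self order.trans real_norm_def)
  qed
qed

section \<open>Sums and coordinatewise rescalings of Gaussian sequences\<close>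

definition conv_law :: "(nat \<Rightarrow> real) measure \<Rightarrow> (nat \<Rightarrow> real) measure \<Rightarrow> (nat \<Rightarrow> real) measure" where
  "conv_law P Q = distr (P \<Otimes>\<^sub>M Q) borel (\<lambda>(x, y) a. x a + y a)"

lemma measurable_add_fun [measurable]:
  "(\<lambda>(x, y) a. x a + y a) \<in> (borel :: (nat \<Rightarrow> real) measure) \<Otimes>\<^sub>M (borel :: (nat \<Rightarrow> real) measure) \<rightarrow>\<^sub>M borel"
  unfolding split_beta
  by (rule measurable_into_fun)
     (intro borel_measurable_add measurable_compose[OF measurable_fst borel_measurable_coordinate]
       measurable_compose[OF measurable_snd borel_measurable_coordinate])

lemma measurable_scale_fun [measurable]:
  "(\<lambda>x a. s a * x a) \<in> (borel :: (nat \<Rightarrow> real) measure) \<rightarrow>\<^sub>M borel"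
  by (rule measurable_into_fun) measurable

lemma nn_integral_conv_law:
  assumes P: "prob_space P" "sets P = sets borel" and Q: "prob_space Q" "sets Q = sets borel"
    and f: "f \<in> borel_measurable borel"
  shows "(\<integral>\<^sup>+z. f z \<partial>conv_law P Q) = (\<integral>\<^sup>+x. \<integral>\<^sup>+y. f (\<lambda>a. x a + y a) \<partial>Q \<partial>P)"
proof -
  interpret P: prob_space P by fact
  interpret Q: prob_space Q by fact
  have [measurable_cong]: "sets P = sets borel" "sets Q = sets borel" by fact+
  have [measurable]: "f \<in> borel_measurable borel" by fact
  have "(\<integral>\<^sup>+z. f z \<partial>conv_law P Q) = (\<integral>\<^sup>+p. f (case p of (x, y) \<Rightarrow> \<lambda>a. x a + y a) \<partial>(P \<Otimes>\<^sub>M Q))"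
    unfolding conv_law_def by (subst nn_integral_distr) auto
  also have "\<dots> = (\<integral>\<^sup>+x. \<integral>\<^sup>+y. f (\<lambda>a. x a + y a) \<partial>Q \<partial>P)"
    by (subst Q.nn_integral_fst[symmetric]) auto
  finally show ?thesis .
qed

lemma integral_conv_law:
  fixes f :: "(nat \<Rightarrow> real) \<Rightarrow> real"
  assumes P: "prob_space P" "sets P = sets borel" and Q: "prob_space Q" "sets Q = sets borel"
    and f: "integrable (conv_law P Q) f"
  shows "(\<integral>z. f z \<partial>conv_law P Q) = (\<integral>x. \<integral>y. f (\<lambda>a. x a + y a) \<partial>Q \<partial>P)"
proof -
  interpret P: prob_space P by fact
  interpret Q: prob_space Q by fact
  interpret PQ: pair_prob_space P Q ..
  have [measurable_cong]: "sets P = sets borel" "sets Q = sets borel" by fact+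
  have [measurable]: "f \<in> borel_measurable borel"
    using borel_measurable_integrable[OF f] by (simp add: conv_law_def)
  have i: "integrable (P \<Otimes>\<^sub>M Q) (\<lambda>p. f (case p of (x, y) \<Rightarrow> \<lambda>a. x a + y a))"
    using f unfolding conv_law_def by (subst (asm) integrable_distr_eq) auto
  have "(\<integral>z. f z \<partial>conv_law P Q) = (\<integral>p. f (case p of (x, y) \<Rightarrow> \<lambda>a. x a + y a) \<partial>(P \<Otimes>\<^sub>M Q))"
    unfolding conv_law_def by (subst integral_distr) auto
  also have "\<dots> = (\<integral>x. \<integral>y. f (\<lambda>a. x a + y a) \<partial>Q \<partial>P)"
    using PQ.integral_fst'[OF i] by simp
  finally show ?thesis .
qed

lemma gaussian_law_conv:
  assumes P: "gaussian_law P K" and Q: "gaussian_law Q L"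
  shows "gaussian_law (conv_law P Q) (\<lambda>a b. K a b + L a b)"
proof -
  note PD = gaussian_lawD[OF P] and QD = gaussian_lawD[OF Q]
  interpret P: prob_space P by (rule PD)
  interpret Q: prob_space Q by (rule QD)
  interpret PQ: pair_prob_space P Q ..
  have [measurable_cong]: "sets P = sets borel" "sets Q = sets borel" using PD QD by auto
  interpret C: prob_space "conv_law P Q"
    unfolding conv_law_def by (rule PQ.prob_space_distr) simp
  have s: "sets (conv_law P Q) = sets borel" by (simp add: conv_law_def)
  note [measurable_cong] = s
  have "(\<integral>z. cos (lin I c z) \<partial>conv_law P Q) = exp (- quad I (\<lambda>a b. K a b + L a b) c / 2)
    \<and> (\<integral>z. sin (lin I c z) \<partial>conv_law P Q) = 0" if I: "finite I" for I c
  proof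
    have add: "lin I c (\<lambda>a. x a + y a) = lin I c x + lin I c y" for x y
      by (simp add: algebra_simps sum.distrib)
    have iQ: "integrable Q (\<lambda>y. cos (lin I c y))" "integrable Q (\<lambda>y. sin (lin I c y))"
      by (auto intro!: Q.integrable_const_bound[of _ 1])
    have iP: "integrable P (\<lambda>y. cos (lin I c y))" "integrable P (\<lambda>y. sin (lin I c y))"
      by (auto intro!: P.integrable_const_bound[of _ 1])
    have iC: "integrable (conv_law P Q) (\<lambda>y. cos (lin I c y))" "integrable (conv_law P Q) (\<lambda>y. sin (lin I c y))"
      by (auto intro!: C.integrable_const_bound[of _ 1])
    have "(\<integral>z. cos (lin I c z) \<partial>conv_law P Q) = (\<integral>x. \<integral>y. cos (lin I c x) * cos (lin I c y) - sin (lin I c x) * sin (lin I c y) \<partial>Q \<partial>P)"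
      by (subst integral_conv_law[OF PD(1,2) QD(1,2) iC(1)]) (simp only: add cos_add)
    also have "\<dots> = exp (- quad I K c / 2) * exp (- quad I L c / 2)"
      using iQ iP PD(3,4)[OF I] QD(3,4)[OF I] by simp
    finally show "(\<integral>z. cos (lin I c z) \<partial>conv_law P Q) = exp (- quad I (\<lambda>a b. K a b + L a b) c / 2)"
      by (simp add: quad_add mult_exp_exp add_divide_distrib)
    have "(\<integral>z. sin (lin I c z) \<partial>conv_law P Q) = (\<integral>x. \<integral>y. sin (lin I c x) * cos (lin I c y) + cos (lin I c x) * sin (lin I c y) \<partial>Q \<partial>P)"
      by (subst integral_conv_law[OF PD(1,2) QD(1,2) iC(2)]) (simp only: add sin_add)
    also have "\<dots> = 0"
      using iQ iP PD(3,4)[OF I] QD(3,4)[OF I] by simp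
    finally show "(\<integral>z. sin (lin I c z) \<partial>conv_law P Q) = 0" .
  qed
  then show ?thesis using C.prob_space_axioms s by (simp add: gaussian_law_def)
qed

text \<open>The factors depend on the coordinate: constants produce small increments of the
  disorder, indicators erase the coordinates outside a block.\<close>

definition scale_law :: "(nat \<Rightarrow> real) \<Rightarrow> (nat \<Rightarrow> real) measure \<Rightarrow> (nat \<Rightarrow> real) measure" where
  "scale_law s P = distr P borel (\<lambda>z a. s a * z a)"

lemma gaussian_law_scale:
  assumes P: "gaussian_law P K"
  shows "gaussian_law (scale_law s P) (\<lambda>a b. s a * s b * K a b)"
proof -
  note PD = gaussian_lawD[OF P]
  interpret P: prob_space P by (rule PD)
  have [measurable_cong]: "sets P = sets borel" using PD by auto
  have lin: "lin I c (\<lambda>a. s a * z a) = lin I (\<lambda>a. c a * s a) z" for I c z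
    by (simp add: mult_ac)
  have quad: "quad I K (\<lambda>a. c a * s a) = quad I (\<lambda>a b. s a * s b * K a b) c" for I c
    by (simp add: quad_def mult_ac)
  have "(\<integral>z. g (lin I c z) \<partial>scale_law s P) = (\<integral>z. g (lin I (\<lambda>a. c a * s a) z) \<partial>P)"
    if [measurable]: "g \<in> borel_measurable borel" for g :: "real \<Rightarrow> real" and I c
    unfolding scale_law_def by (subst integral_distr) (auto simp: lin)
  then show ?thesis
    using PD(3,4) by (auto simp: gaussian_law_def scale_law_def quad intro!: P.prob_space_distr)
qed

lemma std_normal_cos_sin:
  "(\<integral>x. cos (s * x) \<partial>std_normal_distribution) = exp (- s\<^sup>2 / 2)"
  "(\<integral>x. sin (s * x) \<partial>std_normal_distribution) = 0"
proof -
  interpret std: real_distribution std_normal_distribution by (rule real_dist_normal_dist)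
  have iexp: "integrable std_normal_distribution (\<lambda>x. iexp (s * x))" by (rule std.integrable_iexp) auto
  show "(\<integral>x. cos (s * x) \<partial>std_normal_distribution) = exp (- s\<^sup>2 / 2)"
    "(\<integral>x. sin (s * x) \<partial>std_normal_distribution) = 0"
    using integral_Re[OF iexp] integral_Im[OF iexp] fun_cong[OF char_std_normal_distribution, of s]
    by (simp_all add: char_def Re_exp Im_exp)
qed

text \<open>One standard normal variable times a fixed vector. Convolutions of such laws realise the
  perturbation in the decoupling argument.\<close>

lemma gaussian_law_rank_one:
  "gaussian_law (distr std_normal_distribution borel (\<lambda>t a. v a * t)) (\<lambda>a b. v a * v b)"
proof -
  interpret std: real_distribution std_normal_distribution by (rule real_dist_normal_dist)
  have [measurable]: "(\<lambda>t a. v a * t) \<in> std_normal_distribution \<rightarrow>\<^sub>M (borel :: (nat \<Rightarrow> real) measure)"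
    by (rule measurable_into_fun) auto
  have lin: "lin I c (\<lambda>a. v a * t) = lin I c v * t" for I c t
    by (simp add: sum_distrib_right mult.assoc)
  have quad: "quad I (\<lambda>a b. v a * v b) c = (lin I c v)\<^sup>2" for I c
    by (simp add: quad_def power2_eq_square sum_product mult_ac)
  show ?thesis
    by (auto simp: gaussian_law_def integral_distr lin quad std_normal_cos_sin intro!: std.prob_space_distr)
qed

section \<open>Positive combinations of exponentials\<close>

text \<open>The crude remainder suffices: it is used for increments of size
  \<open>1 / sqrt k\<close>, where its square is of order \<open>1 / k ^ 2\<close>, so that
  \<open>k\<close> steps leave an error of order \<open>1 / k\<close>.\<close>

lemma exp_le_quadratic: "exp t \<le> 1 + t + t\<^sup>2 * exp \<bar>t\<bar>" for t :: real
proof -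
  obtain s where s: "\<bar>s\<bar> \<le> \<bar>t\<bar>" "exp t = (\<Sum>m<2. t ^ m / fact m) + exp s / fact 2 * t ^ 2"
    using Maclaurin_exp_le[of t 2] by blast
  have "exp s / fact 2 * t ^ 2 \<le> exp \<bar>t\<bar> * t\<^sup>2"
  proof (rule mult_right_mono)
    have "exp s \<le> exp \<bar>t\<bar>" using s(1) by simp
    moreover have "exp s / fact 2 \<le> exp s" by (simp add: numeral_2_eq_2)
    ultimately show "exp s / fact 2 \<le> exp \<bar>t\<bar>" by linarith
  qed simp
  then show ?thesis using s(2) by (simp add: numeral_2_eq_2 mult.commute)
qed

text \<open>The third-order Taylor remainder has the sign of \<open>- t ^ 3\<close> and may be
  dropped.\<close>

lemma exp_minus_le_quadratic: "exp (- t) \<le> 1 - t + t\<^sup>2 / 2" if "0 \<le> t" for t :: real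
proof -
  obtain s where s: "\<bar>s\<bar> \<le> \<bar>t\<bar>" "exp (- t) = (\<Sum>m<3. (- t) ^ m / fact m) + exp s / fact 3 * (- t) ^ 3"
    using Maclaurin_exp_le[of "- t" 3] by (auto simp: abs_minus_cancel)
  have "exp s / fact 3 * (- t) ^ 3 \<le> 0"
    using that by (simp add: power3_eq_cube mult_nonneg_nonneg)
  then show ?thesis using s(2) by (simp add: eval_nat_numeral)
qed

lemma borel_measurable_plus_scale [measurable]:
  "(\<lambda>z a. x a + t * z a) \<in> (borel :: (nat \<Rightarrow> real) measure) \<rightarrow>\<^sub>M borel"
  by (rule measurable_into_fun) measurable

text \<open>The terms are indexed by an abstract type rather than by the sets of sites themselves,
  so that a product of two such functions can be indexed by pairs.\<close>

locale exp_sum =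
  fixes J :: "'i set" and w :: "'i \<Rightarrow> real" and A :: "'i \<Rightarrow> nat set" and I :: "nat set"
  assumes J: "finite J" "J \<noteq> {}" and w: "\<And>j. j \<in> J \<Longrightarrow> 0 < w j"
    and I: "finite I" and A: "\<And>j. j \<in> J \<Longrightarrow> A j \<subseteq> I"
begin

definition Z :: "(nat \<Rightarrow> real) \<Rightarrow> real" where
  "Z z = (\<Sum>j\<in>J. w j * exp (\<Sum>a\<in>A j. z a))"

definition u :: "'i \<Rightarrow> nat \<Rightarrow> real" where "u j a = (if a \<in> A j then 1 else 0)"

definition s :: "(nat \<Rightarrow> real) \<Rightarrow> real" where "s z = (\<Sum>a\<in>I. \<bar>z a\<bar>)"

text \<open>The Gibbs probability at \<open>z\<close> that the site \<open>a\<close> is occupied,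
  that is, the partial derivative of \<open>ln Z\<close> in the coordinate \<open>a\<close>.\<close>

definition m :: "nat \<Rightarrow> (nat \<Rightarrow> real) \<Rightarrow> real" where
  "m a z = (\<Sum>j\<in>J. w j * exp (\<Sum>a\<in>A j. z a) * u j a) / Z z"

lemma sum_eq_lin: "j \<in> J \<Longrightarrow> (\<Sum>a\<in>A j. z a) = lin I (u j) z"
  unfolding u_def using A[of j] I
  by (intro sum.mono_neutral_cong_left) auto

lemma Z_measurable [measurable]: "Z \<in> borel_measurable borel"
  unfolding Z_def by measurable

lemma s_measurable [measurable]: "s \<in> borel_measurable borel"
  unfolding s_def by measurable

lemma m_measurable [measurable]: "m a \<in> borel_measurable borel"
  unfolding m_def by measurable

lemma Z_pos: "0 < Z z"
  unfolding Z_def using J w by (intro sum_pos) auto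

lemma u01: "0 \<le> u j a" "u j a \<le> 1" by (auto simp: u_def)

lemma m01: "0 \<le> m a z" "m a z \<le> 1"
proof -
  show "0 \<le> m a z" unfolding m_def using w u01 Z_pos[of z]
    by (intro divide_nonneg_pos sum_nonneg mult_nonneg_nonneg) (auto simp: less_imp_le)
  have "(\<Sum>j\<in>J. w j * exp (\<Sum>a\<in>A j. z a) * u j a) \<le> Z z"
    unfolding Z_def
  proof (rule sum_mono)
    fix j assume "j \<in> J"
    then have "w j * exp (\<Sum>a\<in>A j. z a) * u j a \<le> w j * exp (\<Sum>a\<in>A j. z a) * 1"
      using w[of j] u01[of j a] by (intro mult_left_mono) auto
    then show "w j * exp (\<Sum>a\<in>A j. z a) * u j a \<le> w j * exp (\<Sum>a\<in>A j. z a)" by simp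
  qed
  then show "m a z \<le> 1" unfolding m_def using Z_pos[of z] by simp
qed

lemma s_nonneg: "0 \<le> s z" by (simp add: s_def sum_nonneg)

lemma lin_abs_le_s:
  assumes "\<And>a. a \<in> I \<Longrightarrow> \<bar>c a\<bar> \<le> 1"
  shows "\<bar>lin I c z\<bar> \<le> s z"
proof -
  have "\<bar>lin I c z\<bar> \<le> (\<Sum>a\<in>I. \<bar>c a * z a\<bar>)" by (rule sum_abs)
  also have "\<dots> \<le> s z" unfolding s_def
    by (intro sum_mono) (use assms in \<open>auto simp: abs_mult intro!: mult_left_le_one_le\<close>)
  finally show ?thesis .
qed

lemma gibbs_sum:
  "(\<Sum>j\<in>J. w j * exp (\<Sum>a\<in>A j. x a) / Z x * lin I (u j) y) = lin I (\<lambda>a. m a x) y"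
proof -
  have "(\<Sum>j\<in>J. w j * exp (\<Sum>a\<in>A j. x a) / Z x * lin I (u j) y)
      = (\<Sum>j\<in>J. \<Sum>a\<in>I. w j * exp (\<Sum>a\<in>A j. x a) * u j a / Z x * y a)"
    by (simp add: sum_distrib_left sum_divide_distrib mult_ac)
  also have "\<dots> = (\<Sum>a\<in>I. \<Sum>j\<in>J. w j * exp (\<Sum>a\<in>A j. x a) * u j a / Z x * y a)"
    by (rule sum.swap)
  also have "\<dots> = lin I (\<lambda>a. m a x) y"
    by (simp add: m_def sum_distrib_right sum_divide_distrib)
  finally show ?thesis .
qed

lemma gibbs_mass: "(\<Sum>j\<in>J. w j * exp (\<Sum>a\<in>A j. x a) / Z x) = 1"
  using Z_pos[of x] unfolding sum_divide_distrib[symmetric] Z_def[symmetric] by simp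

text \<open>The ratio of the two values of \<open>Z\<close> is a Gibbs mean, at \<open>x\<close>, of
  exponentials of the increment. Jensen's inequality for this mean gives \<open>Z_add_ge\<close>, a
  Taylor bound gives \<open>ln_Z_add_le\<close>.\<close>

lemma Z_add:
  "Z (\<lambda>a. x a + y a) = Z x * (\<Sum>j\<in>J. w j * exp (\<Sum>a\<in>A j. x a) / Z x * exp (lin I (u j) y))"
proof -
  have "Z (\<lambda>a. x a + y a) = (\<Sum>j\<in>J. w j * exp (\<Sum>a\<in>A j. x a) * exp (lin I (u j) y))"
    unfolding Z_def by (rule sum.cong) (simp_all add: sum.distrib exp_add sum_eq_lin)
  then show ?thesis using Z_pos[of x] by (simp add: sum_distrib_left)
qed

lemma Z_add_ge: "Z x * exp (lin I (\<lambda>a. m a x) y) \<le> Z (\<lambda>a. x a + y a)"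
proof -
  let ?p = "\<lambda>j. w j * exp (\<Sum>a\<in>A j. x a) / Z x"
  have p: "0 \<le> ?p j" if "j \<in> J" for j using w[OF that] Z_pos[of x] by simp
  have "exp (\<Sum>j\<in>J. ?p j *\<^sub>R lin I (u j) y) \<le> (\<Sum>j\<in>J. ?p j * exp (lin I (u j) y))"
    using J p gibbs_mass exp_convex by (intro convex_on_sum[where C=UNIV]) auto
  then have "exp (lin I (\<lambda>a. m a x) y) \<le> (\<Sum>j\<in>J. ?p j * exp (lin I (u j) y))"
    by (simp only: real_scaleR_def gibbs_sum)
  then show ?thesis unfolding Z_add using Z_pos[of x] by (intro mult_left_mono) auto
qed

text \<open>Taylor bound for each exponential, then \<open>ln t \<le> t - 1\<close>. The error does
  not depend on \<open>x\<close>, so it survives averaging over the base point.\<close>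

lemma ln_Z_add_le: "ln (Z (\<lambda>a. x a + y a)) \<le> ln (Z x) + lin I (\<lambda>a. m a x) y + (s y)\<^sup>2 * exp (s y)"
proof -
  let ?p = "\<lambda>j. w j * exp (\<Sum>a\<in>A j. x a) / Z x"
  have p: "0 \<le> ?p j" if "j \<in> J" for j using w[OF that] Z_pos[of x] by simp
  have "(\<Sum>j\<in>J. ?p j * exp (lin I (u j) y)) \<le> (\<Sum>j\<in>J. ?p j * (1 + lin I (u j) y + (s y)\<^sup>2 * exp (s y)))"
  proof (intro sum_mono mult_left_mono)
    fix j assume "j \<in> J"
    have b: "\<bar>lin I (u j) y\<bar> \<le> s y" using u01 by (intro lin_abs_le_s) (auto simp: u_def)
    then have "(lin I (u j) y)\<^sup>2 * exp \<bar>lin I (u j) y\<bar> \<le> (s y)\<^sup>2 * exp (s y)"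
      using s_nonneg[of y] by (intro mult_mono) (auto simp: abs_le_square_iff[symmetric])
    then show "exp (lin I (u j) y) \<le> 1 + lin I (u j) y + (s y)\<^sup>2 * exp (s y)"
      using exp_le_quadratic[of "lin I (u j) y"] by linarith
  qed (use p in auto)
  also have "\<dots> = (\<Sum>j\<in>J. ?p j) + (\<Sum>j\<in>J. ?p j * lin I (u j) y) + (\<Sum>j\<in>J. ?p j) * ((s y)\<^sup>2 * exp (s y))"
    by (simp only: distrib_left sum.distrib sum_distrib_right mult_1_right)
  also have "\<dots> = 1 + (lin I (\<lambda>a. m a x) y + (s y)\<^sup>2 * exp (s y))"
    by (simp only: gibbs_mass gibbs_sum)
  finally have le: "(\<Sum>j\<in>J. ?p j * exp (lin I (u j) y)) \<le> 1 + (lin I (\<lambda>a. m a x) y + (s y)\<^sup>2 * exp (s y))" .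
  have pos: "0 < (\<Sum>j\<in>J. ?p j * exp (lin I (u j) y))"
    using Z_pos[of "\<lambda>a. x a + y a"] Z_pos[of x] unfolding Z_add by (simp add: zero_less_mult_iff)
  have "ln (\<Sum>j\<in>J. ?p j * exp (lin I (u j) y)) \<le> lin I (\<lambda>a. m a x) y + (s y)\<^sup>2 * exp (s y)"
    using ln_le_minus_one[OF pos] le by linarith
  then show ?thesis unfolding Z_add using Z_pos[of x] pos by (simp add: ln_mult)
qed

lemma ln_Z_add_ge: "ln (Z x) + lin I (\<lambda>a. m a x) y \<le> ln (Z (\<lambda>a. x a + y a))"
proof -
  have "ln (Z x * exp (lin I (\<lambda>a. m a x) y)) \<le> ln (Z (\<lambda>a. x a + y a))"
    using Z_add_ge[of x y] Z_pos by (intro ln_mono) auto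
  then show ?thesis using Z_pos[of x] by (simp add: ln_mult)
qed

lemma Z_bounds: "Z (\<lambda>_. 0) * exp (- s z) \<le> Z z" "Z z \<le> Z (\<lambda>_. 0) * exp (s z)"
proof -
  have l: "\<bar>lin I (u j) z\<bar> \<le> s z" for j using u01 by (intro lin_abs_le_s) (auto simp: u_def)
  have l': "- s z \<le> lin I (u j) z" "lin I (u j) z \<le> s z" for j using l[of j] by linarith+
  show "Z (\<lambda>_. 0) * exp (- s z) \<le> Z z"
    unfolding Z_def sum_distrib_right
    using w l' by (intro sum_mono) (auto simp: sum_eq_lin less_imp_le)
  show "Z z \<le> Z (\<lambda>_. 0) * exp (s z)"
    unfolding Z_def sum_distrib_right
    using w l' by (intro sum_mono) (auto simp: sum_eq_lin less_imp_le)
qed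

lemma abs_ln_Z_le: "\<bar>ln (Z z)\<bar> \<le> \<bar>ln (Z (\<lambda>_. 0))\<bar> + s z"
proof -
  have "ln (Z (\<lambda>_. 0) * exp (- s z)) \<le> ln (Z z)" "ln (Z z) \<le> ln (Z (\<lambda>_. 0) * exp (s z))"
    using Z_bounds[of z] Z_pos by (intro ln_mono; simp)+
  then show ?thesis using Z_pos[of "\<lambda>_. 0"] by (simp add: ln_mult)
qed

lemma s_add_le: "s (\<lambda>a. x a + t * z a) \<le> s x + \<bar>t\<bar> * s z"
  unfolding s_def sum_distrib_left sum.distrib[symmetric]
  by (intro sum_mono) (metis abs_mult abs_triangle_ineq)

lemma s_scale: "s (\<lambda>a. t * z a) = \<bar>t\<bar> * s z"
  by (simp add: s_def abs_mult sum_distrib_left)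

lemma s_le_exp: "s z \<le> exp (s z)"
  using exp_ge_add_one_self[of "s z"] by linarith

lemma integrable_dominated_s:
  assumes P: "gaussian_law P K" and f: "f \<in> borel_measurable borel"
    and le: "\<And>z. \<bar>f z\<bar> \<le> C * exp (r * s z)"
  shows "integrable P f"
  by (rule gaussian_law_integrable_dominated[OF P I f]) (use le in \<open>simp add: s_def\<close>)

lemma ln_Z_dominated: "\<bar>ln (Z (\<lambda>a. x a + t * z a))\<bar> \<le> (\<bar>ln (Z (\<lambda>_. 0))\<bar> + s x + 1) * exp (\<bar>t\<bar> * s z)"
proof -
  have e: "1 + \<bar>t\<bar> * s z \<le> exp (\<bar>t\<bar> * s z)" by (rule exp_ge_add_one_self)
  have e1: "1 \<le> exp (\<bar>t\<bar> * s z)" using s_nonneg[of z] by simp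
  have "\<bar>ln (Z (\<lambda>a. x a + t * z a))\<bar> \<le> (\<bar>ln (Z (\<lambda>_. 0))\<bar> + s x) * 1 + \<bar>t\<bar> * s z"
    using abs_ln_Z_le[of "\<lambda>a. x a + t * z a"] s_add_le[of x t z]
    unfolding mult_1_right by linarith
  also have "\<dots> \<le> (\<bar>ln (Z (\<lambda>_. 0))\<bar> + s x) * exp (\<bar>t\<bar> * s z) + exp (\<bar>t\<bar> * s z)"
    using e e1 s_nonneg[of x] by (intro add_mono mult_left_mono) linarith+
  finally show ?thesis by (simp add: algebra_simps)
qed

lemma integrable_ln_Z:
  assumes P: "gaussian_law P K"
  shows "integrable P (\<lambda>z. ln (Z (\<lambda>a. x a + t * z a)))"
  by (rule integrable_dominated_s[OF P _ ln_Z_dominated]) measurable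

lemma integrable_Z_powr:
  assumes P: "gaussian_law P K"
  shows "integrable P (\<lambda>z. Z z powr p)"
proof (rule integrable_dominated_s[OF P])
  fix z
  have "Z z powr p = exp (p * ln (Z z))" using Z_pos[of z] by (simp add: powr_def)
  also have "\<dots> \<le> exp (\<bar>p\<bar> * (\<bar>ln (Z (\<lambda>_. 0))\<bar> + s z))"
  proof -
    have "p * ln (Z z) \<le> \<bar>p\<bar> * \<bar>ln (Z z)\<bar>" by (metis abs_ge_self abs_mult)
    also have "\<dots> \<le> \<bar>p\<bar> * (\<bar>ln (Z (\<lambda>_. 0))\<bar> + s z)"
      using abs_ln_Z_le[of z] by (intro mult_left_mono) auto
    finally show ?thesis by simp
  qed
  finally show "\<bar>Z z powr p\<bar> \<le> exp (\<bar>p\<bar> * \<bar>ln (Z (\<lambda>_. 0))\<bar>) * exp (\<bar>p\<bar> * s z)"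
    by (simp add: exp_add[symmetric] distrib_left)
qed measurable

lemma integrable_inverse_Z:
  assumes P: "gaussian_law P K"
  shows "integrable P (\<lambda>z. 1 / Z z)"
  using integrable_Z_powr[OF P, of "- 1"] Z_pos by (simp add: powr_minus_divide powr_one less_imp_le)

end

section \<open>Exponential concentration\<close>

text \<open>Kernels scale with the square of the factor, so both sides have the kernel
  \<open>c * c * K i j\<close>, and the kernel determines the law.\<close>

lemma conv_scale_law:
  assumes P: "gaussian_law P K" and abc: "a\<^sup>2 + b\<^sup>2 = c\<^sup>2"
  shows "conv_law (scale_law (\<lambda>_. a) P) (scale_law (\<lambda>_. b) P) = scale_law (\<lambda>_. c) P"
proof (rule gaussian_law_unique)
  show "gaussian_law (scale_law (\<lambda>_. c) P) (\<lambda>i j. c * c * K i j)"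
    by (rule gaussian_law_scale[OF P])
  have "c * c * k = a * a * k + b * b * k" for k
    using abc by (metis distrib_right power2_eq_square)
  then show "gaussian_law (conv_law (scale_law (\<lambda>_. a) P) (scale_law (\<lambda>_. b) P)) (\<lambda>i j. c * c * K i j)"
    using gaussian_law_conv[OF gaussian_law_scale[OF P, of "\<lambda>_. a"] gaussian_law_scale[OF P, of "\<lambda>_. b"]]
    by simp
qed

lemma nn_integral_scale_law:
  assumes "sets P = sets borel" "f \<in> borel_measurable borel"
  shows "(\<integral>\<^sup>+x. f x \<partial>scale_law c P) = (\<integral>\<^sup>+z. f (\<lambda>a. c a * z a) \<partial>P)"
proof -
  have [measurable_cong]: "sets P = sets borel" by fact
  show ?thesis unfolding scale_law_def using assms(2) by (subst nn_integral_distr) auto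
qed

lemma integral_scale_law:
  fixes f :: "(nat \<Rightarrow> real) \<Rightarrow> real"
  assumes "sets P = sets borel" "f \<in> borel_measurable borel"
  shows "(\<integral>x. f x \<partial>scale_law c P) = (\<integral>z. f (\<lambda>a. c a * z a) \<partial>P)"
    and "integrable (scale_law c P) f \<longleftrightarrow> integrable P (\<lambda>z. f (\<lambda>a. c a * z a))"
proof -
  have [measurable_cong]: "sets P = sets borel" by fact
  show "(\<integral>x. f x \<partial>scale_law c P) = (\<integral>z. f (\<lambda>a. c a * z a) \<partial>P)"
    unfolding scale_law_def using assms(2) by (subst integral_distr) auto
  show "integrable (scale_law c P) f \<longleftrightarrow> integrable P (\<lambda>z. f (\<lambda>a. c a * z a))"
    unfolding scale_law_def using assms(2) by (subst integrable_distr_eq) auto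
qed

text \<open>Joint measurability, which makes integrals over the second argument measurable functions
  of the first.\<close>

lemma measurable_pair_combination:
  assumes "sets P = sets borel"
  shows "(\<lambda>p i. a i * fst p i + b i * snd p i) \<in> borel \<Otimes>\<^sub>M P \<rightarrow>\<^sub>M (borel :: (nat \<Rightarrow> real) measure)"
proof -
  have [measurable_cong]: "sets P = sets borel" by fact
  show ?thesis
    by (rule measurable_into_fun, intro borel_measurable_add borel_measurable_times measurable_const
        measurable_compose[OF measurable_fst borel_measurable_coordinate]
        measurable_compose[OF measurable_snd]) simp_all
qed

text \<open>Stability of centered Gaussian laws, as a formula for iterated integrals. The
  nonnegative version serves the exponential moments, whose finiteness along the iteration need not
  be discussed; the Bochner version serves \<open>ln Z\<close>, which takes both signs.\<close>

lemma gaussian_stable_nn_integral: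
  assumes P: "gaussian_law P K" and abc: "a\<^sup>2 + b\<^sup>2 = c\<^sup>2" and f: "f \<in> borel_measurable borel"
  shows "(\<integral>\<^sup>+z. \<integral>\<^sup>+z'. f (\<lambda>i. a * z i + b * z' i) \<partial>P \<partial>P) = (\<integral>\<^sup>+z. f (\<lambda>i. c * z i) \<partial>P)"
proof -
  note PD = gaussian_lawD(1,2)[OF P]
  note SD = gaussian_lawD(1,2)[OF gaussian_law_scale[OF P]]
  interpret P: prob_space P by (rule PD)
  have [measurable_cong]: "sets P = sets borel" by (rule PD)
  have [measurable]: "f \<in> borel_measurable borel" by fact
  have "(\<integral>\<^sup>+z. f (\<lambda>i. c * z i) \<partial>P) = (\<integral>\<^sup>+z. f z \<partial>scale_law (\<lambda>_. c) P)"
    by (rule nn_integral_scale_law[OF PD(2) f, symmetric])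
  also have "\<dots> = (\<integral>\<^sup>+x. \<integral>\<^sup>+y. f (\<lambda>i. x i + y i) \<partial>scale_law (\<lambda>_. b) P \<partial>scale_law (\<lambda>_. a) P)"
    unfolding conv_scale_law[OF P abc, symmetric] by (rule nn_integral_conv_law[OF SD SD f])
  also have "\<dots> = (\<integral>\<^sup>+x. \<integral>\<^sup>+z'. f (\<lambda>i. x i + b * z' i) \<partial>P \<partial>scale_law (\<lambda>_. a) P)"
    by (intro nn_integral_cong nn_integral_scale_law[OF PD(2)])
       (rule measurable_compose[OF _ f], rule measurable_into_fun, measurable)
  also have "\<dots> = (\<integral>\<^sup>+z. \<integral>\<^sup>+z'. f (\<lambda>i. a * z i + b * z' i) \<partial>P \<partial>P)"
  proof (rule nn_integral_scale_law[OF PD(2)])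
    from measurable_compose[OF measurable_pair_combination[OF PD(2), of "\<lambda>_. 1" "\<lambda>_. b"] f]
    show "(\<lambda>x. \<integral>\<^sup>+z'. f (\<lambda>i. x i + b * z' i) \<partial>P) \<in> borel_measurable borel"
      by (intro P.borel_measurable_nn_integral) (simp add: split_beta comp_def)
  qed
  finally show ?thesis by simp
qed

lemma gaussian_stable_integral:
  fixes f :: "(nat \<Rightarrow> real) \<Rightarrow> real"
  assumes P: "gaussian_law P K" and abc: "a\<^sup>2 + b\<^sup>2 = c\<^sup>2" and f: "f \<in> borel_measurable borel"
    and int: "integrable P (\<lambda>z. f (\<lambda>i. c * z i))"
  shows "(\<integral>z. \<integral>z'. f (\<lambda>i. a * z i + b * z' i) \<partial>P \<partial>P) = (\<integral>z. f (\<lambda>i. c * z i) \<partial>P)"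
proof -
  note PD = gaussian_lawD(1,2)[OF P]
  note SD = gaussian_lawD(1,2)[OF gaussian_law_scale[OF P]]
  interpret P: prob_space P by (rule PD)
  have [measurable_cong]: "sets P = sets borel" by (rule PD)
  have [measurable]: "f \<in> borel_measurable borel" by fact
  have "(\<integral>z. f (\<lambda>i. c * z i) \<partial>P) = (\<integral>z. f z \<partial>scale_law (\<lambda>_. c) P)"
    by (rule integral_scale_law[OF PD(2) f, symmetric])
  also have "\<dots> = (\<integral>x. \<integral>y. f (\<lambda>i. x i + y i) \<partial>scale_law (\<lambda>_. b) P \<partial>scale_law (\<lambda>_. a) P)"
    unfolding conv_scale_law[OF P abc, symmetric]
    by (rule integral_conv_law[OF SD SD])
       (unfold conv_scale_law[OF P abc] integral_scale_law(2)[OF PD(2) f], rule int)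
  also have "\<dots> = (\<integral>x. \<integral>z'. f (\<lambda>i. x i + b * z' i) \<partial>P \<partial>scale_law (\<lambda>_. a) P)"
    by (intro Bochner_Integration.integral_cong refl integral_scale_law[OF PD(2)])
       (rule measurable_compose[OF _ f], rule measurable_into_fun, measurable)
  also have "\<dots> = (\<integral>z. \<integral>z'. f (\<lambda>i. a * z i + b * z' i) \<partial>P \<partial>P)"
  proof (rule integral_scale_law[OF PD(2)])
    show "(\<lambda>x. \<integral>z'. f (\<lambda>i. x i + b * z' i) \<partial>P) \<in> borel_measurable borel"
      using measurable_compose[OF measurable_pair_combination[OF PD(2), of "\<lambda>_. 1" "\<lambda>_. b"] f]
      by (intro P.borel_measurable_lebesgue_integral) (simp add: split_beta comp_def)
  qed
  finally show ?thesis by simp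
qed

context exp_sum
begin

text \<open>One increment of the disorder. By \<open>R\<close>, the function \<open>V\<close> is a
  constant plus a linear form plus a small nonnegative remainder. The linear form is centered and
  has an explicit exponential moment; the remainder is handled by its first two moments. Since only
  its mean survives to first order, the mean of \<open>V\<close> appears in the bound.\<close>

lemma exp_moment_one_step:
  assumes P: "gaussian_law P K" and V: "V \<in> borel_measurable borel"
    and g: "\<And>a. a \<in> I \<Longrightarrow> \<bar>g a\<bar> \<le> 1"
    and R: "\<And>y. 0 \<le> V y - v - lin I g y" "\<And>y. V y - v - lin I g y \<le> (s y)\<^sup>2 * exp (s y)"
    and r: "0 \<le> r" "r \<le> 1" and e: "0 \<le> e"
  shows "(\<integral>z. exp (- e * V (\<lambda>a. r * z a)) \<partial>P)
    \<le> exp (- e * (\<integral>z. V (\<lambda>a. r * z a) \<partial>P)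
          + e\<^sup>2 * (r\<^sup>2 * (\<Sum>a\<in>I. \<Sum>b\<in>I. \<bar>K a b\<bar>) + r ^ 4 * (\<integral>z. ((s z)\<^sup>2 * exp (s z))\<^sup>2 \<partial>P)))"
    and "integrable P (\<lambda>z. exp (- e * V (\<lambda>a. r * z a)))"
proof -
  interpret P: prob_space P by (rule gaussian_lawD[OF P])
  have [measurable_cong]: "sets P = sets borel" by (rule gaussian_lawD[OF P])
  have [measurable]: "V \<in> borel_measurable borel" by fact
  have rm [measurable]: "(\<lambda>z a. r * z a) \<in> (borel :: (nat \<Rightarrow> real) measure) \<rightarrow>\<^sub>M borel"
    by (rule measurable_scale_fun)
  define S where "S = (\<Sum>a\<in>I. \<Sum>b\<in>I. \<bar>K a b\<bar>)"
  define B where "B z = (s z)\<^sup>2 * exp (s z)" for z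
  define \<rho> where "\<rho> z = V (\<lambda>a. r * z a) - v - lin I g (\<lambda>a. r * z a)" for z
  have \<rho>_meas [measurable]: "\<rho> \<in> borel_measurable borel" unfolding \<rho>_def by measurable
  have B_meas [measurable]: "B \<in> borel_measurable borel" unfolding B_def by measurable
  have lin_r: "lin I g (\<lambda>a. r * z a) = r * lin I g z" for z by (simp add: sum_distrib_left mult_ac)
  have V_eq: "V (\<lambda>a. r * z a) = v + r * lin I g z + \<rho> z" for z by (simp add: \<rho>_def lin_r)
  have \<rho>0: "0 \<le> \<rho> z" for z using R(1) by (simp add: \<rho>_def)
  have \<rho>B: "\<rho> z \<le> r\<^sup>2 * B z" for z
  proof -
    have "\<rho> z \<le> (r * s z)\<^sup>2 * exp (r * s z)"
      using R(2)[of "\<lambda>a. r * z a"] r(1) by (simp add: \<rho>_def s_scale)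
    also have "\<dots> \<le> (r * s z)\<^sup>2 * exp (s z)"
      using r s_nonneg[of z] by (intro mult_left_mono) (auto intro: mult_left_le_one_le)
    finally show ?thesis by (simp add: B_def power_mult_distrib mult_ac)
  qed
  have B0: "0 \<le> B z" for z by (simp add: B_def)
  have B_le: "B z \<le> exp (3 * s z)" for z
  proof -
    have "B z \<le> (exp (s z))\<^sup>2 * exp (s z)"
      unfolding B_def using s_le_exp[of z] s_nonneg[of z] by (intro mult_right_mono power_mono) auto
    also have "\<dots> = exp (3 * s z)" by (simp add: exp_double[symmetric] exp_add[symmetric])
    finally show ?thesis .
  qed
  have iB: "integrable P B"
    by (rule integrable_dominated_s[OF P, of _ 1 3]) (use B0 B_le in simp_all)
  have iB2: "integrable P (\<lambda>z. (B z)\<^sup>2)"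
  proof (rule integrable_dominated_s[OF P, of _ 1 6])
    fix z
    have "(B z)\<^sup>2 \<le> (exp (3 * s z))\<^sup>2" using B0 B_le by (intro power_mono)
    then show "\<bar>(B z)\<^sup>2\<bar> \<le> 1 * exp (6 * s z)" by (simp add: exp_double[symmetric])
  qed simp
  have i\<rho>: "integrable P \<rho>"
    by (rule Bochner_Integration.integrable_bound[OF integrable_mult_right[OF iB, of "r\<^sup>2"]])
       (use \<rho>0 \<rho>B B0 in \<open>auto simp: abs_of_nonneg\<close>)
  have \<rho>2B: "(\<rho> z)\<^sup>2 \<le> r ^ 4 * (B z)\<^sup>2" for z
  proof -
    have "(\<rho> z)\<^sup>2 \<le> (r\<^sup>2 * B z)\<^sup>2" using \<rho>0 \<rho>B by (intro power_mono)
    then show ?thesis by (simp add: power_mult_distrib flip: power_mult)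
  qed
  have i\<rho>2: "integrable P (\<lambda>z. (\<rho> z)\<^sup>2)"
    by (rule Bochner_Integration.integrable_bound[OF integrable_mult_right[OF iB2, of "r ^ 4"]])
       (use \<rho>2B in \<open>auto simp: abs_of_nonneg\<close>)
  define \<mu> where "\<mu> = (\<integral>z. \<rho> z \<partial>P)"
  define C where "C = (\<integral>z. (B z)\<^sup>2 \<partial>P)"
  have EV: "(\<integral>z. V (\<lambda>a. r * z a) \<partial>P) = v + \<mu>"
    using gaussian_law_lin_mean[OF P I, of g] i\<rho> by (simp add: V_eq \<mu>_def P.prob_space)
  \<comment> \<open>The factors 2 in the exponents of \<open>a\<close> and \<open>b\<close> come
    from separating linear part and remainder as in the Cauchy-Schwarz inequality; they double the
    variance term of the linear part.\<close>
  define a where "a z = exp (lin I (\<lambda>b. - 2 * e * r * g b) z)" for z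
  define b where "b z = exp (- (2 * e * \<rho> z))" for z
  have ia: "integrable P a" unfolding a_def by (rule gaussian_law_mgf[OF P I])
  have Ea: "(\<integral>z. a z \<partial>P) \<le> exp (2 * e\<^sup>2 * r\<^sup>2 * S)"
  proof -
    have "quad I K (\<lambda>b. - 2 * e * r * g b) \<le> (2 * e * r)\<^sup>2 * S" unfolding S_def
    proof (rule quad_abs_le)
      fix a assume "a \<in> I"
      then have "\<bar>2 * e * r\<bar> * \<bar>g a\<bar> \<le> \<bar>2 * e * r\<bar> * 1" using g by (intro mult_left_mono) auto
      then show "\<bar>- 2 * e * r * g a\<bar> \<le> 2 * e * r" using e r by (simp add: abs_mult)
    qed
    then show ?thesis unfolding a_def gaussian_law_mgf(2)[OF P I]
      by (simp add: power_mult_distrib)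
  qed
  have b_meas [measurable]: "b \<in> borel_measurable borel" unfolding b_def by measurable
  have ib: "integrable P b"
    by (rule P.integrable_const_bound[of _ 1]) (use e \<rho>0 in \<open>auto simp: b_def\<close>)
  have Eb: "(\<integral>z. b z \<partial>P) \<le> exp (- 2 * e * \<mu> + 2 * e\<^sup>2 * r ^ 4 * C)"
  proof -
    have "b z \<le> 1 - 2 * e * \<rho> z + 2 * e\<^sup>2 * r ^ 4 * (B z)\<^sup>2" for z
    proof -
      have "b z \<le> 1 - 2 * e * \<rho> z + (2 * e * \<rho> z)\<^sup>2 / 2"
        unfolding b_def by (rule exp_minus_le_quadratic) (use e \<rho>0 in simp)
      also have "(2 * e * \<rho> z)\<^sup>2 / 2 = 2 * e\<^sup>2 * (\<rho> z)\<^sup>2" by (simp add: power_mult_distrib)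
      also have "\<dots> \<le> 2 * e\<^sup>2 * (r ^ 4 * (B z)\<^sup>2)" using \<rho>2B by (intro mult_left_mono) auto
      finally show ?thesis by (simp add: mult_ac)
    qed
    then have "(\<integral>z. b z \<partial>P) \<le> (\<integral>z. 1 - 2 * e * \<rho> z + 2 * e\<^sup>2 * r ^ 4 * (B z)\<^sup>2 \<partial>P)"
      using ib i\<rho> iB2 by (intro integral_mono) auto
    also have "\<dots> = 1 + (- 2 * e * \<mu> + 2 * e\<^sup>2 * r ^ 4 * C)"
      using i\<rho> iB2 by (simp add: \<mu>_def C_def P.prob_space)
    also have "\<dots> \<le> exp (- 2 * e * \<mu> + 2 * e\<^sup>2 * r ^ 4 * C)" by (rule exp_ge_add_one_self)
    finally show ?thesis .
  qed
  define \<alpha> where "\<alpha> = 2 * e\<^sup>2 * r\<^sup>2 * S"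
  define \<beta> where "\<beta> = - 2 * e * \<mu> + 2 * e\<^sup>2 * r ^ 4 * C"
  \<comment> \<open>Cauchy-Schwarz in the form of Young's inequality. As \<open>exp \<alpha>\<close>
    and \<open>exp \<beta>\<close> bound the means of \<open>a\<close> and \<open>b\<close>, the
    weights balance the two terms and the bound becomes the geometric mean
    \<open>exp ((\<alpha> + \<beta>) / 2)\<close>.\<close>
  have young: "exp (- e * V (\<lambda>a. r * z a))
      \<le> exp (- e * v) * (a z * exp ((\<beta> - \<alpha>) / 2) + b z * exp ((\<alpha> - \<beta>) / 2)) / 2" for z
  proof -
    define p where "p = - e * r * lin I g z + (\<beta> - \<alpha>) / 4"
    define q where "q = - (e * \<rho> z) + (\<alpha> - \<beta>) / 4"
    have "lin I (\<lambda>b. - 2 * e * r * g b) z = - 2 * e * r * lin I g z"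
      by (simp add: sum_distrib_left mult_ac sum_negf[symmetric])
    then have p: "exp p ^ 2 = a z * exp ((\<beta> - \<alpha>) / 2)"
      by (simp add: a_def p_def exp_add[symmetric] exp_double[symmetric] field_simps)
    have q: "exp q ^ 2 = b z * exp ((\<alpha> - \<beta>) / 2)"
      by (simp add: b_def q_def exp_add[symmetric] exp_double[symmetric] field_simps)
    have "exp (- e * V (\<lambda>a. r * z a)) = exp (- e * v) * (exp p * exp q)"
      by (simp add: V_eq p_def q_def exp_add[symmetric] field_simps)
    also have "exp p * exp q \<le> (exp p ^ 2 + exp q ^ 2) / 2"
      using sum_squares_bound[of "exp p" "exp q"] by simp
    finally show ?thesis unfolding p q by simp
  qed
  have Vm: "(\<lambda>z. exp (- e * V (\<lambda>a. r * z a))) \<in> borel_measurable P" by measurable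
  have irhs: "integrable P (\<lambda>z. exp (- e * v) * (a z * exp ((\<beta> - \<alpha>) / 2) + b z * exp ((\<alpha> - \<beta>) / 2)) / 2)"
    using ia ib by auto
  show iV: "integrable P (\<lambda>z. exp (- e * V (\<lambda>a. r * z a)))"
    by (rule Bochner_Integration.integrable_bound[OF irhs Vm])
       (use young in \<open>auto intro: order_trans[OF _ abs_ge_self]\<close>)
  have "(\<integral>z. exp (- e * V (\<lambda>a. r * z a)) \<partial>P)
      \<le> (\<integral>z. exp (- e * v) * (a z * exp ((\<beta> - \<alpha>) / 2) + b z * exp ((\<alpha> - \<beta>) / 2)) / 2 \<partial>P)"
    using iV irhs young by (intro integral_mono) auto
  also have "\<dots> = exp (- e * v) * ((\<integral>z. a z \<partial>P) * exp ((\<beta> - \<alpha>) / 2) + (\<integral>z. b z \<partial>P) * exp ((\<alpha> - \<beta>) / 2)) / 2"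
    using ia ib by simp
  also have "\<dots> \<le> exp (- e * v) * (exp \<alpha> * exp ((\<beta> - \<alpha>) / 2) + exp \<beta> * exp ((\<alpha> - \<beta>) / 2)) / 2"
    using Ea Eb by (intro divide_right_mono mult_left_mono add_mono mult_right_mono) (auto simp: \<alpha>_def \<beta>_def)
  also have "\<dots> = exp (- e * v + (\<alpha> + \<beta>) / 2)"
  proof -
    have "exp \<alpha> * exp ((\<beta> - \<alpha>) / 2) = exp ((\<alpha> + \<beta>) / 2)" "exp \<beta> * exp ((\<alpha> - \<beta>) / 2) = exp ((\<alpha> + \<beta>) / 2)"
      by (simp_all add: exp_add[symmetric] field_simps)
    then have "(exp \<alpha> * exp ((\<beta> - \<alpha>) / 2) + exp \<beta> * exp ((\<alpha> - \<beta>) / 2)) / 2 = exp ((\<alpha> + \<beta>) / 2)"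
      by simp
    then show ?thesis by (metis exp_add times_divide_eq_right)
  qed
  also have "- e * v + (\<alpha> + \<beta>) / 2 = - e * (v + \<mu>) + e\<^sup>2 * (r\<^sup>2 * S + r ^ 4 * C)"
    by (simp add: \<alpha>_def \<beta>_def field_simps)
  finally show "(\<integral>z. exp (- e * V (\<lambda>a. r * z a)) \<partial>P)
    \<le> exp (- e * (\<integral>z. V (\<lambda>a. r * z a) \<partial>P)
          + e\<^sup>2 * (r\<^sup>2 * (\<Sum>a\<in>I. \<Sum>b\<in>I. \<bar>K a b\<bar>) + r ^ 4 * (\<integral>z. ((s z)\<^sup>2 * exp (s z))\<^sup>2 \<partial>P)))"
    unfolding EV S_def C_def B_def .
qed

text \<open>The conditional mean of \<open>ln Z\<close> when the part \<open>x\<close> of the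
  disorder is known and an independent part of variance scale \<open>t ^ 2\<close> is still to be
  averaged.\<close>

definition \<Phi> :: "(nat \<Rightarrow> real) measure \<Rightarrow> real \<Rightarrow> (nat \<Rightarrow> real) \<Rightarrow> real" where
  "\<Phi> P t x = (\<integral>z. ln (Z (\<lambda>a. x a + t * z a)) \<partial>P)"

lemma \<Phi>_measurable:
  assumes P: "gaussian_law P K"
  shows "\<Phi> P t \<in> borel_measurable borel"
proof -
  interpret P: prob_space P by (rule gaussian_lawD[OF P])
  have "(\<lambda>x. ln (Z x)) \<in> borel_measurable borel" by measurable
  from measurable_compose[OF measurable_pair_combination[OF gaussian_lawD(2)[OF P], of "\<lambda>_. 1" "\<lambda>_. t"] this]
  show ?thesis unfolding \<Phi>_def
    by (intro P.borel_measurable_lebesgue_integral) (simp add: split_beta comp_def)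
qed

text \<open>Integration of the two pointwise bounds for \<open>ln Z\<close>; the gradient is the
  mean of \<open>m\<close>, hence bounded by 1, and the error is uniform in \<open>x\<close> and
  \<open>t\<close>.\<close>

lemma \<Phi>_expansion:
  assumes P: "gaussian_law P K"
  obtains g where "\<And>a. a \<in> I \<Longrightarrow> \<bar>g a\<bar> \<le> 1"
    and "\<And>y. 0 \<le> \<Phi> P t (\<lambda>a. x a + y a) - \<Phi> P t x - lin I g y"
    and "\<And>y. \<Phi> P t (\<lambda>a. x a + y a) - \<Phi> P t x - lin I g y \<le> (s y)\<^sup>2 * exp (s y)"
proof -
  interpret P: prob_space P by (rule gaussian_lawD[OF P])
  have [measurable_cong]: "sets P = sets borel" by (rule gaussian_lawD[OF P])
  define g where "g a = (\<integral>z. m a (\<lambda>b. x b + t * z b) \<partial>P)" for a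
  have mm [measurable]: "(\<lambda>z. m a (\<lambda>b. x b + t * z b)) \<in> borel_measurable P" for a
    by (rule measurable_compose[OF _ m_measurable]) measurable
  have im: "integrable P (\<lambda>z. m a (\<lambda>b. x b + t * z b))" for a
    by (rule P.integrable_const_bound[of _ 1]) (use m01 in auto)
  have "0 \<le> g a" "g a \<le> 1" for a
    unfolding g_def using im m01 by (auto intro!: integral_nonneg_AE P.integral_le_const)
  then have g1: "\<bar>g a\<bar> \<le> 1" for a by (simp add: abs_of_nonneg)
  have diff: "\<Phi> P t (\<lambda>a. x a + y a) - \<Phi> P t x - lin I g y
      = (\<integral>z. ln (Z (\<lambda>a. x a + y a + t * z a)) - ln (Z (\<lambda>a. x a + t * z a))
          - lin I (\<lambda>a. m a (\<lambda>b. x b + t * z b)) y \<partial>P)"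
    and int: "integrable P (\<lambda>z. ln (Z (\<lambda>a. x a + y a + t * z a)) - ln (Z (\<lambda>a. x a + t * z a))
          - lin I (\<lambda>a. m a (\<lambda>b. x b + t * z b)) y)" for y
    using im integrable_ln_Z[OF P, of x t] integrable_ln_Z[OF P, of "\<lambda>a. x a + y a" t]
    by (simp_all add: \<Phi>_def g_def)
  have shift: "(\<lambda>a. (x a + t * z a) + y a) = (\<lambda>a. x a + y a + t * z a)" for y z
    by (simp add: algebra_simps)
  show thesis
  proof (rule that[of g])
    fix y
    show "0 \<le> \<Phi> P t (\<lambda>a. x a + y a) - \<Phi> P t x - lin I g y"
      unfolding diff using ln_Z_add_ge[of "\<lambda>a. x a + t * z a" y for z]
      by (intro integral_nonneg_AE AE_I2) (simp add: shift algebra_simps)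
    show "\<Phi> P t (\<lambda>a. x a + y a) - \<Phi> P t x - lin I g y \<le> (s y)\<^sup>2 * exp (s y)"
      unfolding diff using ln_Z_add_le[of "\<lambda>a. x a + t * z a" y for z]
      by (intro P.integral_le_const[OF int] AE_I2) (simp add: shift algebra_simps)
  qed (rule g1)
qed

text \<open>A martingale argument: the disorder is revealed in \<open>k\<close> increments of scale
  \<open>1 / sqrt k\<close>, and \<open>\<Phi>\<close> at the revealed part is the Doob martingale
  of \<open>ln Z\<close>. Each step multiplies the exponential moment by at most
  \<open>exp \<delta>\<close>, where \<open>k * \<delta> = e ^ 2 * (S + C / k)\<close>.\<close>

theorem gaussian_concentration:
  assumes P: "gaussian_law P K" and e: "0 \<le> e"
  shows "(\<integral>z. Z z powr (- e) \<partial>P)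
    \<le> exp (- e * (\<integral>z. ln (Z z) \<partial>P) + e\<^sup>2 * (\<Sum>a\<in>I. \<Sum>b\<in>I. \<bar>K a b\<bar>))"
proof -
  interpret P: prob_space P by (rule gaussian_lawD[OF P])
  have [measurable_cong]: "sets P = sets borel" by (rule gaussian_lawD[OF P])
  define S where "S = (\<Sum>a\<in>I. \<Sum>b\<in>I. \<bar>K a b\<bar>)"
  define C where "C = (\<integral>z. ((s z)\<^sup>2 * exp (s z))\<^sup>2 \<partial>P)"
  have \<Phi>m [measurable]: "\<Phi> P t \<in> borel_measurable borel" for t by (rule \<Phi>_measurable[OF P])
  have steps: "(\<integral>z. Z z powr (- e) \<partial>P) \<le> exp (- e * (\<integral>z. ln (Z z) \<partial>P) + e\<^sup>2 * (S + C / real k))"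
    if k: "k > 0" for k :: nat
  proof -
    define r where "r = sqrt (1 / real k)"
    define \<delta> where "\<delta> = e\<^sup>2 * (r\<^sup>2 * S + r ^ 4 * C)"
    have r: "0 \<le> r" "r \<le> 1" using k by (auto simp: r_def)
    have r2: "r\<^sup>2 = 1 / real k" by (simp add: r_def)
    have r4: "r ^ 4 = 1 / real k * (1 / real k)"
      unfolding r2[symmetric] by (simp add: power4_eq_xxxx power2_eq_square)
    \<comment> \<open>After \<open>j\<close> of \<open>k\<close> steps the revealed part has scale
      \<open>p j\<close> and the hidden part scale \<open>q j\<close>, with squares adding up to 1.
      Thus \<open>N 0\<close> is the exponential of the mean and \<open>N k\<close> the moment to be
      bounded.\<close>
    define p where "p j = sqrt (real j / real k)" for j
    define q where "q j = sqrt (1 - real j / real k)" for j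
    define N where "N j = (\<integral>\<^sup>+z. ennreal (exp (- e * \<Phi> P (q j) (\<lambda>a. p j * z a))) \<partial>P)" for j
    have step: "N (Suc j) \<le> ennreal (exp \<delta>) * N j" if j: "j < k" for j
    proof -
      have pr: "(p j)\<^sup>2 + r\<^sup>2 = (p (Suc j))\<^sup>2"
        using k by (simp add: p_def r_def add_divide_distrib[symmetric])
      have qr: "r\<^sup>2 + (q (Suc j))\<^sup>2 = (q j)\<^sup>2"
        using j k by (simp add: q_def r_def field_simps)
      have "N (Suc j) = (\<integral>\<^sup>+z. \<integral>\<^sup>+z'. ennreal (exp (- e * \<Phi> P (q (Suc j)) (\<lambda>a. p j * z a + r * z' a))) \<partial>P \<partial>P)"
        unfolding N_def by (rule gaussian_stable_nn_integral[OF P pr, symmetric]) measurable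
      also have "\<dots> \<le> (\<integral>\<^sup>+z. ennreal (exp \<delta>) * ennreal (exp (- e * \<Phi> P (q j) (\<lambda>a. p j * z a))) \<partial>P)"
      proof (rule nn_integral_mono)
        fix z
        define x where "x a = p j * z a" for a :: nat
        define V where "V y = \<Phi> P (q (Suc j)) (\<lambda>a. x a + y a)" for y :: "nat \<Rightarrow> real"
        obtain g where g: "\<And>a. a \<in> I \<Longrightarrow> \<bar>g a\<bar> \<le> 1"
          "\<And>y. 0 \<le> V y - \<Phi> P (q (Suc j)) x - lin I g y"
          "\<And>y. V y - \<Phi> P (q (Suc j)) x - lin I g y \<le> (s y)\<^sup>2 * exp (s y)"
          unfolding V_def using \<Phi>_expansion[OF P, of "q (Suc j)" x] by blast
        have Vm: "V \<in> borel_measurable borel"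
          unfolding V_def using borel_measurable_plus_scale[of x 1]
          by (intro measurable_compose[OF _ \<Phi>m]) simp
        \<comment> \<open>The martingale property: averaging over the new increment, of scale
          \<open>r\<close>, merges it with the part still hidden.\<close>
        have EV: "(\<integral>z'. V (\<lambda>a. r * z' a) \<partial>P) = \<Phi> P (q j) x"
        proof -
          have "(\<integral>z'. V (\<lambda>a. r * z' a) \<partial>P)
             = (\<integral>z. \<integral>z'. ln (Z (\<lambda>a. x a + 1 * (r * z a + q (Suc j) * z' a))) \<partial>P \<partial>P)"
            unfolding V_def \<Phi>_def by (simp add: add.assoc)
          also have "\<dots> = (\<integral>z. ln (Z (\<lambda>a. x a + 1 * (q j * z a))) \<partial>P)"
            using integrable_ln_Z[OF P, of x "q j"]
            by (intro gaussian_stable_integral[OF P qr, of "\<lambda>z. ln (Z (\<lambda>a. x a + 1 * z a))"]) auto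
          finally show ?thesis by (simp add: \<Phi>_def)
        qed
        note one = exp_moment_one_step[OF P Vm g r e, folded S_def C_def, folded \<delta>_def]
        have "(\<integral>\<^sup>+z'. ennreal (exp (- e * V (\<lambda>a. r * z' a))) \<partial>P)
            = ennreal (\<integral>z'. exp (- e * V (\<lambda>a. r * z' a)) \<partial>P)"
          using one(2) by (intro nn_integral_eq_integral) auto
        also have "\<dots> \<le> ennreal (exp (- e * \<Phi> P (q j) x + \<delta>))"
          using one(1) unfolding EV by (rule ennreal_leI)
        also have "\<dots> = ennreal (exp \<delta>) * ennreal (exp (- e * \<Phi> P (q j) x))"
          by (simp add: ennreal_mult[symmetric] exp_add[symmetric] add.commute)
        finally show "(\<integral>\<^sup>+z'. ennreal (exp (- e * \<Phi> P (q (Suc j)) (\<lambda>a. p j * z a + r * z' a))) \<partial>P)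
          \<le> ennreal (exp \<delta>) * ennreal (exp (- e * \<Phi> P (q j) (\<lambda>a. p j * z a)))"
          unfolding V_def x_def .
      qed
      also have "\<dots> = ennreal (exp \<delta>) * N j"
        unfolding N_def by (rule nn_integral_cmult) measurable
      finally show ?thesis .
    qed
    have iter: "N j \<le> ennreal (exp (real j * \<delta>)) * N 0" if "j \<le> k" for j
      using that
    proof (induction j)
      case (Suc j)
      have "N (Suc j) \<le> ennreal (exp \<delta>) * (ennreal (exp (real j * \<delta>)) * N 0)"
        using step[of j] Suc by (metis Suc_le_lessD less_imp_le mult_left_mono order_trans zero_le)
      moreover have "exp (real (Suc j) * \<delta>) = exp \<delta> * exp (real j * \<delta>)"
        by (simp add: exp_add[symmetric] distrib_right)
      ultimately show ?case by (simp add: ennreal_mult mult.assoc)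
    qed simp
    have p0: "p 0 = 0" "q 0 = 1" "p k = 1" "q k = 0" using k by (auto simp: p_def q_def)
    have N0: "N 0 = ennreal (exp (- e * (\<integral>z. ln (Z z) \<partial>P)))"
      by (simp add: N_def p0 \<Phi>_def P.emeasure_space_1)
    have Nk: "N k = ennreal (\<integral>z. Z z powr (- e) \<partial>P)"
    proof -
      have "exp (- e * \<Phi> P (q k) (\<lambda>a. p k * z a)) = Z z powr (- e)" for z
        using Z_pos[of z] by (simp add: p0 \<Phi>_def powr_def P.prob_space)
      then show ?thesis unfolding N_def using integrable_Z_powr[OF P, of "- e"]
        by (simp add: nn_integral_eq_integral)
    qed
    have "ennreal (\<integral>z. Z z powr (- e) \<partial>P) \<le> ennreal (exp (real k * \<delta>) * exp (- e * (\<integral>z. ln (Z z) \<partial>P)))"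
      using iter[of k] by (simp add: N0 Nk ennreal_mult)
    then have "(\<integral>z. Z z powr (- e) \<partial>P) \<le> exp (real k * \<delta>) * exp (- e * (\<integral>z. ln (Z z) \<partial>P))"
      by simp
    also have "real k * \<delta> = e\<^sup>2 * (S + C / real k)"
      using k by (simp add: \<delta>_def r2 r4 field_simps)
    finally show ?thesis by (simp add: exp_add[symmetric] add.commute)
  qed
  \<comment> \<open>Neither the left-hand side of \<open>steps\<close> nor the constant
    \<open>C\<close> depends on \<open>k\<close>, so the remainder term disappears in the
    limit.\<close>
  have "(\<lambda>k. exp (- e * (\<integral>z. ln (Z z) \<partial>P) + e\<^sup>2 * (S + C / real k)))
     \<longlonglongrightarrow> exp (- e * (\<integral>z. ln (Z z) \<partial>P) + e\<^sup>2 * (S + 0))"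
    by (intro tendsto_intros lim_const_over_n)
  then show ?thesis
    using steps unfolding S_def
    by (intro LIMSEQ_le_const[where X="\<lambda>k. exp (- e * (\<integral>z. ln (Z z) \<partial>P) + e\<^sup>2 * ((\<Sum>a\<in>I. \<Sum>b\<in>I. \<bar>K a b\<bar>) + C / real k))"])
       (auto intro!: exI[of _ 1])
qed

end

section \<open>Decoupling of disjoint blocks\<close>

lemma gaussian_law_sum_rank_one:
  assumes "finite B"
  shows "\<exists>N. gaussian_law N (\<lambda>i j. \<Sum>p\<in>B. v p i * v p j)"
  using assms
proof (induction B rule: finite_induct)
  case empty
  show ?case using gaussian_law_rank_one[of "\<lambda>_. 0"] by auto
next
  case (insert q B)
  then obtain N where "gaussian_law N (\<lambda>i j. \<Sum>p\<in>B. v p i * v p j)" by blast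
  from gaussian_law_conv[OF gaussian_law_rank_one[of "v q"] this] insert.hyps
  show ?case by auto
qed

lemma quad_sum_rank_one: "quad I (\<lambda>i j. \<Sum>p\<in>B. v p i * v p j) c = (\<Sum>p\<in>B. (lin I c (v p))\<^sup>2)"
proof -
  have "quad I (\<lambda>i j. \<Sum>p\<in>B. v p i * v p j) c = (\<Sum>i\<in>I. \<Sum>j\<in>I. \<Sum>p\<in>B. c i * v p i * (c j * v p j))"
    by (simp add: quad_def sum_distrib_left mult_ac)
  also have "\<dots> = (\<Sum>i\<in>I. \<Sum>p\<in>B. \<Sum>j\<in>I. c i * v p i * (c j * v p j))"
    by (rule sum.cong[OF refl], rule sum.swap)
  also have "\<dots> = (\<Sum>p\<in>B. \<Sum>i\<in>I. \<Sum>j\<in>I. c i * v p i * (c j * v p j))"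
    by (rule sum.swap)
  also have "\<dots> = (\<Sum>p\<in>B. (lin I c (v p))\<^sup>2)"
    by (simp add: power2_eq_square sum_product)
  finally show ?thesis .
qed

text \<open>Uncorrelated Gaussian blocks are independent. Independence is expressed by writing the
  law on both blocks as the convolution of its restrictions, which then act on \<open>F\<close> and
  \<open>G\<close> separately.\<close>

lemma nn_integral_gaussian_blocks:
  fixes F G :: "(nat \<Rightarrow> real) \<Rightarrow> ennreal"
  assumes R: "gaussian_law R M" and disj: "I1 \<inter> I2 = {}"
    and cross: "\<And>a b. a \<in> I1 \<Longrightarrow> b \<in> I2 \<Longrightarrow> M a b = 0" "\<And>a b. a \<in> I1 \<Longrightarrow> b \<in> I2 \<Longrightarrow> M b a = 0"
    and F: "F \<in> borel_measurable borel" "\<And>x y. (\<And>a. a \<in> I1 \<Longrightarrow> x a = y a) \<Longrightarrow> F x = F y"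
    and G: "G \<in> borel_measurable borel" "\<And>x y. (\<And>a. a \<in> I2 \<Longrightarrow> x a = y a) \<Longrightarrow> G x = G y"
  shows "(\<integral>\<^sup>+z. F z * G z \<partial>R) = (\<integral>\<^sup>+z. F z \<partial>R) * (\<integral>\<^sup>+z. G z \<partial>R)"
proof -
  note RD = gaussian_lawD(1,2)[OF R]
  have [measurable_cong]: "sets R = sets borel" by (rule RD)
  have [measurable]: "F \<in> borel_measurable borel" "G \<in> borel_measurable borel" by fact+
  let ?i = "\<lambda>I a. indicator I a :: real"
  let ?R1 = "scale_law (?i I1) R" and ?R2 = "scale_law (?i I2) R"
  \<comment> \<open>The indicators erase all coordinates on which neither \<open>F\<close> nor
    \<open>G\<close> depends. What is left of the kernel is block diagonal, because the cross
    entries vanish.\<close>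
  have K: "(\<lambda>a b. ?i I1 a * ?i I1 b * M a b + ?i I2 a * ?i I2 b * M a b)
      = (\<lambda>a b. ?i (I1 \<union> I2) a * ?i (I1 \<union> I2) b * M a b)"
    using disj cross by (intro ext) (auto simp: indicator_def)
  have law: "scale_law (?i (I1 \<union> I2)) R = conv_law ?R1 ?R2"
    using gaussian_law_conv[OF gaussian_law_scale[OF R, of "?i I1"] gaussian_law_scale[OF R, of "?i I2"]]
    unfolding K by (intro gaussian_law_unique[OF gaussian_law_scale[OF R]])
  have S1: "prob_space ?R1" "sets ?R1 = sets borel" and S2: "prob_space ?R2" "sets ?R2 = sets borel"
    using gaussian_lawD(1,2)[OF gaussian_law_scale[OF R]] by auto
  have FG: "(\<lambda>z. F z * G z) \<in> borel_measurable borel" by measurable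
  have "(\<integral>\<^sup>+z. F z * G z \<partial>R) = (\<integral>\<^sup>+z. F (\<lambda>a. ?i (I1 \<union> I2) a * z a) * G (\<lambda>a. ?i (I1 \<union> I2) a * z a) \<partial>R)"
    by (intro nn_integral_cong arg_cong2[where f="(*)"] F(2) G(2)) auto
  also have "\<dots> = (\<integral>\<^sup>+z. F z * G z \<partial>conv_law ?R1 ?R2)"
    unfolding law[symmetric] by (rule nn_integral_scale_law[OF RD(2) FG, symmetric])
  also have "\<dots> = (\<integral>\<^sup>+x. \<integral>\<^sup>+y. F (\<lambda>a. x a + y a) * G (\<lambda>a. x a + y a) \<partial>?R2 \<partial>?R1)"
    by (rule nn_integral_conv_law[OF S1 S2 FG])
  also have "\<dots> = (\<integral>\<^sup>+x. \<integral>\<^sup>+y. F (\<lambda>a. x a + ?i I2 a * y a) * G (\<lambda>a. x a + ?i I2 a * y a) \<partial>R \<partial>?R1)"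
    by (intro nn_integral_cong nn_integral_scale_law[OF RD(2)]
        borel_measurable_times_ennreal measurable_compose[OF _ F(1)] measurable_compose[OF _ G(1)]
        measurable_into_fun) auto
  also have "\<dots> = (\<integral>\<^sup>+x. \<integral>\<^sup>+y. F x * G (\<lambda>a. x a + ?i I2 a * y a) \<partial>R \<partial>?R1)"
    using disj by (intro nn_integral_cong arg_cong2[where f="(*)"] F(2)) (auto simp: indicator_def)
  also have "\<dots> = (\<integral>\<^sup>+x. \<integral>\<^sup>+y. F (\<lambda>a. ?i I1 a * x a) * G (\<lambda>a. ?i I1 a * x a + ?i I2 a * y a) \<partial>R \<partial>R)"
  proof (rule nn_integral_scale_law[OF RD(2)])
    interpret R: prob_space R by (rule RD)
    from measurable_compose[OF measurable_pair_combination[OF RD(2), of "\<lambda>_. 1" "?i I2"] G(1)]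
    show "(\<lambda>x. \<integral>\<^sup>+y. F x * G (\<lambda>a. x a + ?i I2 a * y a) \<partial>R) \<in> borel_measurable borel"
      by (intro R.borel_measurable_nn_integral) (simp add: split_beta comp_def)
  qed
  also have "\<dots> = (\<integral>\<^sup>+x. \<integral>\<^sup>+y. F x * G y \<partial>R \<partial>R)"
    using disj by (intro nn_integral_cong arg_cong2[where f="(*)"] F(2) G(2)) (auto simp: indicator_def)
  also have "\<dots> = (\<integral>\<^sup>+x. F x * (\<integral>\<^sup>+y. G y \<partial>R) \<partial>R)"
    by (intro nn_integral_cong nn_integral_cmult) measurable
  also have "\<dots> = (\<integral>\<^sup>+x. F x \<partial>R) * (\<integral>\<^sup>+y. G y \<partial>R)"
    by (intro nn_integral_multc) measurable
  finally show ?thesis .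
qed

context exp_sum
begin

lemma Z_cong: "(\<And>a. a \<in> I \<Longrightarrow> x a = y a) \<Longrightarrow> Z x = Z y"
proof -
  assume eq: "\<And>a. a \<in> I \<Longrightarrow> x a = y a"
  have "(\<Sum>a\<in>A j. x a) = (\<Sum>a\<in>A j. y a)" if "j \<in> J" for j
    using A[OF that] eq by (intro sum.cong) auto
  then show "Z x = Z y" unfolding Z_def by simp
qed

lemma integrable_Z_shift:
  assumes N: "gaussian_law N L"
  shows "integrable N (\<lambda>\<xi>. Z (\<lambda>a. z a + \<xi> a))" "integrable N (\<lambda>\<xi>. 1 / Z (\<lambda>a. z a + \<xi> a))"
proof -
  have m: "(\<lambda>\<xi>. Z (\<lambda>a. z a + \<xi> a)) \<in> borel_measurable borel"
    using measurable_compose[OF borel_measurable_plus_scale[of z 1] Z_measurable] by simp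
  have le: "s (\<lambda>a. z a + \<xi> a) \<le> s z + s \<xi>" for \<xi> using s_add_le[of z 1 \<xi>] by simp
  show "integrable N (\<lambda>\<xi>. Z (\<lambda>a. z a + \<xi> a))"
  proof (rule integrable_dominated_s[OF N m])
    fix \<xi>
    have "Z (\<lambda>a. z a + \<xi> a) \<le> Z (\<lambda>_. 0) * exp (s (\<lambda>a. z a + \<xi> a))" by (rule Z_bounds)
    also have "\<dots> \<le> Z (\<lambda>_. 0) * exp (s z + s \<xi>)"
      using le Z_pos[of "\<lambda>_. 0"] by (intro mult_left_mono) auto
    finally show "\<bar>Z (\<lambda>a. z a + \<xi> a)\<bar> \<le> (Z (\<lambda>_. 0) * exp (s z)) * exp (1 * s \<xi>)"
      using Z_pos[of "\<lambda>a. z a + \<xi> a"] by (simp add: exp_add)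
  qed
  show "integrable N (\<lambda>\<xi>. 1 / Z (\<lambda>a. z a + \<xi> a))"
  proof (rule integrable_dominated_s[OF N])
    show "(\<lambda>\<xi>. 1 / Z (\<lambda>a. z a + \<xi> a)) \<in> borel_measurable borel" using m by measurable
    fix \<xi>
    have "Z (\<lambda>_. 0) * exp (- (s z + s \<xi>)) \<le> Z (\<lambda>_. 0) * exp (- s (\<lambda>a. z a + \<xi> a))"
      using le[of \<xi>] Z_pos[of "\<lambda>_. 0"] by (intro mult_left_mono) (simp_all add: algebra_simps)
    also have "\<dots> \<le> Z (\<lambda>a. z a + \<xi> a)" by (rule Z_bounds)
    finally have "1 / Z (\<lambda>a. z a + \<xi> a) \<le> 1 / (Z (\<lambda>_. 0) * exp (- (s z + s \<xi>)))"
      using Z_pos[of "\<lambda>_. 0"] by (intro divide_left_mono) (auto intro!: mult_pos_pos Z_pos)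
    also have "1 / (Z (\<lambda>_. 0) * exp (- (s z + s \<xi>))) = (exp (s z) / Z (\<lambda>_. 0)) * exp (1 * s \<xi>)"
      unfolding exp_minus exp_add by (simp add: field_simps)
    finally show "\<bar>1 / Z (\<lambda>a. z a + \<xi> a)\<bar> \<le> (exp (s z) / Z (\<lambda>_. 0)) * exp (1 * s \<xi>)"
      using Z_pos[of "\<lambda>a. z a + \<xi> a"] by simp
  qed
qed

text \<open>Upper bound: \<open>Z_add_ge\<close> replaces the shifted \<open>Z\<close> by the
  exponential of a linear form. Lower bound: the mean of the shifted \<open>Z\<close> is at most
  \<open>exp (l / 2) * Z z\<close>, and \<open>t \<mapsto> 1 / t\<close> is convex. Both use
  \<open>quad\<close> only for coefficients in \<open>[-1, 1]\<close>, namely \<open>- m\<close> and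
  \<open>u j\<close>, so \<open>l\<close> need not depend on \<open>z\<close>.\<close>

lemma inverse_Z_smoothing_pointwise:
  assumes N: "gaussian_law N L"
    and l: "\<And>c. (\<And>a. a \<in> I \<Longrightarrow> \<bar>c a\<bar> \<le> 1) \<Longrightarrow> quad I L c \<le> l"
  shows "(\<integral>\<xi>. 1 / Z (\<lambda>a. z a + \<xi> a) \<partial>N) \<le> exp (l / 2) / Z z"
    and "exp (- l / 2) / Z z \<le> (\<integral>\<xi>. 1 / Z (\<lambda>a. z a + \<xi> a) \<partial>N)"
proof -
  interpret N: prob_space N by (rule gaussian_lawD[OF N])
  note int = integrable_Z_shift[OF N, of z]
  have "(\<integral>\<xi>. 1 / Z (\<lambda>a. z a + \<xi> a) \<partial>N) \<le> (\<integral>\<xi>. 1 / Z z * exp (lin I (\<lambda>a. - m a z) \<xi>) \<partial>N)"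
  proof (intro integral_mono int integrable_mult_right gaussian_law_mgf[OF N I])
    fix \<xi>
    have "1 / Z (\<lambda>a. z a + \<xi> a) \<le> 1 / (Z z * exp (lin I (\<lambda>a. m a z) \<xi>))"
      using Z_add_ge[of z \<xi>] Z_pos by (intro divide_left_mono) auto
    then show "1 / Z (\<lambda>a. z a + \<xi> a) \<le> 1 / Z z * exp (lin I (\<lambda>a. - m a z) \<xi>)"
      by (simp add: sum_negf exp_minus field_simps)
  qed
  also have "\<dots> = 1 / Z z * exp (quad I L (\<lambda>a. - m a z) / 2)"
    by (simp only: integral_mult_right_zero gaussian_law_mgf(2)[OF N I])
  also have "\<dots> \<le> 1 / Z z * exp (l / 2)"
    using l[of "\<lambda>a. - m a z"] m01 Z_pos[of z] by (intro mult_left_mono) auto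
  finally show "(\<integral>\<xi>. 1 / Z (\<lambda>a. z a + \<xi> a) \<partial>N) \<le> exp (l / 2) / Z z" by simp
  define c where "c = Z z * exp (l / 2)"
  have c: "c > 0" using Z_pos by (simp add: c_def)
  have "(\<integral>\<xi>. Z (\<lambda>a. z a + \<xi> a) \<partial>N)
      = (\<Sum>j\<in>J. w j * exp (\<Sum>a\<in>A j. z a) * (\<integral>\<xi>. exp (lin I (u j) \<xi>) \<partial>N))"
  proof -
    have "Z (\<lambda>a. z a + \<xi> a) = (\<Sum>j\<in>J. w j * exp (\<Sum>a\<in>A j. z a) * exp (lin I (u j) \<xi>))" for \<xi>
      unfolding Z_def by (rule sum.cong) (simp_all add: sum.distrib exp_add sum_eq_lin)
    then show ?thesis using gaussian_law_mgf(1)[OF N I] by (simp add: integral_sum)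
  qed
  also have "\<dots> \<le> (\<Sum>j\<in>J. w j * exp (\<Sum>a\<in>A j. z a) * exp (l / 2))"
  proof (intro sum_mono mult_left_mono)
    fix j assume "j \<in> J"
    have "quad I L (u j) \<le> l" by (rule l) (simp add: u_def)
    then show "(\<integral>\<xi>. exp (lin I (u j) \<xi>) \<partial>N) \<le> exp (l / 2)"
      by (simp add: gaussian_law_mgf(2)[OF N I])
  qed (use w in \<open>auto simp: less_imp_le\<close>)
  also have "\<dots> = c" by (simp add: c_def Z_def sum_distrib_right)
  finally have Zc: "(\<integral>\<xi>. Z (\<lambda>a. z a + \<xi> a) \<partial>N) \<le> c" .
  \<comment> \<open>The tangent of \<open>1 / z\<close> at \<open>c\<close>; integrating it is
    Jensen's inequality.\<close>
  have tangent: "2 / c - z / c\<^sup>2 \<le> 1 / z" if "z > 0" for z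
  proof -
    have "0 \<le> (z - c)\<^sup>2" by simp
    then have "2 * z * c \<le> z * z + c * c" by (simp add: power2_eq_square algebra_simps)
    then have "(2 * z * c) / (z * (c * c)) \<le> (z * z + c * c) / (z * (c * c))"
      using c that by (intro divide_right_mono) auto
    moreover have "(2 * z * c) / (z * (c * c)) = 2 / c" using c that by simp
    moreover have "(z * z + c * c) / (z * (c * c)) = z / c\<^sup>2 + 1 / z"
      using c that by (simp add: add_divide_distrib power2_eq_square)
    ultimately show ?thesis by linarith
  qed
  have "1 / c \<le> 2 / c - (\<integral>\<xi>. Z (\<lambda>a. z a + \<xi> a) \<partial>N) / c\<^sup>2"
  proof -
    have "(\<integral>\<xi>. Z (\<lambda>a. z a + \<xi> a) \<partial>N) / c\<^sup>2 \<le> c / c\<^sup>2" using Zc by (intro divide_right_mono) auto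
    also have "c / c\<^sup>2 = 1 / c" using c by (simp add: power2_eq_square)
    finally show ?thesis by simp
  qed
  also have "\<dots> = (\<integral>\<xi>. 2 / c - Z (\<lambda>a. z a + \<xi> a) / c\<^sup>2 \<partial>N)"
    using int by (simp add: N.prob_space)
  also have "\<dots> \<le> (\<integral>\<xi>. 1 / Z (\<lambda>a. z a + \<xi> a) \<partial>N)"
    using int tangent Z_pos by (intro integral_mono) auto
  finally show "exp (- l / 2) / Z z \<le> (\<integral>\<xi>. 1 / Z (\<lambda>a. z a + \<xi> a) \<partial>N)"
    by (simp add: c_def exp_minus field_simps)
qed

text \<open>Both directions are required: the product is taken from the original to the perturbed
  law, where it factorises, and the factors are taken back.\<close>

lemma inverse_Z_smoothing:
  assumes P: "gaussian_law P K" and N: "gaussian_law N L"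
    and l: "\<And>c. (\<And>a. a \<in> I \<Longrightarrow> \<bar>c a\<bar> \<le> 1) \<Longrightarrow> quad I L c \<le> l"
  shows "(\<integral>z. 1 / Z z \<partial>conv_law P N) \<le> exp (l / 2) * (\<integral>z. 1 / Z z \<partial>P)"
    and "(\<integral>z. 1 / Z z \<partial>P) \<le> exp (l / 2) * (\<integral>z. 1 / Z z \<partial>conv_law P N)"
proof -
  note PD = gaussian_lawD(1,2)[OF P] and ND = gaussian_lawD(1,2)[OF N]
  interpret P: prob_space P by (rule PD)
  interpret N: prob_space N by (rule ND)
  have [measurable_cong]: "sets P = sets borel" "sets N = sets borel" by (rule PD ND)+
  note iC = integrable_inverse_Z[OF gaussian_law_conv[OF P N]]
  note iP = integrable_inverse_Z[OF P]
  let ?g = "\<lambda>z. \<integral>\<xi>. 1 / Z (\<lambda>a. z a + \<xi> a) \<partial>N"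
  have eq: "(\<integral>z. 1 / Z z \<partial>conv_law P N) = (\<integral>z. ?g z \<partial>P)"
    by (rule integral_conv_law[OF PD ND iC])
  have gm: "?g \<in> borel_measurable P"
  proof -
    have "(\<lambda>x. 1 / Z x) \<in> borel_measurable borel" by measurable
    from measurable_compose[OF measurable_pair_combination[OF ND(2), of "\<lambda>_. 1" "\<lambda>_. 1"] this]
    have "?g \<in> borel_measurable borel"
      by (intro N.borel_measurable_lebesgue_integral) (simp add: split_beta comp_def)
    then show ?thesis by simp
  qed
  note pw = inverse_Z_smoothing_pointwise[OF N l]
  have g0: "0 \<le> ?g z" for z using Z_pos by (intro integral_nonneg_AE AE_I2) (simp add: less_imp_le)
  have ig: "integrable P ?g"
    by (rule Bochner_Integration.integrable_bound[OF integrable_mult_right[OF iP, of "exp (l / 2)"] gm])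
       (use pw(1) g0 Z_pos in \<open>auto simp: less_imp_le abs_of_nonneg\<close>)
  have "(\<integral>z. ?g z \<partial>P) \<le> (\<integral>z. exp (l / 2) * (1 / Z z) \<partial>P)"
    using pw(1) by (intro integral_mono ig integrable_mult_right iP) simp
  also have "\<dots> = exp (l / 2) * (\<integral>z. 1 / Z z \<partial>P)" by (rule integral_mult_right_zero)
  finally show "(\<integral>z. 1 / Z z \<partial>conv_law P N) \<le> exp (l / 2) * (\<integral>z. 1 / Z z \<partial>P)"
    unfolding eq .
  have "(\<integral>z. 1 / Z z \<partial>P) \<le> (\<integral>z. exp (l / 2) * ?g z \<partial>P)"
  proof (intro integral_mono ig integrable_mult_right iP)
    fix z
    have "exp (l / 2) * (exp (- l / 2) / Z z) \<le> exp (l / 2) * ?g z"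
      using pw(2) by (intro mult_left_mono) auto
    then show "1 / Z z \<le> exp (l / 2) * ?g z" by (simp add: exp_minus)
  qed
  also have "\<dots> = exp (l / 2) * (\<integral>z. ?g z \<partial>P)" by (rule integral_mult_right_zero)
  finally show "(\<integral>z. 1 / Z z \<partial>P) \<le> exp (l / 2) * (\<integral>z. 1 / Z z \<partial>conv_law P N)"
    unfolding eq .
qed

end

locale exp_sum_pair =
  U: exp_sum J1 w1 A1 I1 + V: exp_sum J2 w2 A2 I2
  for J1 :: "'i set" and w1 A1 I1 and J2 :: "'j set" and w2 A2 I2 +
  assumes disj: "I1 \<inter> I2 = {}"
begin

text \<open>The product is again a positive combination of exponentials, so smoothing applies to it
  as a whole. Disjointness of \<open>I1\<close> and \<open>I2\<close> makes the exponent of a union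
  the sum of the exponents, see \<open>Z_product\<close>.\<close>

sublocale W: exp_sum "J1 \<times> J2" "\<lambda>(i, j). w1 i * w2 j" "\<lambda>(i, j). A1 i \<union> A2 j" "I1 \<union> I2"
proof
  show "(case j of (i, j) \<Rightarrow> A1 i \<union> A2 j) \<subseteq> I1 \<union> I2" if "j \<in> J1 \<times> J2" for j
    using that U.A V.A by fastforce
qed (use U.J V.J U.w V.w U.I V.I in auto)

lemma Z_product: "W.Z z = U.Z z * V.Z z"
proof -
  have "(\<Sum>a\<in>A1 i \<union> A2 j. z a) = (\<Sum>a\<in>A1 i. z a) + (\<Sum>a\<in>A2 j. z a)"
    if "i \<in> J1" "j \<in> J2" for i j
    using U.A[OF that(1)] V.A[OF that(2)] U.I V.I disj
    by (intro sum.union_disjoint) (auto intro: finite_subset)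
  then show ?thesis
    unfolding W.Z_def U.Z_def V.Z_def sum_product sum.cartesian_product
    by (intro sum.cong refl) (auto simp: exp_add)
qed

text \<open>The vector attached to a pair \<open>(a, b)\<close> contributes \<open>- K a b\<close>
  to the cross entry and otherwise affects the diagonal only; being a sum of squares,
  \<open>L\<close> is the kernel of a Gaussian law. Under the perturbed law the blocks are
  independent. Each of the three comparisons costs \<open>exp (4 * k / 2)\<close>, which gives
  \<open>exp (6 * k)\<close>.\<close>

theorem decoupling:
  assumes P: "gaussian_law P K" and sym: "\<And>a b. K a b = K b a"
  shows "(\<integral>z. 1 / (U.Z z * V.Z z) \<partial>P)
    \<le> exp (6 * (\<Sum>a\<in>I1. \<Sum>b\<in>I2. \<bar>K a b\<bar>)) * ((\<integral>z. 1 / U.Z z \<partial>P) * (\<integral>z. 1 / V.Z z \<partial>P))"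
proof -
  define B where "B = I1 \<times> I2"
  txt \<open>The kernel \<open>L\<close> is built to cancel \<open>K\<close> between the blocks.\<close>
  define v where "v = (\<lambda>(a, b) i. sqrt \<bar>K a b\<bar> * ((if i = a then 1 else 0) - sgn (K a b) * (if i = b then 1 else 0)))"
  define L where "L i j = (\<Sum>p\<in>B. v p i * v p j)" for i j
  define k where "k = (\<Sum>a\<in>I1. \<Sum>b\<in>I2. \<bar>K a b\<bar>)"
  have B: "finite B" using U.I V.I by (simp add: B_def)
  obtain N where N: "gaussian_law N L"
    using gaussian_law_sum_rank_one[OF B, of v] unfolding L_def[abs_def, symmetric] by blast
  have bound: "quad I L c \<le> 4 * k" if I: "finite I" and c: "\<And>a. a \<in> I \<Longrightarrow> \<bar>c a\<bar> \<le> 1" for I c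
  proof -
    \<comment> \<open>The vector \<open>v p\<close> has two nonzero entries at most, of modulus at
      most \<open>sqrt |K a b|\<close>; against coefficients bounded by 1 this is where the 4 comes
      from.\<close>
    have "(lin I c (v p))\<^sup>2 \<le> 4 * \<bar>K (fst p) (snd p)\<bar>" for p
    proof -
      obtain a b where p: "p = (a, b)" by (cases p)
      define ca where "ca = (if a \<in> I then c a else 0)"
      define cb where "cb = (if b \<in> I then c b else 0)"
      have "lin I c (v p) = sqrt \<bar>K a b\<bar> * ((\<Sum>i\<in>I. if i = a then c i else 0) - sgn (K a b) * (\<Sum>i\<in>I. if i = b then c i else 0))"
        unfolding p v_def prod.case sum_distrib_left sum_subtractf[symmetric]
        by (intro sum.cong refl) (auto simp: algebra_simps)
      also have "\<dots> = sqrt \<bar>K a b\<bar> * (ca - sgn (K a b) * cb)"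
        using I by (simp add: ca_def cb_def)
      finally have eq: "(lin I c (v p))\<^sup>2 = \<bar>K a b\<bar> * (ca - sgn (K a b) * cb)\<^sup>2"
        by (simp add: power_mult_distrib)
      have "\<bar>ca\<bar> \<le> 1" "\<bar>cb\<bar> \<le> 1" using c by (auto simp: ca_def cb_def)
      then have "\<bar>ca - sgn (K a b) * cb\<bar> \<le> 2"
        by (auto simp: sgn_if)
      then have "(ca - sgn (K a b) * cb)\<^sup>2 \<le> 2\<^sup>2" by (metis abs_le_square_iff abs_numeral)
      then have "\<bar>K a b\<bar> * (ca - sgn (K a b) * cb)\<^sup>2 \<le> \<bar>K a b\<bar> * 4" by (intro mult_left_mono) auto
      then show ?thesis unfolding eq by (simp add: p)
    qed
    then have "quad I L c \<le> (\<Sum>p\<in>B. 4 * \<bar>K (fst p) (snd p)\<bar>)"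
      unfolding L_def[abs_def] quad_sum_rank_one by (intro sum_mono)
    also have "\<dots> = 4 * k"
      by (simp add: k_def B_def sum.cartesian_product sum_distrib_left split_beta)
    finally show ?thesis .
  qed
  have cross: "L i j = - K i j" if "i \<in> I1" "j \<in> I2" for i j
  proof -
    \<comment> \<open>Since the blocks are disjoint, only the pair \<open>(i, j)\<close> itself has
      a vector that is nonzero at both sites.\<close>
    have "L i j = (\<Sum>p\<in>{(i, j)}. v p i * v p j)"
      unfolding L_def using B that disj
      by (intro sum.mono_neutral_right) (auto simp: B_def v_def split: if_splits)
    also have "\<dots> = - (sqrt \<bar>K i j\<bar> * sqrt \<bar>K i j\<bar> * sgn (K i j))"
      using that disj by (auto simp: v_def)
    also have "\<dots> = - K i j" by (simp add: abs_mult_sgn)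
    finally show ?thesis .
  qed
  have Lsym: "L i j = L j i" for i j by (simp add: L_def mult.commute)
  define R where "R = conv_law P N"
  have R: "gaussian_law R (\<lambda>a b. K a b + L a b)" unfolding R_def by (rule gaussian_law_conv[OF P N])
  have "(\<integral>\<^sup>+z. ennreal (1 / U.Z z) * ennreal (1 / V.Z z) \<partial>R)
      = (\<integral>\<^sup>+z. ennreal (1 / U.Z z) \<partial>R) * (\<integral>\<^sup>+z. ennreal (1 / V.Z z) \<partial>R)"
  proof (rule nn_integral_gaussian_blocks[OF R disj])
    show "K a b + L a b = 0" "K b a + L b a = 0" if "a \<in> I1" "b \<in> I2" for a b
      using cross[OF that] sym[of a b] Lsym[of a b] by auto
    show "ennreal (1 / U.Z x) = ennreal (1 / U.Z y)" if "\<And>a. a \<in> I1 \<Longrightarrow> x a = y a" for x y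
      using U.Z_cong[of x y] that by simp
    show "ennreal (1 / V.Z x) = ennreal (1 / V.Z y)" if "\<And>a. a \<in> I2 \<Longrightarrow> x a = y a" for x y
      using V.Z_cong[of x y] that by simp
  qed measurable
  moreover have "(\<integral>\<^sup>+z. ennreal (1 / U.Z z) * ennreal (1 / V.Z z) \<partial>R) = ennreal (\<integral>z. 1 / W.Z z \<partial>R)"
    using W.integrable_inverse_Z[OF R] W.Z_pos U.Z_pos V.Z_pos
    by (subst nn_integral_eq_integral[symmetric])
       (auto simp: Z_product less_imp_le simp flip: ennreal_mult)
  moreover have "(\<integral>\<^sup>+z. ennreal (1 / U.Z z) \<partial>R) = ennreal (\<integral>z. 1 / U.Z z \<partial>R)"
    using U.integrable_inverse_Z[OF R] U.Z_pos by (intro nn_integral_eq_integral) (auto simp: less_imp_le)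
  moreover have "(\<integral>\<^sup>+z. ennreal (1 / V.Z z) \<partial>R) = ennreal (\<integral>z. 1 / V.Z z \<partial>R)"
    using V.integrable_inverse_Z[OF R] V.Z_pos by (intro nn_integral_eq_integral) (auto simp: less_imp_le)
  moreover have nn: "0 \<le> (\<integral>z. 1 / W.Z z \<partial>R)" "0 \<le> (\<integral>z. 1 / U.Z z \<partial>R)" "0 \<le> (\<integral>z. 1 / V.Z z \<partial>R)"
    using W.Z_pos U.Z_pos V.Z_pos by (auto intro!: integral_nonneg_AE simp: less_imp_le)
  ultimately have prod: "(\<integral>z. 1 / W.Z z \<partial>R) = (\<integral>z. 1 / U.Z z \<partial>R) * (\<integral>z. 1 / V.Z z \<partial>R)"
    by (simp flip: ennreal_mult)
  have "(\<integral>z. 1 / W.Z z \<partial>P) \<le> exp (4 * k / 2) * (\<integral>z. 1 / W.Z z \<partial>R)"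
    unfolding R_def using bound[OF W.I] by (rule W.inverse_Z_smoothing(2)[OF P N])
  also have "\<dots> = exp (4 * k / 2) * ((\<integral>z. 1 / U.Z z \<partial>R) * (\<integral>z. 1 / V.Z z \<partial>R))"
    unfolding prod ..
  also have "\<dots> \<le> exp (4 * k / 2) * ((exp (4 * k / 2) * (\<integral>z. 1 / U.Z z \<partial>P)) * (exp (4 * k / 2) * (\<integral>z. 1 / V.Z z \<partial>P)))"
  proof (intro mult_left_mono mult_mono nn)
    show "(\<integral>z. 1 / U.Z z \<partial>R) \<le> exp (4 * k / 2) * (\<integral>z. 1 / U.Z z \<partial>P)"
      unfolding R_def using bound[OF U.I] by (rule U.inverse_Z_smoothing(1)[OF P N])
    show "(\<integral>z. 1 / V.Z z \<partial>R) \<le> exp (4 * k / 2) * (\<integral>z. 1 / V.Z z \<partial>P)"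
      unfolding R_def using bound[OF V.I] by (rule V.inverse_Z_smoothing(1)[OF P N])
    show "0 \<le> exp (4 * k / 2) * (\<integral>z. 1 / U.Z z \<partial>P)"
      using U.Z_pos by (intro mult_nonneg_nonneg integral_nonneg_AE) (auto simp: less_imp_le)
  qed auto
  also have "\<dots> = exp (6 * k) * ((\<integral>z. 1 / U.Z z \<partial>P) * (\<integral>z. 1 / V.Z z \<partial>P))"
  proof -
    have "exp (6 * k) = exp (4 * k / 2) * (exp (4 * k / 2) * exp (4 * k / 2))"
      by (simp add: exp_add[symmetric])
    then show ?thesis by simp
  qed
  finally show ?thesis unfolding k_def Z_product .
qed

end

section \<open>Stationary Gaussian disorder\<close>

lemma gaussian_rv_integrable:
  assumes "prob_space P" "gaussian_rv P Y"
  shows "integrable P Y" "integrable P (\<lambda>x. (Y x)\<^sup>2)"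
proof -
  interpret prob_space P by fact
  have [measurable]: "Y \<in> borel_measurable P" using assms by (simp add: gaussian_rv_def)
  consider m where "AE x in P. Y x = m"
    | m \<sigma> where "\<sigma> > 0" "distributed P lborel Y (normal_density m \<sigma>)"
    using assms by (auto simp: gaussian_rv_def)
  then have "integrable P Y \<and> integrable P (\<lambda>x. (Y x)\<^sup>2)"
  proof cases
    case 1
    then have "integrable P Y \<longleftrightarrow> integrable P (\<lambda>_. m)" "integrable P (\<lambda>x. (Y x)\<^sup>2) \<longleftrightarrow> integrable P (\<lambda>_. m\<^sup>2)"
      by (intro integrable_cong_AE; auto)+
    then show ?thesis by simp
  next
    case 2
    have i: "integrable lborel (\<lambda>x. normal_density m \<sigma> x * (x - m) ^ k)" for k
      by (rule integrable_normal_moment[OF 2(1)])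
    have D: "integrable P (\<lambda>x. (Y x - m) ^ k)" for k
      using distributed_integrable[OF 2(2), of "\<lambda>x. (x - m) ^ k"] i[of k] by simp
    have "integrable P (\<lambda>x. (Y x - m) ^ 1 + m)" "integrable P (\<lambda>x. (Y x - m) ^ 2 + 2 * m * (Y x - m) ^ 1 + m\<^sup>2)"
      by (intro Bochner_Integration.integrable_add integrable_mult_right D integrable_const)+
    moreover have "(Y x - m) ^ 1 + m = Y x" "(Y x - m) ^ 2 + 2 * m * (Y x - m) ^ 1 + m\<^sup>2 = (Y x)\<^sup>2" for x
      by (simp_all add: power2_eq_square algebra_simps)
    ultimately show ?thesis by simp
  qed
  then show "integrable P Y" "integrable P (\<lambda>x. (Y x)\<^sup>2)" by auto
qed

text \<open>In the degenerate case the vanishing mean forces the constant to be 0, so a single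
  formula in terms of the second moment covers both cases.\<close>

lemma gaussian_rv_cos_sin:
  assumes "prob_space P" "gaussian_rv P Y" and mean: "(\<integral>x. Y x \<partial>P) = 0"
  shows "(\<integral>x. cos (Y x) \<partial>P) = exp (- (\<integral>x. (Y x)\<^sup>2 \<partial>P) / 2)" "(\<integral>x. sin (Y x) \<partial>P) = 0"
proof -
  interpret prob_space P by fact
  have [measurable]: "Y \<in> borel_measurable P" using assms by (simp add: gaussian_rv_def)
  consider m where "AE x in P. Y x = m"
    | m \<sigma> where "\<sigma> > 0" "distributed P lborel Y (normal_density m \<sigma>)"
    using assms by (auto simp: gaussian_rv_def)
  then have "(\<integral>x. cos (Y x) \<partial>P) = exp (- (\<integral>x. (Y x)\<^sup>2 \<partial>P) / 2) \<and> (\<integral>x. sin (Y x) \<partial>P) = 0"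
  proof cases
    case 1
    have *: "(\<integral>x. f (Y x) \<partial>P) = f m" if [measurable]: "f \<in> borel_measurable borel" for f :: "real \<Rightarrow> real"
    proof -
      have "(\<integral>x. f (Y x) \<partial>P) = (\<integral>x. f m \<partial>P)" using 1 by (intro integral_cong_AE) auto
      then show ?thesis by (simp add: prob_space)
    qed
    have "m = 0" using *[of "\<lambda>x. x"] mean by simp
    then show ?thesis using *[of cos] *[of sin] *[of "\<lambda>x. x\<^sup>2"] by simp
  next
    case 2
    have m: "m = 0" using normal_distributed_expectation[OF 2] mean by simp
    have var: "(\<integral>x. (Y x)\<^sup>2 \<partial>P) = \<sigma>\<^sup>2" using normal_distributed_variance[OF 2] mean by simp
    have D: "distributed P lborel (\<lambda>x. (Y x - m) / \<sigma>) std_normal_density"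
      using normal_standard_normal_convert[OF 2(1), of Y m] 2(2) by simp
    have *: "(\<integral>x. f (Y x) \<partial>P) = (\<integral>x. f (\<sigma> * x) \<partial>std_normal_distribution)"
      if [measurable]: "f \<in> borel_measurable borel" for f :: "real \<Rightarrow> real"
    proof -
      have "(\<integral>x. f (\<sigma> * x) \<partial>std_normal_distribution) = (\<integral>x. std_normal_density x * f (\<sigma> * x) \<partial>lborel)"
        by (subst integral_real_density) auto
      also have "\<dots> = (\<integral>x. f (\<sigma> * ((Y x - m) / \<sigma>)) \<partial>P)"
        by (rule distributed_integral[OF D]) auto
      finally show ?thesis using 2(1) by (simp add: m)
    qed
    show ?thesis unfolding var using *[of cos] *[of sin] by (simp add: std_normal_cos_sin)
  qed
  then show "(\<integral>x. cos (Y x) \<partial>P) = exp (- (\<integral>x. (Y x)\<^sup>2 \<partial>P) / 2)" "(\<integral>x. sin (Y x) \<partial>P) = 0" by auto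
qed

text \<open>With truncated subtraction, \<open>(a - b) + (b - a)\<close> is the distance of
  \<open>a\<close> and \<open>b\<close>.\<close>

definition cov_kernel :: "(nat \<Rightarrow> real) measure \<Rightarrow> nat \<Rightarrow> nat \<Rightarrow> real" where
  "cov_kernel P a b = covariance_fun P ((a - b) + (b - a))"

lemma cov_kernel_sym: "cov_kernel P a b = cov_kernel P b a"
  by (simp add: cov_kernel_def add.commute)

lemma stationary_shift_law:
  assumes "centered_stationary_gaussian P"
  shows "distr P borel (\<lambda>\<omega> a. \<omega> (a + k)) = P" "(\<lambda>\<omega> a. \<omega> (a + k)) \<in> P \<rightarrow>\<^sub>M borel"
proof -
  have s: "sets P = sets borel" using assms by (simp add: centered_stationary_gaussian_def)
  then show "(\<lambda>\<omega> a. \<omega> (a + k)) \<in> P \<rightarrow>\<^sub>M borel"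
    by (intro measurable_into_fun) (simp cong: measurable_cong_sets)
  have "distr P borel (\<lambda>\<omega> a. \<omega> (a + k)) = distr P P (\<lambda>\<omega> a. \<omega> (a + k))"
    by (rule distr_cong) (use s in auto)
  then show "distr P borel (\<lambda>\<omega> a. \<omega> (a + k)) = P"
    using assms by (simp add: centered_stationary_gaussian_def)
qed

lemma stationary_integral_shift:
  fixes f :: "(nat \<Rightarrow> real) \<Rightarrow> real"
  assumes P: "centered_stationary_gaussian P" and f: "f \<in> borel_measurable borel"
  shows "(\<integral>\<omega>. f (\<lambda>a. \<omega> (a + k)) \<partial>P) = (\<integral>\<omega>. f \<omega> \<partial>P)"
  using integral_distr[OF stationary_shift_law(2)[OF P, of k] f] stationary_shift_law(1)[OF P, of k]
  by simp

text \<open>Each linear form is a centered Gaussian variable, so its characteristic function is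
  given by its variance; expanding the square yields \<open>quad\<close>, and shift invariance moves
  each covariance to the origin.\<close>

lemma gaussian_law_stationary:
  assumes P: "centered_stationary_gaussian P"
  shows "gaussian_law P (cov_kernel P)"
proof -
  have ps: "prob_space P" and s: "sets P = sets borel" and mean: "(\<integral>\<omega>. \<omega> a \<partial>P) = 0"
    and rv: "finite I \<Longrightarrow> gaussian_rv P (lin I c)" for a I c
    using P by (auto simp: centered_stationary_gaussian_def)
  interpret prob_space P by (rule ps)
  have [measurable_cong]: "sets P = sets borel" by (rule s)
  have rv1: "gaussian_rv P (\<lambda>\<omega>. \<omega> a)" for a using rv[of "{a}" "\<lambda>_. 1"] by simp
  note int = gaussian_rv_integrable[OF ps rv1]
  have int2: "integrable P (\<lambda>\<omega>. \<omega> a * \<omega> b)" for a b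
  proof (rule Bochner_Integration.integrable_bound)
    show "integrable P (\<lambda>\<omega>. (\<omega> a)\<^sup>2 + (\<omega> b)\<^sup>2)" using int by auto
    have "\<bar>x * y\<bar> \<le> x\<^sup>2 + y\<^sup>2" for x y :: real
    proof -
      have "0 \<le> \<bar>x\<bar> * \<bar>y\<bar>" by simp
      then show ?thesis using sum_squares_bound[of "\<bar>x\<bar>" "\<bar>y\<bar>"]
        unfolding abs_mult power2_abs by linarith
    qed
    then show "AE \<omega> in P. norm (\<omega> a * \<omega> b) \<le> norm ((\<omega> a)\<^sup>2 + (\<omega> b)\<^sup>2)" by auto
  qed measurable
  have cov: "(\<integral>\<omega>. \<omega> a * \<omega> b \<partial>P) = cov_kernel P a b" for a b
  proof -
    have le: "(\<integral>\<omega>. \<omega> a * \<omega> b \<partial>P) = covariance_fun P (b - a)" if "a \<le> b" for a b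
      using stationary_integral_shift[OF P, of "\<lambda>\<omega>. \<omega> 0 * \<omega> (b - a)" a] that
      by (simp add: covariance_fun_def)
    show ?thesis
    proof (cases "a \<le> b")
      case True
      then show ?thesis using le by (simp add: cov_kernel_def)
    next
      case False
      then show ?thesis using le[of b a] by (simp add: cov_kernel_def mult.commute)
    qed
  qed
  have "(\<integral>\<omega>. cos (lin I c \<omega>) \<partial>P) = exp (- quad I (cov_kernel P) c / 2) \<and> (\<integral>\<omega>. sin (lin I c \<omega>) \<partial>P) = 0"
    if I: "finite I" for I c
  proof -
    have m: "(\<integral>\<omega>. lin I c \<omega> \<partial>P) = 0" using int mean by simp
    have "(lin I c \<omega>)\<^sup>2 = (\<Sum>a\<in>I. \<Sum>b\<in>I. c a * c b * (\<omega> a * \<omega> b))" for \<omega>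
      by (simp add: power2_eq_square sum_product mult_ac)
    then have "(\<integral>\<omega>. (lin I c \<omega>)\<^sup>2 \<partial>P) = quad I (cov_kernel P) c"
      using int2 by (simp add: quad_def integral_sum cov)
    then show ?thesis using gaussian_rv_cos_sin[OF ps rv[OF I] m] by simp
  qed
  then show ?thesis using ps s by (simp add: gaussian_law_def)
qed

section \<open>Closure properties of exponential sums in the disorder\<close>

text \<open>Hides index set and weights, so that the renewal recursion can be followed without
  explicit coefficients. The terms are indexed by their sets of sites; terms with the same set are
  merged by adding weights.\<close>

definition is_exp_sum :: "nat set \<Rightarrow> ((nat \<Rightarrow> real) \<Rightarrow> real) \<Rightarrow> bool" where
  "is_exp_sum I F \<longleftrightarrow> (\<exists>J w. exp_sum J w (\<lambda>A. A) I \<and> F = (\<lambda>\<omega>. \<Sum>A\<in>J. w A * exp (\<Sum>a\<in>A. \<omega> a)))"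

lemma is_exp_sumE:
  assumes "is_exp_sum I F"
  obtains J w where "exp_sum J w (\<lambda>A. A) I" "F = exp_sum.Z J w (\<lambda>A. A)"
proof -
  obtain J w where *: "exp_sum J w (\<lambda>A. A) I" "F = (\<lambda>\<omega>. \<Sum>A\<in>J. w A * exp (\<Sum>a\<in>A. \<omega> a))"
    using assms by (auto simp: is_exp_sum_def)
  then have "F = exp_sum.Z J w (\<lambda>A. A)" by (simp add: exp_sum.Z_def[OF *(1)] fun_eq_iff)
  with * that show thesis by blast
qed

lemma is_exp_sum_const: "0 < c \<Longrightarrow> finite I \<Longrightarrow> is_exp_sum I (\<lambda>_. c)"
  unfolding is_exp_sum_def
  by (intro exI[of _ "{{}}"] exI[of _ "\<lambda>_. c"]) (auto simp: exp_sum_def)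

lemma is_exp_sum_mono: "is_exp_sum I F \<Longrightarrow> I \<subseteq> I' \<Longrightarrow> finite I' \<Longrightarrow> is_exp_sum I' F"
proof -
  assume F: "is_exp_sum I F" and I': "I \<subseteq> I'" "finite I'"
  obtain J w where *: "exp_sum J w (\<lambda>A. A) I" "F = (\<lambda>\<omega>. \<Sum>A\<in>J. w A * exp (\<Sum>a\<in>A. \<omega> a))"
    using F by (auto simp: is_exp_sum_def)
  have "exp_sum J w (\<lambda>A. A) I'" using *(1) I' unfolding exp_sum_def by auto
  with *(2) show "is_exp_sum I' F" unfolding is_exp_sum_def by blast
qed

lemma is_exp_sum_cmult:
  assumes "is_exp_sum I F" "0 < c"
  shows "is_exp_sum I (\<lambda>\<omega>. c * F \<omega>)"
proof -
  obtain J w where "exp_sum J w (\<lambda>A. A) I" "F = (\<lambda>\<omega>. \<Sum>A\<in>J. w A * exp (\<Sum>a\<in>A. \<omega> a))"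
    using assms by (auto simp: is_exp_sum_def)
  then show ?thesis unfolding is_exp_sum_def using assms(2)
    by (intro exI[of _ J] exI[of _ "\<lambda>A. c * w A"]) (auto simp: exp_sum_def sum_distrib_left mult.assoc)
qed

lemma is_exp_sum_add:
  assumes "is_exp_sum I F" "is_exp_sum I G"
  shows "is_exp_sum I (\<lambda>\<omega>. F \<omega> + G \<omega>)"
proof -
  obtain J w where F: "exp_sum J w (\<lambda>A. A) I" "F = (\<lambda>\<omega>. \<Sum>A\<in>J. w A * exp (\<Sum>a\<in>A. \<omega> a))"
    using assms by (auto simp: is_exp_sum_def)
  obtain J' w' where G: "exp_sum J' w' (\<lambda>A. A) I" "G = (\<lambda>\<omega>. \<Sum>A\<in>J'. w' A * exp (\<Sum>a\<in>A. \<omega> a))"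
    using assms by (auto simp: is_exp_sum_def)
  have fin: "finite J" "finite J'" using F(1) G(1) by (auto simp: exp_sum_def)
  let ?v = "\<lambda>A. (if A \<in> J then w A else 0) + (if A \<in> J' then w' A else 0)"
  have "(\<Sum>A\<in>J \<union> J'. ?v A * exp (\<Sum>a\<in>A. \<omega> a)) = F \<omega> + G \<omega>" for \<omega>
  proof -
    have "(\<Sum>A\<in>J \<union> J'. ?v A * exp (\<Sum>a\<in>A. \<omega> a))
        = (\<Sum>A\<in>J \<union> J'. if A \<in> J then w A * exp (\<Sum>a\<in>A. \<omega> a) else 0)
        + (\<Sum>A\<in>J \<union> J'. if A \<in> J' then w' A * exp (\<Sum>a\<in>A. \<omega> a) else 0)"
      by (subst sum.distrib[symmetric], rule sum.cong) (auto simp: distrib_right)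
    also have "(\<Sum>A\<in>J \<union> J'. if A \<in> J then w A * exp (\<Sum>a\<in>A. \<omega> a) else 0) = F \<omega>"
      unfolding F(2) using fin by (intro sum.mono_neutral_cong_right) auto
    also have "(\<Sum>A\<in>J \<union> J'. if A \<in> J' then w' A * exp (\<Sum>a\<in>A. \<omega> a) else 0) = G \<omega>"
      unfolding G(2) using fin by (intro sum.mono_neutral_cong_right) auto
    finally show ?thesis .
  qed
  moreover have "exp_sum (J \<union> J') ?v (\<lambda>A. A) I"
    using F(1) G(1) by (auto simp: exp_sum_def add_pos_pos)
  ultimately show ?thesis unfolding is_exp_sum_def
    by (intro exI[of _ "J \<union> J'"] exI[of _ ?v]) auto
qed

lemma is_exp_sum_sum:
  assumes "finite S" "S \<noteq> {}" "\<And>k. k \<in> S \<Longrightarrow> is_exp_sum I (F k)"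
  shows "is_exp_sum I (\<lambda>\<omega>. \<Sum>k\<in>S. F k \<omega>)"
  using assms
proof (induction S rule: finite_ne_induct)
  case (insert k S)
  then show ?case using is_exp_sum_add[of I "F k" "\<lambda>\<omega>. \<Sum>k\<in>S. F k \<omega>"] by simp
qed simp

text \<open>As \<open>k\<close> is a fresh site, it occurs in no exponent yet: insertion of
  \<open>k\<close> is injective on the index sets, and \<open>exp (\<omega> k)\<close> occurs
  exactly once in every term.\<close>

lemma is_exp_sum_mult_exp:
  assumes "is_exp_sum I F" "k \<notin> I"
  shows "is_exp_sum (insert k I) (\<lambda>\<omega>. exp (\<omega> k) * F \<omega>)"
proof -
  obtain J w where F: "exp_sum J w (\<lambda>A. A) I" "F = (\<lambda>\<omega>. \<Sum>A\<in>J. w A * exp (\<Sum>a\<in>A. \<omega> a))"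
    using assms by (auto simp: is_exp_sum_def)
  have sub: "A \<subseteq> I" "finite A" "k \<notin> A" if "A \<in> J" for A
  proof -
    show "A \<subseteq> I" using F(1) that by (simp add: exp_sum_def)
    then show "finite A" "k \<notin> A" using F(1) assms(2) by (auto simp: exp_sum_def dest: finite_subset)
  qed
  have inj: "inj_on (insert k) J"
    by (rule inj_onI) (metis Diff_insert_absorb sub(3))
  have "(\<Sum>B\<in>insert k ` J. w (B - {k}) * exp (\<Sum>a\<in>B. \<omega> a)) = exp (\<omega> k) * F \<omega>" for \<omega>
    unfolding F(2) sum.reindex[OF inj] sum_distrib_left
    by (rule sum.cong) (use sub in \<open>auto simp: exp_add\<close>)
  moreover have "exp_sum (insert k ` J) (\<lambda>B. w (B - {k})) (\<lambda>A. A) (insert k I)"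
    using F(1) sub by (auto simp: exp_sum_def)
  ultimately show ?thesis unfolding is_exp_sum_def
    by (intro exI[of _ "insert k ` J"] exI[of _ "\<lambda>B. w (B - {k})"]) auto
qed

lemma is_exp_sum_pos: "is_exp_sum I F \<Longrightarrow> 0 < F \<omega>"
  by (erule is_exp_sumE) (simp add: exp_sum.Z_pos)

lemma is_exp_sum_measurable: "is_exp_sum I F \<Longrightarrow> F \<in> borel_measurable borel"
  by (erule is_exp_sumE) (simp add: exp_sum.Z_measurable)

lemma is_exp_sum_integrable:
  assumes "is_exp_sum I F" "gaussian_law P K"
  shows "integrable P (\<lambda>\<omega>. ln (F \<omega>))" "integrable P (\<lambda>\<omega>. F \<omega> powr r)" "integrable P (\<lambda>\<omega>. 1 / F \<omega>)"
proof -
  obtain J w where F: "exp_sum J w (\<lambda>A. A) I" "F = exp_sum.Z J w (\<lambda>A. A)"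
    using assms(1) by (rule is_exp_sumE)
  show "integrable P (\<lambda>\<omega>. ln (F \<omega>))"
    using exp_sum.integrable_ln_Z[OF F(1) assms(2), of "\<lambda>_. 0" 1] by (simp add: F(2))
  show "integrable P (\<lambda>\<omega>. F \<omega> powr r)" "integrable P (\<lambda>\<omega>. 1 / F \<omega>)"
    unfolding F(2) by (rule exp_sum.integrable_Z_powr[OF F(1) assms(2)] exp_sum.integrable_inverse_Z[OF F(1) assms(2)])+
qed

lemma is_exp_sum_concentration:
  assumes "is_exp_sum I F" "gaussian_law P K" "0 \<le> r"
  shows "(\<integral>\<omega>. F \<omega> powr (- r) \<partial>P)
    \<le> exp (- r * (\<integral>\<omega>. ln (F \<omega>) \<partial>P) + r\<^sup>2 * (\<Sum>a\<in>I. \<Sum>b\<in>I. \<bar>K a b\<bar>))"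
proof -
  obtain J w where F: "exp_sum J w (\<lambda>A. A) I" "F = exp_sum.Z J w (\<lambda>A. A)"
    using assms(1) by (rule is_exp_sumE)
  show ?thesis unfolding F(2) by (rule exp_sum.gaussian_concentration[OF F(1) assms(2,3)])
qed

lemma is_exp_sum_decoupling:
  assumes "is_exp_sum I1 F" "is_exp_sum I2 G" "I1 \<inter> I2 = {}"
    and "gaussian_law P K" "\<And>a b. K a b = K b a"
  shows "(\<integral>\<omega>. 1 / (F \<omega> * G \<omega>) \<partial>P)
    \<le> exp (6 * (\<Sum>a\<in>I1. \<Sum>b\<in>I2. \<bar>K a b\<bar>)) * ((\<integral>\<omega>. 1 / F \<omega> \<partial>P) * (\<integral>\<omega>. 1 / G \<omega> \<partial>P))"
    and "integrable P (\<lambda>\<omega>. 1 / (F \<omega> * G \<omega>))"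
proof -
  obtain J w where F: "exp_sum J w (\<lambda>A. A) I1" "F = exp_sum.Z J w (\<lambda>A. A)"
    using assms(1) by (rule is_exp_sumE)
  obtain J' w' where G: "exp_sum J' w' (\<lambda>A. A) I2" "G = exp_sum.Z J' w' (\<lambda>A. A)"
    using assms(2) by (rule is_exp_sumE)
  interpret exp_sum_pair J w "\<lambda>A. A" I1 J' w' "\<lambda>A. A" I2
    using F(1) G(1) assms(3) by (simp add: exp_sum_pair_def exp_sum_pair_axioms_def)
  show "(\<integral>\<omega>. 1 / (F \<omega> * G \<omega>) \<partial>P)
    \<le> exp (6 * (\<Sum>a\<in>I1. \<Sum>b\<in>I2. \<bar>K a b\<bar>)) * ((\<integral>\<omega>. 1 / F \<omega> \<partial>P) * (\<integral>\<omega>. 1 / G \<omega> \<partial>P))"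
    unfolding F(2) G(2) by (rule decoupling[OF assms(4,5)])
  show "integrable P (\<lambda>\<omega>. 1 / (F \<omega> * G \<omega>))"
    using W.integrable_inverse_Z[OF assms(4)] by (simp only: Z_product F(2) G(2))
qed

text \<open>Jensen's inequality, obtained by integrating the tangent of the exponential at
  \<open>- m\<close>, where \<open>m\<close> is the mean of \<open>ln F\<close>.\<close>

lemma is_exp_sum_jensen:
  assumes "is_exp_sum I F" "gaussian_law P K"
  shows "- (\<integral>\<omega>. ln (F \<omega>) \<partial>P) \<le> ln (\<integral>\<omega>. 1 / F \<omega> \<partial>P)"
    and "0 < (\<integral>\<omega>. 1 / F \<omega> \<partial>P)"
proof -
  interpret prob_space P by (rule gaussian_lawD[OF assms(2)])
  note int = is_exp_sum_integrable[OF assms] and pos = is_exp_sum_pos[OF assms(1)]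
  define m where "m = (\<integral>\<omega>. ln (F \<omega>) \<partial>P)"
  have le: "exp (- m) * (1 + m - ln (F \<omega>)) \<le> 1 / F \<omega>" for \<omega>
  proof -
    have "exp (- m) * (1 + (m - ln (F \<omega>))) \<le> exp (- m) * exp (m - ln (F \<omega>))"
      by (intro mult_left_mono exp_ge_add_one_self) auto
    also have "\<dots> = 1 / F \<omega>" using pos[of \<omega>] by (simp add: exp_diff exp_minus field_simps)
    finally show ?thesis by (simp add: algebra_simps)
  qed
  have "exp (- m) = (\<integral>\<omega>. exp (- m) * (1 + m - ln (F \<omega>)) \<partial>P)"
    using int(1) by (simp add: prob_space m_def)
  also have "\<dots> \<le> (\<integral>\<omega>. 1 / F \<omega> \<partial>P)"
    using int le by (intro integral_mono) auto
  finally have *: "exp (- m) \<le> (\<integral>\<omega>. 1 / F \<omega> \<partial>P)" .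
  then show pos': "0 < (\<integral>\<omega>. 1 / F \<omega> \<partial>P)" by (rule less_le_trans[OF exp_gt_zero])
  show "- (\<integral>\<omega>. ln (F \<omega>) \<partial>P) \<le> ln (\<integral>\<omega>. 1 / F \<omega> \<partial>P)"
    using * pos' by (simp add: ln_ge_iff m_def)
qed

section \<open>Renewal partition functions\<close>

text \<open>Decomposition by the last jump, of length \<open>k + 1\<close>, before the endpoint;
  \<open>\<eta> a\<close> is the energy collected at the site \<open>a\<close>.\<close>

fun renewal_sum :: "(nat \<Rightarrow> real) \<Rightarrow> (nat \<Rightarrow> real) \<Rightarrow> nat \<Rightarrow> real" where
  "renewal_sum p \<eta> 0 = 1"
| "renewal_sum p \<eta> (Suc n) = exp (\<eta> (Suc n)) * (\<Sum>k\<le>n. p (Suc k) * renewal_sum p \<eta> (n - k))"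

text \<open>Belongs to the endpoint \<open>n + 1\<close> and omits the energy there, so it involves
  the sites up to \<open>n\<close> only.\<close>

definition renewal_sum_minus :: "(nat \<Rightarrow> real) \<Rightarrow> (nat \<Rightarrow> real) \<Rightarrow> nat \<Rightarrow> real" where
  "renewal_sum_minus p \<eta> n = (\<Sum>k\<le>n. p (Suc k) * renewal_sum p \<eta> (n - k))"

lemma renewal_sum_Suc: "renewal_sum p \<eta> (Suc n) = exp (\<eta> (Suc n)) * renewal_sum_minus p \<eta> n"
  by (simp add: renewal_sum_minus_def)

declare renewal_sum.simps(2) [simp del]

context
  fixes p :: "nat \<Rightarrow> real"
  assumes p_pos: "\<And>k. 0 < p (Suc k)"
begin

lemma renewal_sum_pos: "0 < renewal_sum p \<eta> n"
proof (induction n rule: less_induct)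
  case (less n)
  show ?case
  proof (cases n)
    case (Suc k)
    then show ?thesis using less p_pos
      by (auto simp: renewal_sum.simps(2) intro!: mult_pos_pos sum_pos)
  qed simp
qed

text \<open>The single jump from 0 to \<open>n + 1\<close> visits no site in between, so its
  contribution is free of disorder.\<close>

lemma renewal_sum_minus_ge: "p (Suc n) \<le> renewal_sum_minus p \<eta> n"
proof -
  have "p (Suc n) * renewal_sum p \<eta> (n - n) \<le> (\<Sum>k\<le>n. p (Suc k) * renewal_sum p \<eta> (n - k))"
    using p_pos renewal_sum_pos
    by (intro member_le_sum[of n "{..n}" "\<lambda>k. p (Suc k) * renewal_sum p \<eta> (n - k)"])
       (auto simp: less_imp_le)
  then show ?thesis by (simp add: renewal_sum_minus_def)
qed

text \<open>Restricts to paths that visit \<open>m\<close>. The assumption has the shape of an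
  induction hypothesis, so the lemma serves both inside the induction for \<open>renewal_sum\<close>
  and after it.\<close>

lemma renewal_sum_minus_supermult_aux:
  assumes "\<And>j. j \<le> n \<Longrightarrow> renewal_sum p \<eta> m * renewal_sum p (\<lambda>a. \<eta> (a + m)) j \<le> renewal_sum p \<eta> (m + j)"
  shows "renewal_sum p \<eta> m * renewal_sum_minus p (\<lambda>a. \<eta> (a + m)) n \<le> renewal_sum_minus p \<eta> (m + n)"
proof -
  have "renewal_sum p \<eta> m * renewal_sum_minus p (\<lambda>a. \<eta> (a + m)) n
      = (\<Sum>k\<le>n. p (Suc k) * (renewal_sum p \<eta> m * renewal_sum p (\<lambda>a. \<eta> (a + m)) (n - k)))"
    by (simp add: renewal_sum_minus_def sum_distrib_left mult_ac)
  also have "\<dots> \<le> (\<Sum>k\<le>n. p (Suc k) * renewal_sum p \<eta> (m + (n - k)))"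
    by (intro sum_mono mult_left_mono assms) (use p_pos in \<open>auto simp: less_imp_le\<close>)
  also have "\<dots> = (\<Sum>k\<le>n. p (Suc k) * renewal_sum p \<eta> (m + n - k))"
    by (rule sum.cong) auto
  also have "\<dots> \<le> (\<Sum>k\<le>m + n. p (Suc k) * renewal_sum p \<eta> (m + n - k))"
    using p_pos renewal_sum_pos by (intro sum_mono2) (auto simp: less_imp_le)
  finally show ?thesis by (simp add: renewal_sum_minus_def)
qed

lemma renewal_sum_supermult:
  "renewal_sum p \<eta> m * renewal_sum p (\<lambda>a. \<eta> (a + m)) n \<le> renewal_sum p \<eta> (m + n)"
proof (induction n rule: less_induct)
  case (less n)
  show ?case
  proof (cases n)
    case (Suc k)
    have "renewal_sum p \<eta> m * renewal_sum_minus p (\<lambda>a. \<eta> (a + m)) k \<le> renewal_sum_minus p \<eta> (m + k)"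
      using less Suc by (intro renewal_sum_minus_supermult_aux) auto
    then have "exp (\<eta> (Suc (m + k))) * (renewal_sum p \<eta> m * renewal_sum_minus p (\<lambda>a. \<eta> (a + m)) k)
        \<le> exp (\<eta> (Suc (m + k))) * renewal_sum_minus p \<eta> (m + k)"
      by (intro mult_left_mono) auto
    then show ?thesis by (simp add: Suc renewal_sum_Suc mult_ac add_ac)
  qed simp
qed

lemma renewal_sum_minus_supermult:
  "renewal_sum p \<eta> m * renewal_sum_minus p (\<lambda>a. \<eta> (a + m)) n \<le> renewal_sum_minus p \<eta> (m + n)"
  by (rule renewal_sum_minus_supermult_aux[OF renewal_sum_supermult])

text \<open>Path probabilities have total mass at most 1, and no path collects more energy than the
  sum of all \<open>|\<eta> a|\<close>.\<close>

lemma renewal_sum_le: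
  assumes mass: "\<And>n. (\<Sum>k\<le>n. p (Suc k)) \<le> 1"
  shows "renewal_sum p \<eta> n \<le> exp (\<Sum>a=1..n. \<bar>\<eta> a\<bar>)"
proof (induction n rule: less_induct)
  case (less n)
  show ?case
  proof (cases n)
    case (Suc k)
    have "(\<Sum>i\<le>k. p (Suc i) * renewal_sum p \<eta> (k - i)) \<le> (\<Sum>i\<le>k. p (Suc i) * exp (\<Sum>a=1..k. \<bar>\<eta> a\<bar>))"
    proof (intro sum_mono mult_left_mono)
      fix i
      have "renewal_sum p \<eta> (k - i) \<le> exp (\<Sum>a=1..k - i. \<bar>\<eta> a\<bar>)" using less Suc by auto
      also have "\<dots> \<le> exp (\<Sum>a=1..k. \<bar>\<eta> a\<bar>)" by (auto intro!: sum_mono2)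
      finally show "renewal_sum p \<eta> (k - i) \<le> exp (\<Sum>a=1..k. \<bar>\<eta> a\<bar>)" .
    qed (use p_pos in \<open>auto simp: less_imp_le\<close>)
    also have "\<dots> = (\<Sum>i\<le>k. p (Suc i)) * exp (\<Sum>a=1..k. \<bar>\<eta> a\<bar>)" by (simp add: sum_distrib_right)
    also have "\<dots> \<le> 1 * exp (\<Sum>a=1..k. \<bar>\<eta> a\<bar>)" using mass by (intro mult_right_mono) auto
    finally have "renewal_sum p \<eta> n \<le> exp \<bar>\<eta> n\<bar> * exp (\<Sum>a=1..k. \<bar>\<eta> a\<bar>)"
      unfolding Suc renewal_sum.simps(2) using p_pos renewal_sum_pos
      by (intro mult_mono) (auto intro!: sum_nonneg mult_nonneg_nonneg simp: less_imp_le)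
    then show ?thesis by (simp add: Suc exp_add mult.commute)
  qed simp
qed

lemma renewal_sum_mono:
  assumes "\<And>a. \<eta> a \<le> \<eta>' a"
  shows "renewal_sum p \<eta> n \<le> renewal_sum p \<eta>' n"
proof (induction n rule: less_induct)
  case (less n)
  show ?case
  proof (cases n)
    case (Suc k)
    then show ?thesis using less p_pos assms renewal_sum_pos
      by (auto simp: renewal_sum.simps(2) less_imp_le
          intro!: mult_mono sum_mono sum_nonneg mult_nonneg_nonneg)
  qed simp
qed

lemma renewal_sum_minus_mono:
  assumes "\<And>a. \<eta> a \<le> \<eta>' a"
  shows "renewal_sum_minus p \<eta> n \<le> renewal_sum_minus p \<eta>' n"
  unfolding renewal_sum_minus_def
  using renewal_sum_mono[OF assms] p_pos by (intro sum_mono mult_left_mono) (auto simp: less_imp_le)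

text \<open>A path to \<open>n\<close> has at most \<open>n\<close> renewals, each of which gains
  \<open>\<delta>\<close>.\<close>

lemma renewal_sum_shift_le:
  assumes "0 \<le> \<delta>"
  shows "renewal_sum p (\<lambda>a. \<delta> + \<eta> a) n \<le> exp (\<delta> * real n) * renewal_sum p \<eta> n"
proof (induction n rule: less_induct)
  case (less n)
  show ?case
  proof (cases n)
    case (Suc k)
    have "(\<Sum>i\<le>k. p (Suc i) * renewal_sum p (\<lambda>a. \<delta> + \<eta> a) (k - i))
        \<le> (\<Sum>i\<le>k. p (Suc i) * (exp (\<delta> * real k) * renewal_sum p \<eta> (k - i)))"
    proof (intro sum_mono mult_left_mono)
      fix i
      have "renewal_sum p (\<lambda>a. \<delta> + \<eta> a) (k - i) \<le> exp (\<delta> * real (k - i)) * renewal_sum p \<eta> (k - i)"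
        using less Suc by auto
      also have "\<dots> \<le> exp (\<delta> * real k) * renewal_sum p \<eta> (k - i)"
        using assms renewal_sum_pos by (intro mult_right_mono) (auto simp: less_imp_le intro: mult_left_mono)
      finally show "renewal_sum p (\<lambda>a. \<delta> + \<eta> a) (k - i) \<le> exp (\<delta> * real k) * renewal_sum p \<eta> (k - i)" .
    qed (use p_pos in \<open>auto simp: less_imp_le\<close>)
    then have "exp (\<delta> + \<eta> n) * (\<Sum>i\<le>k. p (Suc i) * renewal_sum p (\<lambda>a. \<delta> + \<eta> a) (k - i))
       \<le> exp (\<delta> + \<eta> n) * (exp (\<delta> * real k) * (\<Sum>i\<le>k. p (Suc i) * renewal_sum p \<eta> (k - i)))"
      by (intro mult_left_mono) (auto simp: sum_distrib_left mult_ac)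
    also have "\<dots> = exp (\<delta> * real n) * (exp (\<eta> n) * (\<Sum>i\<le>k. p (Suc i) * renewal_sum p \<eta> (k - i)))"
      by (simp add: Suc exp_add[symmetric] algebra_simps mult_exp_exp)
    finally show ?thesis by (simp add: Suc renewal_sum.simps(2))
  qed simp
qed

lemma renewal_sum_minus_shift_le:
  assumes "0 \<le> \<delta>"
  shows "renewal_sum_minus p (\<lambda>a. \<delta> + \<eta> a) n \<le> exp (\<delta> * real n) * renewal_sum_minus p \<eta> n"
  unfolding renewal_sum_minus_def sum_distrib_left
proof (rule sum_mono)
  fix i
  have "renewal_sum p (\<lambda>a. \<delta> + \<eta> a) (n - i) \<le> exp (\<delta> * real (n - i)) * renewal_sum p \<eta> (n - i)"
    by (rule renewal_sum_shift_le[OF assms])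
  also have "\<dots> \<le> exp (\<delta> * real n) * renewal_sum p \<eta> (n - i)"
    using assms renewal_sum_pos by (intro mult_right_mono) (auto simp: less_imp_le intro: mult_left_mono)
  finally have "p (Suc i) * renewal_sum p (\<lambda>a. \<delta> + \<eta> a) (n - i) \<le> p (Suc i) * (exp (\<delta> * real n) * renewal_sum p \<eta> (n - i))"
    using p_pos by (intro mult_left_mono) (auto simp: less_imp_le)
  then show "p (Suc i) * renewal_sum p (\<lambda>a. \<delta> + \<eta> a) (n - i) \<le> exp (\<delta> * real n) * (p (Suc i) * renewal_sum p \<eta> (n - i))"
    by (simp add: mult_ac)
qed

text \<open>The endpoint is a fresh site: the earlier part of a path uses strictly smaller sites.
  The offset \<open>m\<close> provides the second block of a split system.\<close>

lemma is_exp_sum_renewal_sum: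
  "is_exp_sum {m + 1..m + n} (\<lambda>\<omega>. renewal_sum p (\<lambda>a. h + \<omega> (a + m)) n)"
proof (induction n rule: less_induct)
  case (less n)
  show ?case
  proof (cases n)
    case 0
    then show ?thesis by (simp add: is_exp_sum_const)
  next
    case (Suc k)
    have "is_exp_sum {m + 1..m + k} (\<lambda>\<omega>. \<Sum>i\<le>k. p (Suc i) * renewal_sum p (\<lambda>a. h + \<omega> (a + m)) (k - i))"
    proof (intro is_exp_sum_sum is_exp_sum_cmult p_pos)
      fix i
      have "is_exp_sum {m + 1..m + (k - i)} (\<lambda>\<omega>. renewal_sum p (\<lambda>a. h + \<omega> (a + m)) (k - i))"
        using less Suc by auto
      then show "is_exp_sum {m + 1..m + k} (\<lambda>\<omega>. renewal_sum p (\<lambda>a. h + \<omega> (a + m)) (k - i))"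
        by (rule is_exp_sum_mono) auto
    qed auto
    from is_exp_sum_cmult[OF is_exp_sum_mult_exp[OF this, of "Suc (m + k)"], of "exp h"]
    have "is_exp_sum (insert (Suc (m + k)) {m + 1..m + k})
      (\<lambda>\<omega>. renewal_sum p (\<lambda>a. h + \<omega> (a + m)) n)"
      by (simp add: Suc renewal_sum.simps(2) exp_add mult_ac add_ac)
    moreover have "insert (Suc (m + k)) {m + 1..m + k} = {m + 1..m + n}" using Suc by auto
    ultimately show ?thesis by simp
  qed
qed

lemma is_exp_sum_renewal_sum_minus:
  "is_exp_sum {m + 1..m + n} (\<lambda>\<omega>. renewal_sum_minus p (\<lambda>a. h + \<omega> (a + m)) n)"
  unfolding renewal_sum_minus_def
proof (intro is_exp_sum_sum is_exp_sum_cmult p_pos)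
  fix i
  show "is_exp_sum {m + 1..m + n} (\<lambda>\<omega>. renewal_sum p (\<lambda>a. h + \<omega> (a + m)) (n - i))"
    by (rule is_exp_sum_mono[OF is_exp_sum_renewal_sum]) auto
qed auto

end

section \<open>Identification of the partition functions with the renewal recursion\<close>

context
  fixes M :: "'b measure" and T :: "nat \<Rightarrow> 'b \<Rightarrow> nat" and \<alpha> :: real and l :: "real \<Rightarrow> real"
  assumes renewal: "renewal_process M T \<alpha> l"
begin

interpretation prob_space M using renewal unfolding renewal_process_def by blast

definition jump_prob :: "nat \<Rightarrow> real" where "jump_prob k = measure M {x \<in> space M. T 1 x = k}"

lemma jump_prob_pos: "0 < jump_prob (Suc k)"
proof -
  have "\<forall>t\<ge>1. measure M {x \<in> space M. T 1 x = t} > 0"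
    using renewal unfolding renewal_process_def by blast
  then show ?thesis unfolding jump_prob_def by (metis le_add1 plus_1_eq_Suc)
qed

lemma T_measurable: "1 \<le> i \<Longrightarrow> T i \<in> M \<rightarrow>\<^sub>M count_space UNIV"
  using renewal unfolding renewal_process_def indep_vars_def2 by auto

lemma T_ge_1: "1 \<le> i \<Longrightarrow> x \<in> space M \<Longrightarrow> 1 \<le> T i x"
  using renewal unfolding renewal_process_def by blast

lemma prob_T_eq:
  assumes "1 \<le> i"
  shows "measure M {x \<in> space M. T i x = k} = jump_prob k"
proof -
  have "distr M (count_space UNIV) (T i) = distr M (count_space UNIV) (T 1)"
    using renewal assms unfolding renewal_process_def by blast
  then have "measure (distr M (count_space UNIV) (T i)) {k} = measure (distr M (count_space UNIV) (T 1)) {k}"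
    by simp
  moreover have "measure (distr M (count_space UNIV) (T j)) {k} = measure M {x \<in> space M. T j x = k}"
    if "1 \<le> j" for j
    using T_measurable[OF that] by (subst measure_distr) (auto intro!: arg_cong[where f="measure M"])
  ultimately show ?thesis using assms by (simp add: jump_prob_def)
qed

lemma jump_prob_mass: "(\<Sum>k\<le>n. jump_prob (Suc k)) \<le> 1"
proof -
  have *: "{x \<in> space M. T 1 x = k} \<in> events" for k
    using T_measurable[of 1] by measurable
  have "(\<Sum>k\<le>n. jump_prob (Suc k)) = measure M (\<Union>k\<le>n. {x \<in> space M. T 1 x = Suc k})"
    unfolding jump_prob_def
    by (rule finite_measure_finite_Union[symmetric]) (use * in \<open>auto simp: disjoint_family_on_def\<close>)
  also have "\<dots> \<le> 1" by (rule prob_le_1)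
  finally show ?thesis .
qed

lemma renewal_time_Suc: "renewal_time T (Suc N) x = renewal_time T N x + T (Suc N) x"
  by (simp add: renewal_time_def)

lemma renewal_time_mono: "i \<le> j \<Longrightarrow> renewal_time T i x \<le> renewal_time T j x"
  unfolding renewal_time_def by (intro sum_mono2) auto

lemma renewal_time_less: "i < j \<Longrightarrow> x \<in> space M \<Longrightarrow> renewal_time T i x < renewal_time T j x"
proof (induction j)
  case (Suc j)
  have "1 \<le> T (Suc j) x" using T_ge_1 Suc.prems by simp
  then have "renewal_time T j x < renewal_time T (Suc j) x" by (simp add: renewal_time_Suc)
  with Suc show ?case by (cases "i = j") auto
qed simp

lemma renewal_time_ge: "x \<in> space M \<Longrightarrow> N \<le> renewal_time T N x"
proof (induction N)
  case (Suc N)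
  have "1 \<le> T (Suc N) x" using T_ge_1 Suc.prems by simp
  with Suc show ?case by (simp add: renewal_time_Suc)
qed simp

lemma renewal_time_measurable: "renewal_time T N \<in> M \<rightarrow>\<^sub>M count_space UNIV"
proof (induction N)
  case 0
  then show ?case by (simp add: renewal_time_def)
next
  case (Suc N)
  have [measurable]: "T (Suc N) \<in> M \<rightarrow>\<^sub>M count_space UNIV" "renewal_time T N \<in> M \<rightarrow>\<^sub>M count_space UNIV"
    using T_measurable Suc by auto
  have "(\<lambda>x. renewal_time T N x + T (Suc N) x) \<in> M \<rightarrow>\<^sub>M count_space UNIV" by measurable
  then show ?case by (simp add: renewal_time_Suc cong: measurable_cong)
qed

text \<open>The Boltzmann weight of the paths whose \<open>N\<close>-th renewal is at
  \<open>n\<close>. Fixing the number of renewals makes the last jump an explicit random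
  variable.\<close>

definition path_weight :: "(nat \<Rightarrow> real) \<Rightarrow> nat \<Rightarrow> nat \<Rightarrow> 'b \<Rightarrow> real" where
  "path_weight \<eta> N n x = indicator {n} (renewal_time T N x) * exp (\<Sum>i=1..N. \<eta> (renewal_time T i x))"

lemma path_weight_measurable: "path_weight \<eta> N n \<in> borel_measurable M"
proof -
  have [measurable]: "(\<lambda>x. g (renewal_time T i x)) \<in> borel_measurable M" for g :: "nat \<Rightarrow> real" and i
    by (rule measurable_compose[OF renewal_time_measurable]) simp
  show ?thesis unfolding path_weight_def by measurable
qed

lemma path_weight_integrable: "integrable M (path_weight \<eta> N n)"
proof (rule integrable_const_bound[OF AE_I2 path_weight_measurable])
  fix x assume x: "x \<in> space M"
  show "norm (path_weight \<eta> N n x) \<le> exp (\<Sum>i=1..N. \<Sum>a\<le>n. \<bar>\<eta> a\<bar>)"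
  proof (cases "renewal_time T N x = n")
    case True
    have "\<eta> (renewal_time T i x) \<le> (\<Sum>a\<le>n. \<bar>\<eta> a\<bar>)" if "i \<in> {1..N}" for i
    proof -
      have "renewal_time T i x \<le> n" using renewal_time_mono[of i N x] that True by auto
      then have "\<bar>\<eta> (renewal_time T i x)\<bar> \<le> (\<Sum>a\<le>n. \<bar>\<eta> a\<bar>)"
        by (intro member_le_sum[where f="\<lambda>a. \<bar>\<eta> a\<bar>"]) auto
      then show ?thesis by simp
    qed
    then have "(\<Sum>i=1..N. \<eta> (renewal_time T i x)) \<le> (\<Sum>i=1..N. \<Sum>a\<le>n. \<bar>\<eta> a\<bar>)" by (rule sum_mono)
    then show ?thesis by (simp add: path_weight_def indicator_def)
  qed (simp add: path_weight_def)
qed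

text \<open>Conditioning on the last jump, which is independent of the first \<open>N\<close> jumps
  and distributed like the first one.\<close>

lemma expectation_path_weight_Suc:
  "expectation (path_weight \<eta> (Suc N) (Suc n))
    = exp (\<eta> (Suc n)) * (\<Sum>k\<le>n. jump_prob (Suc k) * expectation (path_weight \<eta> N (n - k)))"
proof -
  have ind: "indep_vars (\<lambda>_. count_space UNIV) T {1..}" using renewal unfolding renewal_process_def by blast
  have split: "path_weight \<eta> (Suc N) (Suc n) x
      = exp (\<eta> (Suc n)) * (\<Sum>k\<le>n. path_weight \<eta> N (n - k) x * indicator {Suc k} (T (Suc N) x))"
    if x: "x \<in> space M" for x
  proof (cases "renewal_time T (Suc N) x = Suc n")
    case True
    have T1: "1 \<le> T (Suc N) x" using T_ge_1 x by simp
    define k where "k = T (Suc N) x - 1"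
    have k: "T (Suc N) x = Suc k" "k \<le> n" "renewal_time T N x = n - k"
      using True T1 by (auto simp: k_def renewal_time_Suc)
    have "(\<Sum>j\<le>n. path_weight \<eta> N (n - j) x * indicator {Suc j} (T (Suc N) x)) = path_weight \<eta> N (n - k) x"
      using k by (subst sum.remove[of _ k]) (auto simp: indicator_def intro!: sum.neutral)
    then show ?thesis using True k by (simp add: path_weight_def exp_add mult.commute)
  next
    case False
    have "path_weight \<eta> N (n - j) x * indicator {Suc j} (T (Suc N) x) = 0" if "j \<le> n" for j
      using False that by (auto simp: path_weight_def indicator_def renewal_time_Suc)
    then have "(\<Sum>j\<le>n. path_weight \<eta> N (n - j) x * indicator {Suc j} (T (Suc N) x)) = 0"
      by (intro sum.neutral) auto
    moreover have "path_weight \<eta> (Suc N) (Suc n) x = 0" using False by (simp add: path_weight_def)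
    ultimately show ?thesis by simp
  qed
  have factor: "expectation (\<lambda>x. path_weight \<eta> N j x * indicator {Suc k} (T (Suc N) x))
      = expectation (path_weight \<eta> N j) * jump_prob (Suc k)
      \<and> integrable M (\<lambda>x. path_weight \<eta> N j x * indicator {Suc k} (T (Suc N) x))" for j k
  proof -
    define f where "f t = indicator {j} (\<Sum>i=1..N. t i) * exp (\<Sum>i=1..N. \<eta> (\<Sum>r=1..i. t r))" for t :: "nat \<Rightarrow> nat"
    define g where "g t = (indicator {Suc k} (t (Suc N)) :: real)" for t :: "nat \<Rightarrow> nat"
    \<comment> \<open>A finite product of discrete sigma-fields is discrete, so \<open>f\<close> and
      \<open>g\<close> are measurable whatever they are.\<close>
    have cs: "PiM A (\<lambda>_. count_space (UNIV :: nat set)) = count_space (PiE A (\<lambda>_. UNIV))" if "finite A" for A :: "nat set"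
      using that by (intro count_space_PiM_finite) auto
    have iv: "indep_var (PiM {1..N} (\<lambda>_. count_space UNIV)) (\<lambda>x. restrict (\<lambda>i. T i x) {1..N})
        (PiM {Suc N} (\<lambda>_. count_space UNIV)) (\<lambda>x. restrict (\<lambda>i. T i x) {Suc N})"
      by (rule indep_var_restrict[OF ind]) auto
    have "indep_var borel (f \<circ> (\<lambda>x. restrict (\<lambda>i. T i x) {1..N})) borel (g \<circ> (\<lambda>x. restrict (\<lambda>i. T i x) {Suc N}))"
      by (rule indep_var_compose[OF iv]) (simp_all add: cs)
    moreover have "f \<circ> (\<lambda>x. restrict (\<lambda>i. T i x) {1..N}) = path_weight \<eta> N j"
    proof
      fix x
      have "(\<Sum>r=1..i. restrict (\<lambda>i. T i x) {1..N} r) = renewal_time T i x" if "i \<le> N" for i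
        unfolding renewal_time_def using that by (intro sum.cong) auto
      then show "(f \<circ> (\<lambda>x. restrict (\<lambda>i. T i x) {1..N})) x = path_weight \<eta> N j x"
        unfolding f_def path_weight_def comp_def by simp
    qed
    moreover have "g \<circ> (\<lambda>x. restrict (\<lambda>i. T i x) {Suc N}) = (\<lambda>x. indicator {Suc k} (T (Suc N) x))"
      by (simp add: g_def fun_eq_iff)
    ultimately have iv': "indep_var borel (path_weight \<eta> N j) borel (\<lambda>x. indicator {Suc k} (T (Suc N) x) :: real)"
      by simp
    have ev: "{x \<in> space M. T (Suc N) x = Suc k} \<in> events"
      using T_measurable[of "Suc N"] by measurable
    have ind_eq: "(indicator {Suc k} (T (Suc N) x) :: real) = indicator {x \<in> space M. T (Suc N) x = Suc k} x"
      if "x \<in> space M" for x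
      using that by (simp add: indicator_def)
    have "integrable M (\<lambda>x. indicator {x \<in> space M. T (Suc N) x = Suc k} x :: real)"
      using ev by (simp add: emeasure_eq_measure)
    then have ii: "integrable M (\<lambda>x. indicator {Suc k} (T (Suc N) x) :: real)"
      using ind_eq by (simp cong: Bochner_Integration.integrable_cong)
    have "expectation (\<lambda>x. indicator {Suc k} (T (Suc N) x) :: real)
        = expectation (\<lambda>x. indicator {x \<in> space M. T (Suc N) x = Suc k} x)"
      using ind_eq by (intro Bochner_Integration.integral_cong) auto
    also have "\<dots> = jump_prob (Suc k)"
      using ev prob_T_eq[of "Suc N" "Suc k"] by simp
    finally have "expectation (\<lambda>x. indicator {Suc k} (T (Suc N) x) :: real) = jump_prob (Suc k)" .
    then show ?thesis
      using indep_var_lebesgue_integral[OF iv' path_weight_integrable ii]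
        indep_var_integrable[OF iv' path_weight_integrable ii] by simp
  qed
  have "expectation (path_weight \<eta> (Suc N) (Suc n))
      = expectation (\<lambda>x. exp (\<eta> (Suc n)) * (\<Sum>k\<le>n. path_weight \<eta> N (n - k) x * indicator {Suc k} (T (Suc N) x)))"
    using split by (intro Bochner_Integration.integral_cong) auto
  also have "\<dots> = exp (\<eta> (Suc n)) * (\<Sum>k\<le>n. expectation (path_weight \<eta> N (n - k)) * jump_prob (Suc k))"
    unfolding integral_mult_right_zero
    by (subst Bochner_Integration.integral_sum) (simp_all only: factor)
  finally show ?thesis by (simp add: mult.commute)
qed

lemma path_weight_vanish: "n < N \<Longrightarrow> expectation (path_weight \<eta> N n) = 0"
proof -
  assume n: "n < N"
  have "path_weight \<eta> N n x = 0" if "x \<in> space M" for x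
    using renewal_time_ge[OF that, of N] n by (auto simp: path_weight_def indicator_def)
  then have "expectation (path_weight \<eta> N n) = expectation (\<lambda>_. 0)"
    by (intro Bochner_Integration.integral_cong) auto
  then show ?thesis by simp
qed

text \<open>Renewal times increase by at least 1, so more than \<open>n\<close> renewals up to
  \<open>n\<close> are impossible and every cutoff \<open>m\<close> from \<open>n\<close> on gives
  the same sum. The freedom in \<open>m\<close> is needed in the induction, where one cutoff serves
  all shorter systems.\<close>

lemma sum_expectation_path_weight:
  assumes "n \<le> m"
  shows "(\<Sum>N\<le>m. expectation (path_weight \<eta> N n)) = renewal_sum jump_prob \<eta> n"
  using assms
proof (induction n arbitrary: m rule: less_induct)
  case (less n)
  have 0: "path_weight \<eta> 0 j x = indicator {j} (0::nat)" for j x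
    by (simp add: path_weight_def renewal_time_def)
  show ?case
  proof (cases n)
    case 0
    have "(\<Sum>N\<le>m. expectation (path_weight \<eta> N 0)) = (\<Sum>N\<in>{0}. expectation (path_weight \<eta> N 0))"
      by (rule sum.mono_neutral_right) (auto intro!: path_weight_vanish)
    also have "\<dots> = 1" using prob_space by (simp add: \<open>\<And>j x. path_weight \<eta> 0 j x = indicator {j} 0\<close>[abs_def])
    finally show ?thesis by (simp add: 0)
  next
    case (Suc k)
    obtain m' where m': "m = Suc m'" using less.prems Suc by (cases m) auto
    have "(\<Sum>N\<le>m. expectation (path_weight \<eta> N n)) = (\<Sum>N\<le>m'. expectation (path_weight \<eta> (Suc N) (Suc k)))"
      unfolding m' Suc sum.atMost_Suc_shift by (simp add: 0[abs_def])
    also have "\<dots> = exp (\<eta> (Suc k)) * (\<Sum>N\<le>m'. \<Sum>i\<le>k. jump_prob (Suc i) * expectation (path_weight \<eta> N (k - i)))"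
      unfolding expectation_path_weight_Suc by (simp add: sum_distrib_left)
    also have "(\<Sum>N\<le>m'. \<Sum>i\<le>k. jump_prob (Suc i) * expectation (path_weight \<eta> N (k - i)))
        = (\<Sum>i\<le>k. \<Sum>N\<le>m'. jump_prob (Suc i) * expectation (path_weight \<eta> N (k - i)))"
      by (rule sum.swap)
    also have "\<dots> = (\<Sum>i\<le>k. jump_prob (Suc i) * renewal_sum jump_prob \<eta> (k - i))"
      unfolding sum_distrib_left[symmetric]
      using less Suc m' by (intro sum.cong refl arg_cong2[where f="(*)"]) auto
    finally show ?thesis by (simp add: Suc renewal_sum.simps(2))
  qed
qed

text \<open>If \<open>n\<close> is a renewal point, it is the \<open>N\<close>-th one for exactly
  one \<open>N\<close>, and the renewal points in \<open>{1..n}\<close> are then the first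
  \<open>N\<close> renewal times. Summation over \<open>N\<close> removes the choice.\<close>

lemma partition_fun_eq: "partition_fun M T n h \<omega> = renewal_sum jump_prob (\<lambda>a. h + \<omega> a) n"
proof -
  define \<eta> where "\<eta> a = h + \<omega> a" for a
  have "exp (\<Sum>a=1..n. \<eta> a * renewal_indicator T a x) * renewal_indicator T n x = (\<Sum>N\<le>n. path_weight \<eta> N n x)"
    if x: "x \<in> space M" for x
  proof (cases "\<exists>N. renewal_time T N x = n")
    case True
    then obtain N where N: "renewal_time T N x = n" by blast
    have Nn: "N \<le> n" using renewal_time_ge[OF x, of N] N by simp
    have uniq: "N' = N" if "renewal_time T N' x = n" for N'
      using renewal_time_less[OF _ x] N that by (metis linorder_neqE_nat less_irrefl)
    have inj: "inj_on (\<lambda>i. renewal_time T i x) {1..N}"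
      by (rule inj_onI) (metis linorder_neqE_nat less_irrefl renewal_time_less[OF _ x])
    have img: "{a \<in> {1..n}. a \<in> range (\<lambda>i. renewal_time T i x)} = (\<lambda>i. renewal_time T i x) ` {1..N}"
    proof (intro set_eqI iffI)
      fix a assume "a \<in> {a \<in> {1..n}. a \<in> range (\<lambda>i. renewal_time T i x)}"
      then obtain i where i: "a = renewal_time T i x" "1 \<le> a" "a \<le> n" by auto
      have "i \<noteq> 0" using i by (auto simp: renewal_time_def intro: gr0I)
      moreover have "i \<le> N" using i N renewal_time_less[OF _ x, of N i] by (meson not_le)
      ultimately show "a \<in> (\<lambda>i. renewal_time T i x) ` {1..N}" using i by auto
    next
      fix a assume "a \<in> (\<lambda>i. renewal_time T i x) ` {1..N}"
      then obtain i where i: "a = renewal_time T i x" "1 \<le> i" "i \<le> N" by auto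
      have "1 \<le> a" using renewal_time_ge[OF x, of i] i by simp
      moreover have "a \<le> n" using renewal_time_mono[OF i(3), of x] i N by simp
      ultimately show "a \<in> {a \<in> {1..n}. a \<in> range (\<lambda>i. renewal_time T i x)}" using i by auto
    qed
    have "(\<Sum>a=1..n. \<eta> a * renewal_indicator T a x) = (\<Sum>a\<in>{a \<in> {1..n}. a \<in> range (\<lambda>i. renewal_time T i x)}. \<eta> a)"
      unfolding renewal_indicator_def indicator_def
      by (subst sum.inter_filter, simp, rule sum.cong) auto
    also have "\<dots> = (\<Sum>i=1..N. \<eta> (renewal_time T i x))"
      unfolding img by (subst sum.reindex[OF inj]) simp
    finally have e: "(\<Sum>a=1..n. \<eta> a * renewal_indicator T a x) = (\<Sum>i=1..N. \<eta> (renewal_time T i x))" .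
    have "(\<Sum>N\<le>n. path_weight \<eta> N n x) = (\<Sum>N\<in>{N}. path_weight \<eta> N n x)"
      using Nn uniq by (intro sum.mono_neutral_right) (auto simp: path_weight_def indicator_def)
    also have "\<dots> = exp (\<Sum>i=1..N. \<eta> (renewal_time T i x))" using N by (simp add: path_weight_def)
    finally show ?thesis using N e by (auto simp: renewal_indicator_def indicator_def)
  next
    case False
    then show ?thesis by (auto simp: renewal_indicator_def path_weight_def indicator_def intro!: sum.neutral)
  qed
  then have "partition_fun M T n h \<omega> = expectation (\<lambda>x. \<Sum>N\<le>n. path_weight \<eta> N n x)"
    unfolding partition_fun_def \<eta>_def by (intro Bochner_Integration.integral_cong) auto
  also have "\<dots> = renewal_sum jump_prob \<eta> n"
    using path_weight_integrable by (simp add: integral_sum sum_expectation_path_weight)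
  finally show ?thesis by (simp add: \<eta>_def[abs_def])
qed

lemma partition_fun_minus_eq:
  "partition_fun_minus M T (Suc n) h \<omega> = renewal_sum_minus jump_prob (\<lambda>a. h + \<omega> a) n"
proof -
  have "exp (- x) * (exp x * z) = z" for x z :: real by (simp add: exp_minus)
  then show ?thesis unfolding partition_fun_minus_def partition_fun_eq renewal_sum_Suc by blast
qed

end

section \<open>Limits and covariance sums\<close>

lemma cesaro_null:
  fixes f :: "nat \<Rightarrow> real"
  assumes "f \<longlonglongrightarrow> 0" and nonneg: "\<And>i. 0 \<le> f i"
  shows "(\<lambda>m. (\<Sum>i=1..m. f i) / real m) \<longlonglongrightarrow> 0"
proof (rule LIMSEQ_I)
  fix e :: real assume e: "0 < e"
  obtain N where N: "\<And>i. i \<ge> N \<Longrightarrow> f i < e / 2"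
    using LIMSEQ_D[OF assms(1), of "e / 2"] e nonneg by auto
  define C where "C = (\<Sum>i\<le>N. f i)"
  have C: "0 \<le> C" unfolding C_def using nonneg by (intro sum_nonneg) auto
  obtain M :: nat where M: "2 * C / e < real M" using reals_Archimedean2 by blast
  show "\<exists>no. \<forall>m\<ge>no. norm ((\<Sum>i=1..m. f i) / real m - 0) < e"
  proof (intro exI[of _ "Suc M"] allI impI)
    fix m assume m: "Suc M \<le> m"
    have "(\<Sum>i=1..m. f i) \<le> (\<Sum>i\<in>{..N} \<union> {1..m} \<inter> {N<..}. f i)"
      using nonneg by (intro sum_mono2) auto
    also have "\<dots> = C + (\<Sum>i\<in>{1..m} \<inter> {N<..}. f i)"
      unfolding C_def by (rule sum.union_disjoint) auto
    also have "(\<Sum>i\<in>{1..m} \<inter> {N<..}. f i) \<le> (\<Sum>i\<in>{1..m} \<inter> {N<..}. e / 2)"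
      using N by (intro sum_mono) (auto simp: less_imp_le)
    also have "\<dots> \<le> (\<Sum>i=1..m. e / 2)" using e by (intro sum_mono2) auto
    finally have le: "(\<Sum>i=1..m. f i) \<le> C + real m * (e / 2)" by simp
    have "2 * C / e < real m" using M m by linarith
    then have "2 * C < real m * e" using e by (simp add: pos_divide_less_eq)
    with le have "(\<Sum>i=1..m. f i) < real m * e" by (simp add: field_simps)
    moreover have "0 \<le> (\<Sum>i=1..m. f i)" using nonneg by (intro sum_nonneg)
    ultimately show "norm ((\<Sum>i=1..m. f i) / real m - 0) < e"
      using m by (simp add: field_simps)
  qed
qed

text \<open>Fekete's lemma with an error that depends on the first block alone. Chopping off blocks
  of a fixed length \<open>m\<close> bounds the upper limit by \<open>(a m + \<phi> m) / m\<close>;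
  the infimum of these numbers bounds the lower limit because \<open>\<phi> n / n\<close>
  vanishes.\<close>

lemma almost_subadditive_convergent:
  fixes a \<phi> :: "nat \<Rightarrow> real"
  assumes sub: "\<And>m n. 1 \<le> m \<Longrightarrow> 1 \<le> n \<Longrightarrow> a (m + n) \<le> a m + \<phi> m + a n"
    and \<phi>: "(\<lambda>m. \<phi> m / real m) \<longlonglongrightarrow> 0" and \<phi>0: "\<And>m. 0 \<le> \<phi> m"
    and lower: "\<And>n. 1 \<le> n \<Longrightarrow> - C * real n \<le> a n"
  shows "convergent (\<lambda>n. a n / real n)"
proof -
  define b where "b m = (a m + \<phi> m) / real m" for m
  have b_ge: "- C \<le> b m" if "1 \<le> m" for m
    using lower[OF that] \<phi>0[of m] that by (simp add: b_def field_simps)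
  define L where "L = Inf (b ` {1..})"
  have bdd: "bdd_below (b ` {1..})" using b_ge by (intro bdd_belowI[of _ "- C"]) auto
  have L_le: "L \<le> b m" if "1 \<le> m" for m
    unfolding L_def using that bdd by (intro cInf_lower) auto
  have "(\<lambda>n. a n / real n) \<longlonglongrightarrow> L"
  proof (rule LIMSEQ_I)
    fix e :: real assume e: "0 < e"
    have "\<exists>x\<in>b ` {1..}. x < L + e / 2"
      unfolding L_def using e by (intro cInf_lessD) auto
    then obtain m where m: "1 \<le> m" "b m < L + e / 2" by auto
    define D where "D = (\<Sum>r=1..m. \<bar>a r\<bar>)"
    have blocks: "a (q * m + r) \<le> real q * (a m + \<phi> m) + a r" if "1 \<le> r" for q r
    proof (induction q)
      case (Suc q)
      have "a (m + (q * m + r)) \<le> a m + \<phi> m + a (q * m + r)" using m that by (intro sub) auto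
      with Suc show ?case by (simp add: algebra_simps)
    qed simp
    have up: "a n / real n \<le> b m + (real m * \<bar>b m\<bar> + D) / real n" if n: "1 \<le> n" for n
    proof -
      \<comment> \<open>Division of \<open>n - 1\<close> instead of \<open>n\<close> keeps the
        remaining block \<open>r\<close> in \<open>{1..m}\<close>, since the hypothesis
        \<open>sub\<close> concerns nonempty blocks.\<close>
      define q where "q = (n - 1) div m"
      define r where "r = (n - 1) mod m + 1"
      have nqr: "n = q * m + r" using n unfolding q_def r_def by (metis Suc_eq_plus1 add_Suc_right div_mult_mod_eq le_add_diff_inverse2)
      have r: "1 \<le> r" "r \<le> m" using m by (auto simp: r_def Suc_leI)
      have "a r \<le> D"
      proof -
        have "\<bar>a r\<bar> \<le> D" unfolding D_def using r by (intro member_le_sum[where f="\<lambda>r. \<bar>a r\<bar>"]) auto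
        then show ?thesis by simp
      qed
      moreover have "a m + \<phi> m = real m * b m" using m by (simp add: b_def)
      moreover have "real q * (real m * b m) \<le> real n * b m + real m * \<bar>b m\<bar>"
      proof -
        have "real q * (real m * b m) = real n * b m - real r * b m" by (simp add: nqr algebra_simps)
        moreover have "- (real r * b m) \<le> real r * \<bar>b m\<bar>"
          using mult_left_mono[of "- b m" "\<bar>b m\<bar>" "real r"] by auto
        moreover have "real r * \<bar>b m\<bar> \<le> real m * \<bar>b m\<bar>" using r by (intro mult_right_mono) auto
        ultimately show ?thesis by linarith
      qed
      ultimately have "a n \<le> real n * b m + real m * \<bar>b m\<bar> + D"
        using blocks[OF r(1), of q] unfolding nqr[symmetric] by simp
      then show ?thesis using n by (simp add: field_simps)
    qed
    have "(\<lambda>n. (real m * \<bar>b m\<bar> + D) / real n) \<longlonglongrightarrow> 0" by (rule lim_const_over_n)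
    from LIMSEQ_D[OF this, of "e / 2"] e obtain N1 where
      N1: "\<And>n. n \<ge> N1 \<Longrightarrow> \<bar>(real m * \<bar>b m\<bar> + D) / real n\<bar> < e / 2" by auto
    from LIMSEQ_D[OF \<phi> e] obtain N2 where N2: "\<And>n. n \<ge> N2 \<Longrightarrow> \<bar>\<phi> n / real n\<bar> < e" by auto
    show "\<exists>no. \<forall>n\<ge>no. norm (a n / real n - L) < e"
    proof (intro exI[of _ "max 1 (max N1 N2)"] allI impI)
      fix n assume "max 1 (max N1 N2) \<le> n"
      then have n: "1 \<le> n" "N1 \<le> n" "N2 \<le> n" by auto
      have "a n / real n < L + e" using up[OF n(1)] m(2) N1[OF n(2)] by linarith
      moreover have "L - e < a n / real n"
        using L_le[OF n(1)] N2[OF n(3)] unfolding b_def add_divide_distrib by linarith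
      ultimately show "norm (a n / real n - L) < e" by (simp add: abs_less_iff)
    qed
  qed
  then show ?thesis by (rule convergentI)
qed

text \<open>The ratio of \<open>l\<close> at consecutive powers of two tends to 1, so the increments
  of \<open>k \<mapsto> ln (p (2 ^ k))\<close> are bounded. The logarithm grows at most linearly in
  \<open>k\<close>, which is negligible against \<open>2 ^ k\<close>.\<close>

lemma slowly_varying_ln_dyadic:
  fixes p :: "nat \<Rightarrow> real"
  assumes l: "slowly_varying l" and p: "\<And>t. 1 \<le> t \<Longrightarrow> p t = l (real t) / real t powr (\<alpha> + 1)"
    and pos: "\<And>t. 1 \<le> t \<Longrightarrow> 0 < p t"
  shows "(\<lambda>k. ln (p (2 ^ k)) / real (2 ^ k)) \<longlonglongrightarrow> 0"
proof -
  define q where "q k = ln (p (2 ^ k))" for k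
  have lpos: "0 < l (real t)" if "1 \<le> t" for t
    using pos[OF that] that by (simp add: p[OF that] zero_less_divide_iff)
  have "((\<lambda>x. l (2 * x) / l x) \<longlongrightarrow> 1) at_top"
    using l by (simp add: slowly_varying_def)
  moreover have "filterlim (\<lambda>k::nat. (2::real) ^ k) at_top sequentially"
    by (rule filterlim_at_top_mono[OF filterlim_real_sequentially])
       (simp add: less_imp_le of_nat_less_two_power)
  ultimately have "(\<lambda>k. l (2 * 2 ^ k) / l (2 ^ k)) \<longlonglongrightarrow> 1"
    by (rule filterlim_compose)
  then have "(\<lambda>k. ln (l (2 * 2 ^ k) / l (2 ^ k)) - (\<alpha> + 1) * ln 2) \<longlonglongrightarrow> ln 1 - (\<alpha> + 1) * ln 2"
    by (intro tendsto_intros) auto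
  also have "(\<lambda>k. ln (l (2 * 2 ^ k) / l (2 ^ k)) - (\<alpha> + 1) * ln 2) = (\<lambda>k. q (Suc k) - q k)"
  proof
    fix k
    have pk: "ln (p (2 ^ j)) = ln (l (2 ^ j)) - (\<alpha> + 1) * (real j * ln 2)" for j
      using lpos[of "2 ^ j"] by (simp add: p ln_div ln_powr ln_realpow)
    show "ln (l (2 * 2 ^ k) / l (2 ^ k)) - (\<alpha> + 1) * ln 2 = q (Suc k) - q k"
      unfolding q_def pk using lpos[of "2 ^ k"] lpos[of "2 ^ Suc k"]
      by (simp add: ln_div algebra_simps)
  qed
  finally have "Bseq (\<lambda>k. q (Suc k) - q k)"
    by (intro convergent_imp_Bseq convergentI)
  then obtain D where D: "0 < D" "\<And>k. \<bar>q (Suc k) - q k\<bar> \<le> D" by (auto simp: Bseq_def)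
  have qb: "\<bar>q k\<bar> \<le> \<bar>q 0\<bar> + real k * D" for k
  proof (induction k)
    case (Suc k)
    with D(2)[of k] show ?case by (simp add: algebra_simps)
  qed simp
  have half: "(\<lambda>k. (1 / 2 :: real) ^ k) \<longlonglongrightarrow> 0" by (rule LIMSEQ_realpow_zero) auto
  have khalf: "(\<lambda>k. real k * (1 / 2 :: real) ^ k) \<longlonglongrightarrow> 0" by (rule powser_times_n_limit_0) simp
  have "(\<lambda>k. \<bar>q 0\<bar> * (1 / 2) ^ k + D * (real k * (1 / 2) ^ k)) \<longlonglongrightarrow> \<bar>q 0\<bar> * 0 + D * 0"
    by (intro tendsto_intros half khalf)
  then have lim: "(\<lambda>k. \<bar>q 0\<bar> * (1 / 2) ^ k + D * (real k * (1 / 2) ^ k)) \<longlonglongrightarrow> 0" by simp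
  show ?thesis
  proof (rule Lim_null_comparison[OF _ lim], rule always_eventually, rule allI)
    fix k
    have "norm (ln (p (2 ^ k)) / real (2 ^ k)) = \<bar>q k\<bar> * (1 / 2) ^ k"
      by (simp add: q_def power_divide)
    also have "\<dots> \<le> (\<bar>q 0\<bar> + real k * D) * (1 / 2) ^ k"
      using qb by (intro mult_right_mono) auto
    finally show "norm (ln (p (2 ^ k)) / real (2 ^ k)) \<le> \<bar>q 0\<bar> * (1 / 2) ^ k + D * (real k * (1 / 2) ^ k)"
      by (simp add: algebra_simps)
  qed
qed

section \<open>Summation bounds for the covariances\<close>

context
  fixes P :: "(nat \<Rightarrow> real) measure"
  assumes summable_cov: "summable (\<lambda>a. \<bar>covariance_fun P a\<bar>)"
begin

lemma gamma_bar_nonneg: "0 \<le> gamma_bar P"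
  unfolding gamma_bar_def by (intro suminf_nonneg summable_cov) auto

lemma sum_covariance_le:
  assumes "finite B" "inj_on g B"
  shows "(\<Sum>b\<in>B. \<bar>covariance_fun P (g b)\<bar>) \<le> gamma_bar P"
proof -
  have "(\<Sum>b\<in>B. \<bar>covariance_fun P (g b)\<bar>) = (\<Sum>j\<in>g ` B. \<bar>covariance_fun P j\<bar>)"
    by (simp add: sum.reindex[OF assms(2)])
  also have "\<dots> \<le> gamma_bar P"
    unfolding gamma_bar_def by (intro sum_le_suminf summable_cov) (use assms in auto)
  finally show ?thesis .
qed

text \<open>Every distance from \<open>a\<close> is attained at most once on either side, hence the
  factor 2.\<close>

lemma sum_cov_kernel_row_le:
  assumes "finite B"
  shows "(\<Sum>b\<in>B. \<bar>cov_kernel P a b\<bar>) \<le> 2 * gamma_bar P"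
proof -
  have "(\<Sum>b\<in>B. \<bar>cov_kernel P a b\<bar>) = (\<Sum>b\<in>B \<inter> {..a} \<union> B \<inter> {a<..}. \<bar>cov_kernel P a b\<bar>)"
    by (rule sum.cong) auto
  also have "\<dots> = (\<Sum>b\<in>B \<inter> {..a}. \<bar>cov_kernel P a b\<bar>) + (\<Sum>b\<in>B \<inter> {a<..}. \<bar>cov_kernel P a b\<bar>)"
    using assms by (intro sum.union_disjoint) auto
  also have "\<dots> = (\<Sum>b\<in>B \<inter> {..a}. \<bar>covariance_fun P (a - b)\<bar>) + (\<Sum>b\<in>B \<inter> {a<..}. \<bar>covariance_fun P (b - a)\<bar>)"
    by (intro arg_cong2[where f="(+)"] sum.cong) (auto simp: cov_kernel_def)
  also have "\<dots> \<le> gamma_bar P + gamma_bar P"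
    using assms by (intro add_mono sum_covariance_le) (auto simp: inj_on_def)
  finally show ?thesis by simp
qed

lemma sum_cov_kernel_square_le:
  "(\<Sum>a\<in>{i..n}. \<Sum>b\<in>{i..n}. \<bar>cov_kernel P a b\<bar>) \<le> real (card {i..n}) * (2 * gamma_bar P)"
proof -
  have "(\<Sum>a\<in>{i..n}. \<Sum>b\<in>{i..n}. \<bar>cov_kernel P a b\<bar>) \<le> (\<Sum>a\<in>{i..n}. 2 * gamma_bar P)"
    by (intro sum_mono sum_cov_kernel_row_le) simp
  then show ?thesis by simp
qed

definition cov_tail :: "nat \<Rightarrow> real" where "cov_tail i = (\<Sum>k. \<bar>covariance_fun P (k + i)\<bar>)"

lemma cov_tail_nonneg: "0 \<le> cov_tail i"
  unfolding cov_tail_def using summable_ignore_initial_segment[OF summable_cov, of i]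
  by (intro suminf_nonneg) auto

lemma cov_tail_tendsto: "cov_tail \<longlonglongrightarrow> 0"
proof (rule LIMSEQ_I)
  fix e :: real assume "0 < e"
  from suminf_exist_split[OF this summable_cov]
  show "\<exists>no. \<forall>n\<ge>no. norm (cov_tail n - 0) < e" by (simp add: cov_tail_def)
qed

text \<open>The site \<open>a\<close> is at distance at least \<open>m + 1 - a\<close> from the
  second block, so its row is below a tail of the covariance series. The bound is independent of the
  length \<open>n\<close> of the second block, as an error attached to the first block has to
  be.\<close>

lemma sum_cov_kernel_cross_le:
  "(\<Sum>a\<in>{0 + 1..0 + m}. \<Sum>b\<in>{m + 1..m + n}. \<bar>cov_kernel P a b\<bar>) \<le> (\<Sum>i=1..m. cov_tail i)"
proof -
  have "(\<Sum>b\<in>{m + 1..m + n}. \<bar>cov_kernel P a b\<bar>) \<le> cov_tail (m + 1 - a)" if a: "a \<in> {1..m}" for a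
  proof -
    have "(\<Sum>b\<in>{m + 1..m + n}. \<bar>cov_kernel P a b\<bar>)
        = (\<Sum>b\<in>{m + 1..m + n}. \<bar>covariance_fun P ((b - (m + 1)) + (m + 1 - a))\<bar>)"
      using a by (intro sum.cong refl arg_cong[where f="\<lambda>x. \<bar>covariance_fun P x\<bar>"]) (auto simp: cov_kernel_def)
    also have "\<dots> = (\<Sum>j\<in>(\<lambda>b. b - (m + 1)) ` {m + 1..m + n}. \<bar>covariance_fun P (j + (m + 1 - a))\<bar>)"
      by (subst sum.reindex) (auto simp: inj_on_def)
    also have "\<dots> \<le> cov_tail (m + 1 - a)"
      unfolding cov_tail_def
      by (intro sum_le_suminf summable_ignore_initial_segment[OF summable_cov]) auto
    finally show ?thesis .
  qed
  then have "(\<Sum>a\<in>{1..m}. \<Sum>b\<in>{m + 1..m + n}. \<bar>cov_kernel P a b\<bar>) \<le> (\<Sum>a\<in>{1..m}. cov_tail (m + 1 - a))"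
    by (rule sum_mono)
  also have "\<dots> = (\<Sum>i\<in>{1..m}. cov_tail i)"
    by (rule sum.reindex_bij_witness[of _ "\<lambda>i. m + 1 - i" "\<lambda>i. m + 1 - i"]) auto
  finally show ?thesis by simp
qed

end

section \<open>The renewal pinning model\<close>

context
  fixes M :: "'b measure" and T :: "nat \<Rightarrow> 'b \<Rightarrow> nat" and \<alpha> :: real and l :: "real \<Rightarrow> real"
    and P :: "(nat \<Rightarrow> real) measure"
  assumes renewal: "renewal_process M T \<alpha> l"
    and disorder: "centered_stationary_gaussian P"
    and summable_cov: "summable (\<lambda>a. \<bar>covariance_fun P a\<bar>)"
begin

definition Zf :: "real \<Rightarrow> nat \<Rightarrow> (nat \<Rightarrow> real) \<Rightarrow> real" where
  "Zf h n \<omega> = renewal_sum (jump_prob M T) (\<lambda>a. h + \<omega> a) n"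

text \<open>The index is shifted: \<open>Zm h n\<close> is the function \<open>Z\<^sup>-\<close> of a system of size \<open>n + 1\<close>, which
  depends on the first \<open>n\<close> disorder variables only.\<close>

definition Zm :: "real \<Rightarrow> nat \<Rightarrow> (nat \<Rightarrow> real) \<Rightarrow> real" where
  "Zm h n \<omega> = renewal_sum_minus (jump_prob M T) (\<lambda>a. h + \<omega> a) n"

definition mean_log :: "real \<Rightarrow> nat \<Rightarrow> real" where
  "mean_log h n = (\<integral>\<omega>. ln (Zf h n \<omega>) \<partial>P)"

definition mean_inv :: "real \<Rightarrow> nat \<Rightarrow> real" where
  "mean_inv h n = (\<integral>\<omega>. 1 / Zm h n \<omega> \<partial>P)"

text \<open>Undoes the index shift of \<open>Zm\<close>: here \<open>n\<close> is the size of the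
  system again.\<close>

definition log_inv :: "real \<Rightarrow> nat \<Rightarrow> real" where
  "log_inv h n = ln (mean_inv h (n - 1))"

lemma p_pos: "0 < jump_prob M T (Suc k)"
  by (rule jump_prob_pos[OF renewal])

lemma law: "gaussian_law P (cov_kernel P)"
  by (rule gaussian_law_stationary[OF disorder])

interpretation prob_space P by (rule gaussian_lawD[OF law])

lemma sets_P [measurable_cong]: "sets P = sets borel"
  by (rule gaussian_lawD[OF law])

lemma Zf_exp_sum: "is_exp_sum {1..n} (Zf h n)"
  using is_exp_sum_renewal_sum[where p="jump_prob M T", OF p_pos, of 0 n h] by (simp add: Zf_def[abs_def])

lemma Zm_exp_sum: "is_exp_sum {1..n} (Zm h n)"
  using is_exp_sum_renewal_sum_minus[where p="jump_prob M T", OF p_pos, of 0 n h] by (simp add: Zm_def[abs_def])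

lemmas Zf_pos = is_exp_sum_pos[OF Zf_exp_sum] and Zm_pos = is_exp_sum_pos[OF Zm_exp_sum]
  and Zf_measurable = is_exp_sum_measurable[OF Zf_exp_sum]
  and Zm_measurable = is_exp_sum_measurable[OF Zm_exp_sum]
  and Zf_integrable = is_exp_sum_integrable[OF Zf_exp_sum law]
  and Zm_integrable = is_exp_sum_integrable[OF Zm_exp_sum law]

lemma Zf_Suc: "Zf h (Suc n) \<omega> = exp (h + \<omega> (Suc n)) * Zm h n \<omega>"
  by (simp add: Zf_def Zm_def renewal_sum_Suc)

lemma coordinate_mean: "integrable P (\<lambda>\<omega>. \<omega> a)" "(\<integral>\<omega>. \<omega> a \<partial>P) = 0"
  using gaussian_law_lin_mean[OF law, of "{a}" "\<lambda>_. 1"] by simp_all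

text \<open>The disorder at the endpoint is centered, so omitting the endpoint energy costs exactly
  \<open>h\<close> on average.\<close>

lemma mean_log_Suc: "mean_log h (Suc n) = h + (\<integral>\<omega>. ln (Zm h n \<omega>) \<partial>P)"
proof -
  have "ln (Zf h (Suc n) \<omega>) = h + \<omega> (Suc n) + ln (Zm h n \<omega>)" for \<omega>
    using Zm_pos[of h n \<omega>] by (simp add: Zf_Suc ln_mult)
  then show ?thesis
    using coordinate_mean Zm_integrable(1) by (simp add: mean_log_def prob_space)
qed

section \<open>Existence and nonnegativity of the free energy\<close>

lemma mean_log_superadditive: "mean_log h m + mean_log h n \<le> mean_log h (m + n)"
proof -
  have shift: "(\<integral>\<omega>. ln (Zf h n (\<lambda>a. \<omega> (a + m))) \<partial>P) = mean_log h n"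
    unfolding mean_log_def
    by (rule stationary_integral_shift[OF disorder, of "\<lambda>\<omega>. ln (Zf h n \<omega>)"])
       (intro borel_measurable_ln Zf_measurable)
  have i: "integrable P (\<lambda>\<omega>. ln (Zf h n (\<lambda>a. \<omega> (a + m))))"
    using is_exp_sum_integrable(1)[OF is_exp_sum_renewal_sum[where p="jump_prob M T", OF p_pos, of m n h] law]
    by (simp add: Zf_def)
  have "mean_log h m + mean_log h n = (\<integral>\<omega>. ln (Zf h m \<omega>) + ln (Zf h n (\<lambda>a. \<omega> (a + m))) \<partial>P)"
    using i Zf_integrable(1) by (simp add: shift mean_log_def)
  also have "\<dots> \<le> mean_log h (m + n)"
    unfolding mean_log_def
  proof (intro integral_mono Bochner_Integration.integrable_add i Zf_integrable)
    fix \<omega>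
    have "ln (Zf h m \<omega>) + ln (Zf h n (\<lambda>a. \<omega> (a + m))) = ln (Zf h m \<omega> * Zf h n (\<lambda>a. \<omega> (a + m)))"
      using Zf_pos[of h m \<omega>] Zf_pos[of h n "\<lambda>a. \<omega> (a + m)"] by (simp add: ln_mult)
    also have "\<dots> \<le> ln (Zf h (m + n) \<omega>)"
      using renewal_sum_supermult[where p="jump_prob M T", OF p_pos, of "\<lambda>a. h + \<omega> a" m n] Zf_pos
      by (intro ln_mono) (simp_all add: Zf_def)
    finally show "ln (Zf h m \<omega>) + ln (Zf h n (\<lambda>a. \<omega> (a + m))) \<le> ln (Zf h (m + n) \<omega>)" .
  qed
  finally show ?thesis .
qed

definition abs_mean :: real where "abs_mean = (\<integral>\<omega>. \<bar>\<omega> 0\<bar> \<partial>P)"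

lemma mean_log_le: "mean_log h n \<le> real n * (\<bar>h\<bar> + abs_mean)"
proof -
  have abs: "(\<integral>\<omega>. \<bar>\<omega> a\<bar> \<partial>P) = abs_mean" for a
    unfolding abs_mean_def
    using stationary_integral_shift[OF disorder, of "\<lambda>\<omega>. \<bar>\<omega> 0\<bar>" a] by simp
  have "mean_log h n \<le> (\<integral>\<omega>. (\<Sum>a=1..n. \<bar>h\<bar> + \<bar>\<omega> a\<bar>) \<partial>P)"
    unfolding mean_log_def
  proof (intro integral_mono Zf_integrable)
    show "integrable P (\<lambda>\<omega>. \<Sum>a=1..n. \<bar>h\<bar> + \<bar>\<omega> a\<bar>)" using coordinate_mean(1) by auto
    fix \<omega>
    have "Zf h n \<omega> \<le> exp (\<Sum>a=1..n. \<bar>h + \<omega> a\<bar>)"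
      unfolding Zf_def by (rule renewal_sum_le[where p="jump_prob M T", OF p_pos jump_prob_mass[OF renewal]])
    also have "\<dots> \<le> exp (\<Sum>a=1..n. \<bar>h\<bar> + \<bar>\<omega> a\<bar>)" by (auto intro!: sum_mono)
    finally have "ln (Zf h n \<omega>) \<le> ln (exp (\<Sum>a=1..n. \<bar>h\<bar> + \<bar>\<omega> a\<bar>))"
      using Zf_pos by (intro ln_mono)
    then show "ln (Zf h n \<omega>) \<le> (\<Sum>a=1..n. \<bar>h\<bar> + \<bar>\<omega> a\<bar>)" by simp
  qed
  also have "\<dots> = (\<Sum>a=1..n. \<bar>h\<bar> + abs_mean)"
    using coordinate_mean(1) by (simp add: integral_sum abs prob_space)
  finally show ?thesis by simp
qed

text \<open>The free energy is defined by \<open>lim\<close>, so it becomes usable only after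
  convergence is established: supermultiplicativity and stationarity give exact superadditivity, the
  case of vanishing error in the subadditive lemma.\<close>

lemma free_energy_tendsto: "(\<lambda>n. mean_log h n / real n) \<longlonglongrightarrow> free_energy M T P h"
proof -
  have "convergent (\<lambda>n. - mean_log h n / real n)"
  proof (rule almost_subadditive_convergent[where \<phi>="\<lambda>_. 0"])
    show "- mean_log h (m + n) \<le> - mean_log h m + 0 + - mean_log h n" for m n
      using mean_log_superadditive[of h m n] by simp
    show "- (\<bar>h\<bar> + abs_mean) * real n \<le> - mean_log h n" for n
      using mean_log_le[of h n] by (simp add: algebra_simps)
  qed simp_all
  then have "convergent (\<lambda>n. mean_log h n / real n)"
    using convergent_minus_iff[of "\<lambda>n. mean_log h n / real n"] by simp
  moreover have "(\<lambda>n. mean_log h n / real n) = (\<lambda>n. \<integral>\<omega>. 1 / real n * ln (partition_fun M T n h \<omega>) \<partial>P)"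
    by (simp add: mean_log_def Zf_def partition_fun_eq[OF renewal])
  ultimately show ?thesis
    unfolding free_energy_def by (simp add: convergent_LIMSEQ_iff)
qed

lemma dyadic_jump_prob: "(\<lambda>k. ln (jump_prob M T (2 ^ k)) / real (2 ^ k)) \<longlonglongrightarrow> 0"
proof (rule slowly_varying_ln_dyadic)
  show "slowly_varying l" using renewal unfolding renewal_process_def by blast
  show "jump_prob M T t = l (real t) / real t powr (\<alpha> + 1)" "0 < jump_prob M T t" if "1 \<le> t" for t
    using renewal that unfolding renewal_process_def jump_prob_def[OF renewal] by blast+
qed

lemma p_le_Zm: "jump_prob M T (Suc n) \<le> Zm h n \<omega>"
  unfolding Zm_def by (rule renewal_sum_minus_ge[where p="jump_prob M T", OF p_pos])

lemma dyadic_tendsto: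
  assumes "f \<longlonglongrightarrow> c"
  shows "(\<lambda>k. f (2 ^ k)) \<longlonglongrightarrow> (c :: real)"
proof -
  have "strict_mono (\<lambda>k::nat. (2::nat) ^ k)" by (rule strict_monoI) simp
  from LIMSEQ_subseq_LIMSEQ[OF assms this] show ?thesis by (simp add: comp_def)
qed

text \<open>The path with a single jump contributes \<open>h + ln (jump_prob M T n)\<close> on
  average, which is negligible against \<open>n\<close> along powers of two.\<close>

lemma free_energy_nonneg: "0 \<le> free_energy M T P h"
proof (rule LIMSEQ_le)
  show "(\<lambda>k. h / real (2 ^ k) + ln (jump_prob M T (2 ^ k)) / real (2 ^ k)) \<longlonglongrightarrow> 0"
    using tendsto_add[OF dyadic_tendsto[OF lim_const_over_n[of h]] dyadic_jump_prob] by simp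
  show "(\<lambda>k. mean_log h (2 ^ k) / real (2 ^ k)) \<longlonglongrightarrow> free_energy M T P h"
    by (rule dyadic_tendsto[OF free_energy_tendsto])
  have "h + ln (jump_prob M T n) \<le> mean_log h n" if "1 \<le> n" for n
  proof -
    obtain k where k: "n = Suc k" using \<open>1 \<le> n\<close> by (cases n) auto
    have "ln (jump_prob M T (Suc k)) \<le> (\<integral>\<omega>. ln (Zm h k \<omega>) \<partial>P)"
      using p_le_Zm p_pos[of k] by (intro integral_ge_const Zm_integrable AE_I2 ln_mono) auto
    then show ?thesis by (simp add: k mean_log_Suc)
  qed
  then show "\<exists>N. \<forall>k\<ge>N. h / real (2 ^ k) + ln (jump_prob M T (2 ^ k)) / real (2 ^ k) \<le> mean_log h (2 ^ k) / real (2 ^ k)"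
    unfolding add_divide_distrib[symmetric] by (intro exI[of _ 0] allI impI divide_right_mono) auto
qed

section \<open>Existence of \<mu> and its upper bound\<close>

lemma mean_inv_pos: "0 < mean_inv h n"
  unfolding mean_inv_def by (rule is_exp_sum_jensen(2)[OF Zm_exp_sum law])

lemma log_inv_ge: "1 \<le> n \<Longrightarrow> h - mean_log h n \<le> log_inv h n"
  using is_exp_sum_jensen(1)[OF Zm_exp_sum law, of h "n - 1"] mean_log_Suc[of h "n - 1"]
  by (simp add: log_inv_def mean_inv_def)

text \<open>Splitting a system leaves \<open>Zf\<close>, not \<open>Zm\<close>, on the first block.
  The endpoint is separated off as a block of one site; its row of covariances is at most
  \<open>2 * gamma_bar P\<close>, and 6 times this is the 12.\<close>

lemma integral_inverse_Zf_le:
  "(\<integral>\<omega>. 1 / Zf h (Suc n) \<omega> \<partial>P)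
    \<le> exp (12 * gamma_bar P - h) * (\<integral>\<omega>. exp (- \<omega> 0) \<partial>P) * mean_inv h n"
proof -
  have F: "is_exp_sum {Suc n} (\<lambda>\<omega>. exp (\<omega> (Suc n)) * 1)"
    using is_exp_sum_mult_exp[OF is_exp_sum_const[of 1 "{}"], of "Suc n"] by simp
  have shift: "(\<integral>\<omega>. 1 / (exp (\<omega> (Suc n)) * 1) \<partial>P) = (\<integral>\<omega>. exp (- \<omega> 0) \<partial>P)"
    using stationary_integral_shift[OF disorder, of "\<lambda>\<omega>. exp (- \<omega> 0)" "Suc n"]
    by (simp add: exp_minus inverse_eq_divide)
  have "(\<integral>\<omega>. 1 / Zf h (Suc n) \<omega> \<partial>P)
      = exp (- h) * (\<integral>\<omega>. 1 / ((exp (\<omega> (Suc n)) * 1) * Zm h n \<omega>) \<partial>P)"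
    by (simp add: Zf_Suc exp_add exp_minus field_simps flip: integral_mult_right_zero)
  also have "\<dots> \<le> exp (- h) * (exp (6 * (\<Sum>a\<in>{Suc n}. \<Sum>b\<in>{1..n}. \<bar>cov_kernel P a b\<bar>))
      * ((\<integral>\<omega>. exp (- \<omega> 0) \<partial>P) * mean_inv h n))"
    unfolding shift[symmetric] mean_inv_def
    by (intro mult_left_mono is_exp_sum_decoupling(1)[OF F Zm_exp_sum _ law cov_kernel_sym]) auto
  also have "\<dots> \<le> exp (- h) * (exp (12 * gamma_bar P) * ((\<integral>\<omega>. exp (- \<omega> 0) \<partial>P) * mean_inv h n))"
  proof (intro mult_left_mono mult_right_mono)
    show "exp (6 * (\<Sum>a\<in>{Suc n}. \<Sum>b\<in>{1..n}. \<bar>cov_kernel P a b\<bar>)) \<le> exp (12 * gamma_bar P)"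
      using sum_cov_kernel_row_le[OF summable_cov, of "{1..n}" "Suc n"] by simp
    show "0 \<le> (\<integral>\<omega>. exp (- \<omega> 0) \<partial>P) * mean_inv h n"
      by (intro mult_nonneg_nonneg less_imp_le[OF mean_inv_pos] Bochner_Integration.integral_nonneg) simp
  qed auto
  also have "\<dots> = exp (12 * gamma_bar P - h) * (\<integral>\<omega>. exp (- \<omega> 0) \<partial>P) * mean_inv h n"
    by (simp add: exp_diff exp_minus field_simps)
  finally show ?thesis .
qed

text \<open>Keeps the logarithm of this mean nonnegative, as an error term of the subadditive lemma
  must be.\<close>

lemma exp_coordinate_mean_ge_1: "1 \<le> (\<integral>\<omega>. exp (- \<omega> 0) \<partial>P)"
proof -
  have i: "integrable P (\<lambda>\<omega>. exp (- \<omega> 0))"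
    using gaussian_law_mgf(1)[OF law, of "{0}" "\<lambda>_. - 1"] by simp
  have "(\<integral>\<omega>. 1 + - \<omega> 0 \<partial>P) \<le> (\<integral>\<omega>. exp (- \<omega> 0) \<partial>P)"
    using i coordinate_mean(1) by (intro integral_mono exp_ge_add_one_self) auto
  then show ?thesis using coordinate_mean by (simp add: prob_space)
qed

text \<open>Paths through \<open>m\<close> bound \<open>Zm\<close> from below by a product of
  functions on \<open>{1..m}\<close> and on the sites after \<open>m\<close>. Decoupling splits the
  inverse moment, stationarity moves the second block to the origin, and
  \<open>integral_inverse_Zf_le\<close> returns from \<open>Zf\<close> to \<open>Zm\<close> on the
  first block.\<close>

lemma log_inv_almost_subadditive:
  assumes "1 \<le> m" "1 \<le> n"
  shows "log_inv h (m + n) \<le> log_inv h m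
    + (6 * (\<Sum>i=1..m. cov_tail P i) + (12 * gamma_bar P + \<bar>h\<bar> + ln (\<integral>\<omega>. exp (- \<omega> 0) \<partial>P))) + log_inv h n"
proof -
  obtain m' n' where mn: "m = Suc m'" "n = Suc n'" using assms by (metis Suc_le_D One_nat_def)
  define e0 where "e0 = (\<integral>\<omega>. exp (- \<omega> 0) \<partial>P)"
  have e0: "1 \<le> e0" unfolding e0_def by (rule exp_coordinate_mean_ge_1)
  let ?V = "\<lambda>\<omega>. Zm h n' (\<lambda>a. \<omega> (a + m))"
  have V: "is_exp_sum {m + 1..m + n'} ?V"
    using is_exp_sum_renewal_sum_minus[where p="jump_prob M T", OF p_pos, of m n' h] by (simp add: Zm_def)
  have EV: "(\<integral>\<omega>. 1 / ?V \<omega> \<partial>P) = mean_inv h n'"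
    unfolding mean_inv_def by (rule stationary_integral_shift[OF disorder, of "\<lambda>\<omega>. 1 / Zm h n' \<omega>"])
       (intro borel_measurable_divide borel_measurable_const Zm_measurable)
  have U: "is_exp_sum {0 + 1..0 + m} (Zf h m)" using Zf_exp_sum[of m h] by simp
  define k where "k = (\<Sum>a\<in>{0 + 1..0 + m}. \<Sum>b\<in>{m + 1..m + n'}. \<bar>cov_kernel P a b\<bar>)"
  have k: "k \<le> (\<Sum>i=1..m. cov_tail P i)"
    unfolding k_def by (rule sum_cov_kernel_cross_le[OF summable_cov])
  have "mean_inv h (m + n') \<le> (\<integral>\<omega>. 1 / (Zf h m \<omega> * ?V \<omega>) \<partial>P)"
    unfolding mean_inv_def
  proof (intro integral_mono Zm_integrable)
    show "1 / Zm h (m + n') \<omega> \<le> 1 / (Zf h m \<omega> * ?V \<omega>)" for \<omega>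
      using renewal_sum_minus_supermult[where p="jump_prob M T", OF p_pos, of "\<lambda>a. h + \<omega> a" m n'] Zf_pos Zm_pos
      by (intro divide_left_mono) (auto simp: Zf_def Zm_def)
    show "integrable P (\<lambda>\<omega>. 1 / (Zf h m \<omega> * ?V \<omega>))"
      by (rule is_exp_sum_decoupling(2)[OF U V _ law cov_kernel_sym]) auto
  qed
  also have "\<dots> \<le> exp (6 * k) * ((\<integral>\<omega>. 1 / Zf h m \<omega> \<partial>P) * (\<integral>\<omega>. 1 / ?V \<omega> \<partial>P))"
    unfolding k_def by (rule is_exp_sum_decoupling(1)[OF U V _ law cov_kernel_sym]) auto
  also have "\<dots> \<le> exp (6 * k) * ((exp (12 * gamma_bar P - h) * e0 * mean_inv h m') * mean_inv h n')"
    unfolding EV unfolding e0_def mn(1)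
    using mean_inv_pos by (intro mult_left_mono mult_right_mono integral_inverse_Zf_le) (auto simp: less_imp_le)
  finally have le: "mean_inv h (m + n')
      \<le> exp (6 * k) * ((exp (12 * gamma_bar P - h) * e0 * mean_inv h m') * mean_inv h n')" .
  have "log_inv h (m + n) \<le> ln (exp (6 * k) * ((exp (12 * gamma_bar P - h) * e0 * mean_inv h m') * mean_inv h n'))"
    using le mean_inv_pos[of h "m + n'"] by (simp only: log_inv_def) (intro ln_mono, auto simp: mn)
  also have "\<dots> = 6 * k + (12 * gamma_bar P - h + ln e0 + log_inv h m + log_inv h n)"
    using mean_inv_pos[of h m'] mean_inv_pos[of h n'] e0
    by (simp add: ln_mult log_inv_def mn)
  finally show ?thesis using k unfolding e0_def by (simp add: abs_if split: if_splits)
qed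

lemma mu_seq_eq: "mu_seq M T P h n = - (log_inv h n / real n)"
proof (cases n)
  case (Suc k)
  then show ?thesis
    by (simp add: mu_seq_def log_inv_def mean_inv_def partition_fun_minus_eq[OF renewal] Zm_def)
qed (simp add: mu_seq_def)

text \<open>Divided by \<open>m\<close>, the error is a Cesaro mean of covariance tails plus a
  vanishing constant term. The linear lower bound follows from Jensen's inequality and the bound on
  \<open>mean_log\<close>.\<close>

lemma log_inv_convergent: "convergent (\<lambda>n. log_inv h n / real n)"
proof (rule almost_subadditive_convergent[OF log_inv_almost_subadditive])
  let ?c = "12 * gamma_bar P + \<bar>h\<bar> + ln (\<integral>\<omega>. exp (- \<omega> 0) \<partial>P)"
  have "(\<lambda>m. 6 * ((\<Sum>i=1..m. cov_tail P i) / real m) + ?c / real m) \<longlonglongrightarrow> 6 * 0 + 0"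
    by (intro tendsto_intros cesaro_null cov_tail_tendsto[OF summable_cov] cov_tail_nonneg[OF summable_cov]
        lim_const_over_n)
  then show "(\<lambda>m. (6 * (\<Sum>i=1..m. cov_tail P i) + ?c) / real m) \<longlonglongrightarrow> 0"
    by (simp add: add_divide_distrib)
  show "0 \<le> 6 * (\<Sum>i=1..m. cov_tail P i) + ?c" for m
    using gamma_bar_nonneg[OF summable_cov] exp_coordinate_mean_ge_1 cov_tail_nonneg[OF summable_cov]
    by (intro add_nonneg_nonneg mult_nonneg_nonneg sum_nonneg) auto
  show "- (2 * \<bar>h\<bar> + abs_mean) * real n \<le> log_inv h n" if n: "1 \<le> n" for n
  proof -
    have "\<bar>h\<bar> \<le> \<bar>h\<bar> * real n" using n by (simp add: mult_le_cancel_left1)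
    moreover have "- \<bar>h\<bar> \<le> h" by simp
    ultimately show ?thesis using log_inv_ge[OF n, of h] mean_log_le[of h n] by (simp add: algebra_simps)
  qed
qed

lemma mu_seq_tendsto: "mu_seq M T P h \<longlonglongrightarrow> mu M T P h"
proof -
  have "convergent (\<lambda>n. - (log_inv h n / real n))"
    using log_inv_convergent[of h] convergent_minus_iff[of "\<lambda>n. log_inv h n / real n"] by simp
  then have "convergent (mu_seq M T P h)" by (simp add: mu_seq_eq[abs_def])
  then show ?thesis by (simp add: mu_def convergent_LIMSEQ_iff)
qed

lemma mu_le_free_energy: "mu M T P h \<le> free_energy M T P h"
proof (rule LIMSEQ_le[OF mu_seq_tendsto])
  show "(\<lambda>n. mean_log h n / real n - h / real n) \<longlonglongrightarrow> free_energy M T P h"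
    using tendsto_diff[OF free_energy_tendsto lim_const_over_n[of h]] by simp
  show "\<exists>N. \<forall>n\<ge>N. mu_seq M T P h n \<le> mean_log h n / real n - h / real n"
  proof (intro exI[of _ 1] allI impI)
    fix n :: nat assume n: "1 \<le> n"
    have "- log_inv h n / real n \<le> (mean_log h n - h) / real n"
      using log_inv_ge[OF n, of h] by (intro divide_right_mono) auto
    then show "mu_seq M T P h n \<le> mean_log h n / real n - h / real n"
      by (simp add: mu_seq_eq diff_divide_distrib)
  qed
qed

section \<open>Lower bound for \<mu>\<close>

text \<open>The inverse is written as a product of the powers \<open>- (1 - r)\<close> and
  \<open>- r\<close> of \<open>Zm\<close>. The first factor is bounded by a deterministic quantity
  that is negligible on the exponential scale, the second by concentration; its term
  \<open>r ^ 2\<close> is the gain over the direct use of the power \<open>- 1\<close>.\<close>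

lemma log_inv_le:
  assumes n: "1 \<le> n" and r: "0 \<le> r" "r \<le> 1"
  shows "log_inv h n \<le> - (1 - r) * ln (jump_prob M T n) - r * (mean_log h n - h) + 2 * r\<^sup>2 * gamma_bar P * real n"
proof -
  obtain k where k: "n = Suc k" using n by (cases n) auto
  have "mean_inv h k \<le> (\<integral>\<omega>. jump_prob M T n powr (- (1 - r)) * Zm h k \<omega> powr (- r) \<partial>P)"
    unfolding mean_inv_def
  proof (intro integral_mono Zm_integrable integrable_mult_right)
    fix \<omega>
    have "1 / Zm h k \<omega> = Zm h k \<omega> powr (- (1 - r)) * Zm h k \<omega> powr (- r)"
      using Zm_pos[of h k \<omega>] unfolding powr_add[symmetric] by (simp add: powr_minus_divide less_imp_le)
    also have "\<dots> \<le> jump_prob M T n powr (- (1 - r)) * Zm h k \<omega> powr (- r)"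
      using p_pos[of k] p_le_Zm[of k h \<omega>] r
      by (intro mult_right_mono powr_mono2') (auto simp: k)
    finally show "1 / Zm h k \<omega> \<le> jump_prob M T n powr (- (1 - r)) * Zm h k \<omega> powr (- r)" .
  qed
  also have "\<dots> = jump_prob M T n powr (- (1 - r)) * (\<integral>\<omega>. Zm h k \<omega> powr (- r) \<partial>P)" by simp
  also have "\<dots> \<le> jump_prob M T n powr (- (1 - r)) * exp (- r * (\<integral>\<omega>. ln (Zm h k \<omega>) \<partial>P)
      + r\<^sup>2 * (\<Sum>a\<in>{1..k}. \<Sum>b\<in>{1..k}. \<bar>cov_kernel P a b\<bar>))"
    by (intro mult_left_mono is_exp_sum_concentration[OF Zm_exp_sum law r(1)]) auto
  also have "\<dots> = exp (- (1 - r) * ln (jump_prob M T n) - r * (mean_log h n - h)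
      + r\<^sup>2 * (\<Sum>a\<in>{1..k}. \<Sum>b\<in>{1..k}. \<bar>cov_kernel P a b\<bar>))"
    using p_pos[of k] by (simp add: k powr_def mean_log_Suc exp_add[symmetric])
  finally have "log_inv h n \<le> ln (exp (- (1 - r) * ln (jump_prob M T n) - r * (mean_log h n - h)
      + r\<^sup>2 * (\<Sum>a\<in>{1..k}. \<Sum>b\<in>{1..k}. \<bar>cov_kernel P a b\<bar>)))"
    using mean_inv_pos[of h k] unfolding log_inv_def k diff_Suc_1 by (intro ln_mono)
  also have "\<dots> = - (1 - r) * ln (jump_prob M T n) - r * (mean_log h n - h)
      + r\<^sup>2 * (\<Sum>a\<in>{1..k}. \<Sum>b\<in>{1..k}. \<bar>cov_kernel P a b\<bar>)" by simp
  also have "r\<^sup>2 * (\<Sum>a\<in>{1..k}. \<Sum>b\<in>{1..k}. \<bar>cov_kernel P a b\<bar>) \<le> r\<^sup>2 * (real n * (2 * gamma_bar P))"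
  proof (rule mult_left_mono)
    have "real (card {1..k}) * (2 * gamma_bar P) \<le> real n * (2 * gamma_bar P)"
      using gamma_bar_nonneg[OF summable_cov] by (intro mult_right_mono) (auto simp: k)
    then show "(\<Sum>a\<in>{1..k}. \<Sum>b\<in>{1..k}. \<bar>cov_kernel P a b\<bar>) \<le> real n * (2 * gamma_bar P)"
      using sum_cov_kernel_square_le[OF summable_cov, of 1 k] by linarith
  qed simp
  finally show ?thesis by (simp add: algebra_simps)
qed

lemma mu_ge_quadratic:
  assumes r: "0 \<le> r" "r \<le> 1"
  shows "r * free_energy M T P h - 2 * r\<^sup>2 * gamma_bar P \<le> mu M T P h"
proof (rule LIMSEQ_le)
  show "(\<lambda>k. mu_seq M T P h (2 ^ k)) \<longlonglongrightarrow> mu M T P h"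
    by (rule dyadic_tendsto[OF mu_seq_tendsto])
  have "(\<lambda>k. (1 - r) * (ln (jump_prob M T (2 ^ k)) / real (2 ^ k)) + r * (mean_log h (2 ^ k) / real (2 ^ k))
      - r * h / real (2 ^ k) - 2 * r\<^sup>2 * gamma_bar P)
    \<longlonglongrightarrow> (1 - r) * 0 + r * free_energy M T P h - 0 - 2 * r\<^sup>2 * gamma_bar P"
    by (intro tendsto_intros dyadic_jump_prob dyadic_tendsto[OF free_energy_tendsto]
        dyadic_tendsto[OF lim_const_over_n])
  then show "(\<lambda>k. (1 - r) * (ln (jump_prob M T (2 ^ k)) / real (2 ^ k)) + r * (mean_log h (2 ^ k) / real (2 ^ k))
      - r * h / real (2 ^ k) - 2 * r\<^sup>2 * gamma_bar P)
    \<longlonglongrightarrow> r * free_energy M T P h - 2 * r\<^sup>2 * gamma_bar P" by simp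
  have bound: "(1 - r) * (ln (jump_prob M T n) / real n) + r * (mean_log h n / real n) - r * h / real n - 2 * r\<^sup>2 * gamma_bar P
      \<le> mu_seq M T P h n" if n: "1 \<le> n" for n
  proof -
    have "((1 - r) * ln (jump_prob M T n) + r * (mean_log h n - h) - 2 * r\<^sup>2 * gamma_bar P * real n) / real n
        \<le> - log_inv h n / real n"
      using log_inv_le[OF n r, of h] by (intro divide_right_mono) (auto simp: algebra_simps)
    then show ?thesis using n
      by (simp add: mu_seq_eq diff_divide_distrib add_divide_distrib right_diff_distrib)
  qed
  show "\<exists>N. \<forall>k\<ge>N. (1 - r) * (ln (jump_prob M T (2 ^ k)) / real (2 ^ k)) + r * (mean_log h (2 ^ k) / real (2 ^ k))
      - r * h / real (2 ^ k) - 2 * r\<^sup>2 * gamma_bar P \<le> mu_seq M T P h (2 ^ k)"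
    by (intro exI[of _ 0] allI impI, rule bound) simp
qed

lemma mu_lower_bound:
  "min (ereal (free_energy M T P h / 3))
       (if gamma_bar P = 0 then \<infinity> else ereal ((free_energy M T P h)\<^sup>2 / (9 * gamma_bar P)))
    \<le> ereal (mu M T P h)"
proof -
  define f where "f = free_energy M T P h"
  define g where "g = gamma_bar P"
  have f: "0 \<le> f" unfolding f_def by (rule free_energy_nonneg)
  have g: "0 \<le> g" unfolding g_def by (rule gamma_bar_nonneg[OF summable_cov])
  have bound: "r * f - 2 * r\<^sup>2 * g \<le> mu M T P h" if "0 \<le> r" "r \<le> 1" for r
    using mu_ge_quadratic[OF that] by (simp add: f_def g_def)
  show ?thesis
  proof (cases "4 * g \<le> f")
    case True
    \<comment> \<open>With \<open>r = 1\<close> and \<open>g \<le> f / 4\<close> the bound is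
      \<open>f - 2 * g \<ge> f / 2\<close>. The degenerate case \<open>g = 0\<close> falls under
      this branch.\<close>
    have "f / 3 \<le> mu M T P h" using bound[of 1] True f by simp
    then show ?thesis by (simp add: f_def min_le_iff_disj)
  next
    case False
    then have g0: "0 < g" using f by linarith
    \<comment> \<open>The choice \<open>r = f / (4 * g)\<close> maximises
      \<open>r * f - 2 * r ^ 2 * g\<close>, with value \<open>f ^ 2 / (8 * g)\<close>; it is below 1
      in this branch.\<close>
    have "f\<^sup>2 / (9 * g) \<le> f\<^sup>2 / (8 * g)" using g0 by (intro divide_left_mono) auto
    also have "\<dots> = (f / (4 * g)) * f - 2 * (f / (4 * g))\<^sup>2 * g"
      using g0 by (simp add: power2_eq_square field_simps)
    also have "\<dots> \<le> mu M T P h" using f g0 False by (intro bound) (auto simp: field_simps)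
    finally show ?thesis using g0 by (simp add: f_def g_def min_le_iff_disj)
  qed
qed

section \<open>Lipschitz continuity of \<mu>\<close>

text \<open>Raising \<open>h\<close> by \<open>\<delta>\<close> multiplies \<open>Zm\<close>
  pointwise by a factor between 1 and \<open>exp (\<delta> * n)\<close>; after the division by
  \<open>n\<close> this is the Lipschitz constant 1.\<close>

lemma log_inv_shift:
  assumes \<delta>: "0 \<le> \<delta>" and n: "1 \<le> n"
  shows "log_inv (\<delta> + h) n \<le> log_inv h n" "log_inv h n - \<delta> * real n \<le> log_inv (\<delta> + h) n"
proof -
  obtain k where k: "n = Suc k" using n by (cases n) auto
  have up: "Zm (\<delta> + h) k \<omega> \<le> exp (\<delta> * real n) * Zm h k \<omega>" for \<omega>
  proof -
    have "Zm (\<delta> + h) k \<omega> \<le> exp (\<delta> * real k) * Zm h k \<omega>"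
      using renewal_sum_minus_shift_le[where p="jump_prob M T", OF p_pos \<delta>, of "\<lambda>a. h + \<omega> a" k] by (simp add: Zm_def add.assoc)
    also have "\<dots> \<le> exp (\<delta> * real n) * Zm h k \<omega>"
      using \<delta> Zm_pos[of h k \<omega>] by (intro mult_right_mono) (auto simp: k distrib_left)
    finally show ?thesis .
  qed
  have low: "Zm h k \<omega> \<le> Zm (\<delta> + h) k \<omega>" for \<omega>
    unfolding Zm_def using \<delta> by (intro renewal_sum_minus_mono[where p="jump_prob M T", OF p_pos]) simp
  have "mean_inv (\<delta> + h) k \<le> mean_inv h k"
    unfolding mean_inv_def using low Zm_pos by (intro integral_mono Zm_integrable divide_left_mono) auto
  then show "log_inv (\<delta> + h) n \<le> log_inv h n"
    using mean_inv_pos unfolding log_inv_def k diff_Suc_1 by (intro ln_mono)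
  have "mean_inv h k \<le> (\<integral>\<omega>. exp (\<delta> * real n) * (1 / Zm (\<delta> + h) k \<omega>) \<partial>P)"
    unfolding mean_inv_def
  proof (intro integral_mono Zm_integrable integrable_mult_right)
    fix \<omega>
    show "1 / Zm h k \<omega> \<le> exp (\<delta> * real n) * (1 / Zm (\<delta> + h) k \<omega>)"
      using up[of \<omega>] Zm_pos[of h k \<omega>] Zm_pos[of "\<delta> + h" k \<omega>] by (simp add: field_simps)
  qed
  also have "\<dots> = exp (\<delta> * real n) * mean_inv (\<delta> + h) k"
    unfolding mean_inv_def by (rule integral_mult_right_zero)
  finally have "log_inv h n \<le> ln (exp (\<delta> * real n) * mean_inv (\<delta> + h) k)"
    using mean_inv_pos unfolding log_inv_def k diff_Suc_1 by (intro ln_mono)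
  also have "\<dots> = \<delta> * real n + log_inv (\<delta> + h) n"
    using mean_inv_pos[of "\<delta> + h" k] by (simp add: ln_mult log_inv_def k)
  finally show "log_inv h n - \<delta> * real n \<le> log_inv (\<delta> + h) n" by simp
qed

lemma mu_shift:
  assumes "0 \<le> \<delta>"
  shows "\<bar>mu M T P (\<delta> + h) - mu M T P h\<bar> \<le> \<delta>"
proof (rule LIMSEQ_le_const2)
  show "(\<lambda>n. \<bar>mu_seq M T P (\<delta> + h) n - mu_seq M T P h n\<bar>) \<longlonglongrightarrow> \<bar>mu M T P (\<delta> + h) - mu M T P h\<bar>"
    by (intro tendsto_intros mu_seq_tendsto)
  show "\<exists>N. \<forall>n\<ge>N. \<bar>mu_seq M T P (\<delta> + h) n - mu_seq M T P h n\<bar> \<le> \<delta>"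
  proof (intro exI[of _ 1] allI impI)
    fix n :: nat assume n: "1 \<le> n"
    have "\<bar>mu_seq M T P (\<delta> + h) n - mu_seq M T P h n\<bar> = \<bar>log_inv h n - log_inv (\<delta> + h) n\<bar> / real n"
      unfolding mu_seq_eq by (simp add: diff_divide_distrib[symmetric] abs_divide)
    also have "\<dots> \<le> \<delta> * real n / real n"
      using log_inv_shift[OF assms n, of h] by (intro divide_right_mono) auto
    also have "\<dots> = \<delta>" using n by simp
    finally show "\<bar>mu_seq M T P (\<delta> + h) n - mu_seq M T P h n\<bar> \<le> \<delta>" .
  qed
qed

lemma mu_lipschitz: "1-lipschitz_on UNIV (mu M T P)"
proof (rule lipschitz_onI)
  fix x y :: real
  have "\<bar>mu M T P x - mu M T P y\<bar> \<le> \<bar>x - y\<bar>"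
    using mu_shift[of "x - y" y] mu_shift[of "y - x" x] by (cases "y \<le> x") auto
  then show "dist (mu M T P x) (mu M T P y) \<le> 1 * dist x y" by (simp add: dist_real_def)
qed simp

end

theorem proposition1p6:
  fixes M :: "'b measure" and T :: "nat \<Rightarrow> 'b \<Rightarrow> nat" and \<alpha> :: real and l :: "real \<Rightarrow> real"
    and P :: "(nat \<Rightarrow> real) measure"
  assumes renewal: "renewal_process M T \<alpha> l"
    and disorder: "centered_stationary_gaussian P"
    and summable_cov: "summable (\<lambda>a. \<bar>covariance_fun P a\<bar>)"
  shows "(\<forall>h. convergent (mu_seq M T P h) \<and>
              min (ereal (free_energy M T P h / 3))
                  (if gamma_bar P = 0 then \<infinity>
                   else ereal ((free_energy M T P h)\<^sup>2 / (9 * gamma_bar P)))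
                \<le> ereal (mu M T P h) \<and>
              mu M T P h \<le> free_energy M T P h) \<and>
         1-lipschitz_on UNIV (mu M T P)"
  by (intro conjI allI mu_lower_bound[OF assms] mu_le_free_energy[OF assms] mu_lipschitz[OF assms]
      convergentI[OF mu_seq_tendsto[OF assms]])

end
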